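(* For every $m\ge 3$, there exists a set of $9m-16$ homogeneous invariants of degree $6$ in $R(3,m)$ that form a homogeneous system of parameters for $R(3,m)$.
   Context: The ground field is $\mathbb{C}$. $\operatorname{Mat}_{n,n}$ is the space of $n\times n$ complex matrices. The group $\operatorname{SL}_n\times\operatorname{SL}_n$ acts on $\operatorname{Mat}_{n,n}^m$ by $(A,B)\circ(X_1,\dots,X_m)=(AX_1B^{-1},\dots,AX_mB^{-1})$, and $R(n,m)=\mathbb{C}[\operatorname{Mat}_{n,n}^m]^{\operatorname{SL}_n\times\operatorname{SL}_n}$ is the ring of invariant polynomials, graded by the usual degree of polynomials in the matrix entries. A homogeneous system of parameters (hsop) for $R(n,m)$ is a set of algebraically independent homogeneous elements $f_1,\dots,f_d\in R(n,m)$ such that $R(n,m)$ is a finitely generated module over $\mathbb{C}[f_1,\dots,f_d]$. *)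

theory Defs
  imports "HOL-Analysis.Analysis" "HOL-Library.Poly_Mapping"
begin

(* Polynomials with complex coefficients in variables from 'x: finitely supported maps from
   monomials (exponent vectors) to coefficients, with the convolution product of Poly_Mapping. *)
type_synonym 'x cpoly = "('x \<Rightarrow>\<^sub>0 nat) \<Rightarrow>\<^sub>0 complex"

definition const_poly :: "complex \<Rightarrow> 'x cpoly" where
  "const_poly c = Poly_Mapping.single 0 c"

definition poly_vars :: "'x cpoly \<Rightarrow> 'x set" where
  "poly_vars p = (\<Union>u \<in> Poly_Mapping.keys p. Poly_Mapping.keys u)"

definition monom_degree :: "('x \<Rightarrow>\<^sub>0 nat) \<Rightarrow> nat" where
  "monom_degree u = (\<Sum>x \<in> Poly_Mapping.keys u. Poly_Mapping.lookup u x)"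

(* As usual, 0 is homogeneous of every degree. *)
definition homogeneous :: "nat \<Rightarrow> 'x cpoly \<Rightarrow> bool" where
  "homogeneous d p \<longleftrightarrow> (\<forall>u \<in> Poly_Mapping.keys p. monom_degree u = d)"

(* Substitution of elements of a commutative ring for the variables; the map h embeds the
   coefficients (h = id evaluates at complex points, h = const_poly substitutes polynomials). *)
definition poly_subst ::
    "(complex \<Rightarrow> 'a::comm_ring_1) \<Rightarrow> ('x \<Rightarrow> 'a) \<Rightarrow> 'x cpoly \<Rightarrow> 'a" where
  "poly_subst h \<sigma> p = (\<Sum>u \<in> Poly_Mapping.keys p. h (Poly_Mapping.lookup p u) *
      (\<Prod>x \<in> Poly_Mapping.keys u. \<sigma> x ^ Poly_Mapping.lookup u x))"

(* In the next two definitions the elements of F serve as names of the variables of P, and each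
   variable is replaced by the element that it names. *)
definition alg_independent :: "'x cpoly set \<Rightarrow> bool" where
  "alg_independent F \<longleftrightarrow>
     (\<forall>P :: 'x cpoly cpoly. poly_vars P \<subseteq> F \<longrightarrow> poly_subst const_poly (\<lambda>f. f) P = 0 \<longrightarrow> P = 0)"

definition generated_subalgebra :: "'x cpoly set \<Rightarrow> 'x cpoly set" where
  "generated_subalgebra F =
     {poly_subst const_poly (\<lambda>f. f) P | P :: 'x cpoly cpoly. poly_vars P \<subseteq> F}"

definition finitely_generated_module :: "'x cpoly set \<Rightarrow> 'x cpoly set \<Rightarrow> bool" where
  "finitely_generated_module S R \<longleftrightarrow>
     (\<exists>G. finite G \<and> G \<subseteq> R \<and>
        R = {\<Sum>g\<in>G. c g * g | c :: 'x cpoly \<Rightarrow> 'x cpoly. \<forall>g\<in>G. c g \<in> S})"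

definition hsop :: "'x cpoly set \<Rightarrow> 'x cpoly set \<Rightarrow> bool" where
  "hsop R F \<longleftrightarrow>
     finite F \<and> F \<subseteq> R \<and> (\<forall>f\<in>F. \<exists>d. homogeneous d f) \<and> alg_independent F \<and>
     finitely_generated_module (generated_subalgebra F) R"

definition SL :: "(complex^'n^'n) set" where
  "SL = {A. det A = 1}"

(* A tuple (X_1, ..., X_m) of matrices is represented by a sequence X of which only the entries
   X 0, ..., X (m - 1) matter. *)
definition left_right_action ::
    "complex^'n^'n \<Rightarrow> complex^'n^'n \<Rightarrow> (nat \<Rightarrow> complex^'n^'n) \<Rightarrow> (nat \<Rightarrow> complex^'n^'n)" where
  "left_right_action A B X = (\<lambda>k. A ** X k ** matrix_inv B)"

(* The variable (k, i, j) is the (i, j) entry of the k-th matrix. *)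
definition eval_matrices ::
    "(nat \<times> 'n \<times> 'n) cpoly \<Rightarrow> (nat \<Rightarrow> complex^'n^'n) \<Rightarrow> complex" where
  "eval_matrices p X = poly_subst id (\<lambda>(k, i, j). X k $ i $ j) p"

(* The ring R(n, m), where n is the cardinality of 'n. *)
definition matrix_semi_invariants :: "nat \<Rightarrow> (nat \<times> 'n::finite \<times> 'n) cpoly set" where
  "matrix_semi_invariants m =
     {p. poly_vars p \<subseteq> {(k, i, j). k < m} \<and>
         (\<forall>A\<in>SL. \<forall>B\<in>SL. \<forall>X. eval_matrices p (left_right_action A B X) = eval_matrices p X)}"

end

theory Submission
  imports Defs "HOL-Computational_Algebra.Fundamental_Theorem_Algebra"
begin

text \<open>
  The invariants of degree six already cut out the null cone. If \<open>tr (adj X Y adj Z W)\<close> and \<open>det X\<close> vanish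
  on the linear span of the matrices, then bringing a matrix of rank two in the span to the form
  \<open>diag (1, 1, 0)\<close> shows that the span has a shrunk subspace, and a one-parameter subgroup then kills every
  invariant of positive degree.

  Choose a finite system of invariants of degree six that cuts out the null cone and has as few elements as
  possible. A polynomial relation between them would make one of them redundant after a linear change of
  the system, so they are algebraically independent. The ring of invariants is a finite module over the
  algebra that they generate by Hilbert's argument: the Nullstellensatz, the basis theorem, and a
  substitute for the Reynolds operator. For the latter, the Fischer inner product turns the action of
  \<open>SL\<^sub>3 \<times> SL\<^sub>3\<close> into one that is closed under adjoints, so that the adjoint of multiplication by an
  invariant preserves invariants.

  The number of elements is determined by comparing growth rates: restriction to a linear slice of
  dimension \<open>9 m - 16\<close> is injective on invariants, and there are \<open>9 m - 16\<close> algebraically independent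
  invariants.
\<close>

section \<open>Polynomials\<close>

text \<open>Degree six is where two kinds of invariants meet: \<open>tr (adj X Y adj Z W)\<close>
  has degree 2 + 1 + 2 + 1, and \<open>det X\<close>, of degree three, enters through its square.
  The number \<open>9 m - 16\<close> is the dimension of the space of tuples minus the dimension 16
  of the group. Dimension theory is replaced by counting: \<open>d\<close> independent elements give
  \<open>N ^ d\<close> linearly independent products with exponents below \<open>N\<close>, and
  spaces of slower growth cannot hold them. Independence is obtained from minimality because all
  members of the system have the same degree, so that a relation may be taken homogeneous. What
  Hilbert's argument takes from a Reynolds operator is only that an invariant in an ideal generated
  by homogeneous invariants has a representation with invariant coefficients; orthogonal projection
  in each degree provides this. The obstacle in the two counts is that normal forms of tuples exist
  only generically. Each genericity assumption is the nonvanishing of a one-variable polynomial in a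
  perturbation parameter, and continuity removes it.\<close>

abbreviation lookup :: "('a \<Rightarrow>\<^sub>0 'b::zero) \<Rightarrow> 'a \<Rightarrow> 'b" where
  "lookup \<equiv> Poly_Mapping.lookup"

abbreviation keys :: "('a \<Rightarrow>\<^sub>0 'b::zero) \<Rightarrow> 'a set" where
  "keys \<equiv> Poly_Mapping.keys"

abbreviation single :: "'a \<Rightarrow> 'b \<Rightarrow> 'a \<Rightarrow>\<^sub>0 'b::zero" where
  "single \<equiv> Poly_Mapping.single"

definition var :: "'x \<Rightarrow> 'x cpoly" where
  "var x = single (single x 1) 1"

text \<open>The target is any commutative monoid: the same monomials are multiplied out in numbers,
  in polynomials, and in the natural numbers that encode exponents.\<close>

definition mpow :: "('x \<Rightarrow> 'a::comm_monoid_mult) \<Rightarrow> ('x \<Rightarrow>\<^sub>0 nat) \<Rightarrow> 'a" where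
  "mpow \<sigma> u = (\<Prod>x \<in> keys u. \<sigma> x ^ lookup u x)"

lemma keys_nonempty: "p \<noteq> 0 \<Longrightarrow> \<exists>x. x \<in> keys p"
  by (rule ccontr) (auto simp: in_keys_iff intro: poly_mapping_eqI)

lemma keys_plus_nat: "keys (u + v :: 'x \<Rightarrow>\<^sub>0 nat) = keys u \<union> keys v"
  by (auto simp: in_keys_iff lookup_add)

lemma mpow_superset:
  assumes "finite S" "keys u \<subseteq> S"
  shows "mpow \<sigma> u = (\<Prod>x \<in> S. \<sigma> x ^ lookup u x)"
  unfolding mpow_def using assms
  by (intro prod.mono_neutral_left) (auto simp: in_keys_iff)

lemma mpow_add: "mpow \<sigma> (u + v) = mpow \<sigma> u * mpow \<sigma> v"
proof -
  let ?S = "keys u \<union> keys v"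
  have "mpow \<sigma> (u + v) = (\<Prod>x\<in>?S. \<sigma> x ^ lookup (u + v) x)"
    by (rule mpow_superset) (auto simp: keys_plus_nat)
  also have "\<dots> = (\<Prod>x\<in>?S. \<sigma> x ^ lookup u x) * (\<Prod>x\<in>?S. \<sigma> x ^ lookup v x)"
    by (simp add: lookup_add power_add prod.distrib)
  also have "\<dots> = mpow \<sigma> u * mpow \<sigma> v"
    by (simp add: mpow_superset[where S = ?S, symmetric])
  finally show ?thesis .
qed

lemma mpow_0 [simp]: "mpow \<sigma> 0 = 1"
  by (simp add: mpow_def)

lemma mpow_single [simp]: "mpow \<sigma> (single x n) = \<sigma> x ^ n"
  by (cases "n = 0") (simp_all add: mpow_def)

lemma mpow_cong: "(\<And>x. x \<in> keys u \<Longrightarrow> \<sigma> x = \<tau> x) \<Longrightarrow> mpow \<sigma> u = mpow \<tau> u"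
  by (simp add: mpow_def)

lemma monom_degree_superset:
  assumes "finite S" "keys u \<subseteq> S"
  shows "monom_degree u = (\<Sum>x \<in> S. lookup u x)"
  unfolding monom_degree_def using assms
  by (intro sum.mono_neutral_left) (auto simp: in_keys_iff)

lemma monom_degree_add: "monom_degree (u + v) = monom_degree u + monom_degree v"
proof -
  let ?S = "keys u \<union> keys v"
  have "monom_degree (u + v) = (\<Sum>x\<in>?S. lookup (u + v) x)"
    by (rule monom_degree_superset) (auto simp: keys_plus_nat)
  also have "\<dots> = monom_degree u + monom_degree v"
    by (simp add: lookup_add sum.distrib monom_degree_superset[where S = ?S, symmetric])
  finally show ?thesis .
qed

lemma monom_degree_0 [simp]: "monom_degree 0 = 0"
  by (simp add: monom_degree_def)

lemma monom_degree_single [simp]: "monom_degree (single x n) = n"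
  by (cases "n = 0") (simp_all add: monom_degree_def)

lemma monom_degree_eq_0_iff: "monom_degree u = 0 \<longleftrightarrow> u = 0"
proof
  assume "monom_degree u = 0"
  then have "lookup u x = 0" for x
    by (cases "x \<in> keys u") (simp_all add: monom_degree_def in_keys_iff)
  then show "u = 0" by (intro poly_mapping_eqI) simp
qed simp

lemma lookup_le_monom_degree: "lookup u x \<le> monom_degree u"
proof (cases "x \<in> keys u")
  case True
  then show ?thesis unfolding monom_degree_def by (intro member_le_sum) auto
qed (simp add: in_keys_iff)

lemma monom_split:
  assumes "x \<in> keys (u :: 'x \<Rightarrow>\<^sub>0 nat)"
  obtains v where "u = single x 1 + v"
proof
  show "u = single x 1 + (u - single x 1)"
    using assms by (intro poly_mapping_eqI) (auto simp: lookup_add lookup_minus lookup_single in_keys_iff when_def)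
qed

lemma monom_induct [case_names zero step]:
  fixes u :: "'x \<Rightarrow>\<^sub>0 nat"
  assumes "P 0" and "\<And>x v. P v \<Longrightarrow> P (single x 1 + v)"
  shows "P u"
proof (induction "monom_degree u" arbitrary: u)
  case 0
  then have "u = 0" by (simp add: monom_degree_eq_0_iff)
  then show ?case using assms(1) by simp
next
  case (Suc n)
  then have "u \<noteq> 0" by auto
  then obtain x where "x \<in> keys u" by (metis keys_nonempty)
  then obtain v where v: "u = single x 1 + v" by (rule monom_split)
  then have "n = monom_degree v" using Suc.hyps(2) by (simp add: monom_degree_add)
  then have "P v" by (rule Suc.hyps(1))
  then show ?case unfolding v by (rule assms(2))
qed

lemma cpoly_sum_monomials:
  "(\<Sum>u\<in>keys p. single u (lookup p u)) = p"
proof (intro poly_mapping_eqI)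
  fix v
  have "lookup (\<Sum>u\<in>keys p. single u (lookup p u)) v
      = (\<Sum>u\<in>keys p. if u = v then lookup p u else 0)"
    by (simp add: lookup_sum lookup_single when_def)
  also have "\<dots> = lookup p v"
    by (subst sum.delta) (simp_all add: in_keys_iff)
  finally show "lookup (\<Sum>u\<in>keys p. single u (lookup p u)) v
      = lookup p v" .
qed

lemma const_poly_add: "const_poly (a + b) = const_poly a + const_poly b"
  by (simp add: const_poly_def single_add)
lemma const_poly_mult: "const_poly (a * b) = const_poly a * const_poly b"
  by (simp add: const_poly_def mult_single)
lemma const_poly_0 [simp]: "const_poly 0 = 0"
  by (simp add: const_poly_def)
lemma const_poly_1 [simp]: "const_poly 1 = 1"
  by (simp add: const_poly_def)

lemma lookup_const_mult: "lookup (const_poly c * p) u = c * lookup p u"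
  unfolding const_poly_def mult_map_scale_conv_mult[symmetric]
  by (simp add: Poly_Mapping.map.rep_eq when_def)

text \<open>Products are built one variable at a time, so that a claim about substitution,
  differentiation or adjoints has to be checked only for \<open>var x * p\<close> and never for a
  product of two general polynomials.\<close>

lemma cpoly_induct [case_names const add var]:
  assumes "\<And>c. P (const_poly c)" "\<And>p q. P p \<Longrightarrow> P q \<Longrightarrow> P (p + q)"
    "\<And>x p. P p \<Longrightarrow> P (var x * p)"
  shows "P p"
proof -
  have mono: "P (single u c)" for u c
  proof (induction u rule: monom_induct)
    case zero
    then show ?case using assms(1)[of c] by (simp add: const_poly_def)
  next
    case (step x v)
    then show ?case using assms(3)[OF step, of x] by (simp add: var_def mult_single)
  qed
  have "P (\<Sum>u\<in>S. single u (lookup p u))" if "finite S" for S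
    using that
  proof induction
    case empty
    then show ?case using assms(1)[of 0] by simp
  qed (simp add: mono assms(2))
  from this[of "keys p"] show ?thesis by (simp add: cpoly_sum_monomials)
qed

text \<open>Evaluation at a point and substitution of polynomials differ only in how coefficients
  are embedded; the laws of substitution are proved once for both.\<close>

locale coeff_hom =
  fixes h :: "complex \<Rightarrow> 'a::comm_ring_1"
  assumes h_add: "h (a + b) = h a + h b" and h_mult: "h (a * b) = h a * h b" and h_1: "h 1 = 1"
begin

lemma h_0: "h 0 = 0"
  using h_add[of 0 0] by simp

lemma subst_superset:
  assumes "finite S" "keys p \<subseteq> S"
  shows "poly_subst h \<sigma> p = (\<Sum>u \<in> S. h (lookup p u) * mpow \<sigma> u)"
  unfolding poly_subst_def mpow_def[symmetric] using assms
  by (intro sum.mono_neutral_left) (auto simp: in_keys_iff h_0)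

lemma subst_add: "poly_subst h \<sigma> (p + q) = poly_subst h \<sigma> p + poly_subst h \<sigma> q"
proof -
  let ?S = "keys p \<union> keys q"
  have "poly_subst h \<sigma> (p + q) = (\<Sum>u \<in> ?S. h (lookup (p + q) u) * mpow \<sigma> u)"
    by (rule subst_superset) (use Poly_Mapping.keys_add[of p q] in auto)
  also have "\<dots> = poly_subst h \<sigma> p + poly_subst h \<sigma> q"
    by (simp add: subst_superset[where S = ?S] lookup_add h_add algebra_simps sum.distrib)
  finally show ?thesis .
qed

lemma subst_single: "poly_subst h \<sigma> (single u c) = h c * mpow \<sigma> u"
  by (subst subst_superset[where S = "{u}"]) auto

lemma subst_const: "poly_subst h \<sigma> (const_poly c) = h c"
  by (simp add: const_poly_def subst_single)

lemma subst_0: "poly_subst h \<sigma> 0 = 0"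
  by (simp add: poly_subst_def)

lemma subst_1: "poly_subst h \<sigma> 1 = 1"
  using subst_const[of \<sigma> 1] by (simp add: h_1)

lemma subst_var: "poly_subst h \<sigma> (var x) = \<sigma> x"
  by (simp add: var_def subst_single h_1)

lemma subst_sum: "poly_subst h \<sigma> (sum f A) = (\<Sum>i\<in>A. poly_subst h \<sigma> (f i))"
  by (induction A rule: infinite_finite_induct) (auto simp: subst_0 subst_add)

lemma subst_uminus: "poly_subst h \<sigma> (- p) = - poly_subst h \<sigma> p"
  using subst_add[of \<sigma> p "- p"] by (simp add: subst_0 eq_neg_iff_add_eq_0 add.commute)

lemma subst_diff: "poly_subst h \<sigma> (p - q) = poly_subst h \<sigma> p - poly_subst h \<sigma> q"
  using subst_add[of \<sigma> p "- q"] by (simp add: subst_uminus)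

lemma subst_const_mult: "poly_subst h \<sigma> (const_poly c * p) = h c * poly_subst h \<sigma> p"
proof -
  have "keys (const_poly c * p) \<subseteq> keys p"
    by (auto simp: in_keys_iff lookup_const_mult)
  then show ?thesis
    by (simp add: subst_superset[where S = "keys p"] lookup_const_mult h_mult sum_distrib_left mult.assoc)
qed

lemma subst_var_mult: "poly_subst h \<sigma> (var x * p) = \<sigma> x * poly_subst h \<sigma> p"
proof -
  have "var x * p = (\<Sum>u\<in>keys p. single (single x 1 + u) (lookup p u))"
    by (subst cpoly_sum_monomials[of p, symmetric]) (simp add: sum_distrib_left var_def mult_single)
  then show ?thesis
    by (simp add: subst_sum subst_single mpow_add sum_distrib_left mult_ac
        subst_superset[where S = "keys p"])
qed

lemma subst_mult: "poly_subst h \<sigma> (p * q) = poly_subst h \<sigma> p * poly_subst h \<sigma> q"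
  by (induction p rule: cpoly_induct)
    (simp_all add: subst_const subst_const_mult subst_add distrib_right subst_var_mult subst_var mult.assoc)

lemma subst_power: "poly_subst h \<sigma> (p ^ n) = poly_subst h \<sigma> p ^ n"
  by (induction n) (simp_all add: subst_1 subst_mult)

lemma subst_prod: "poly_subst h \<sigma> (prod f A) = (\<Prod>i\<in>A. poly_subst h \<sigma> (f i))"
  by (induction A rule: infinite_finite_induct) (auto simp: subst_1 subst_mult)

lemma subst_mpow: "poly_subst h \<sigma> (mpow f u) = mpow (\<lambda>x. poly_subst h \<sigma> (f x)) u"
  by (simp add: mpow_def subst_prod subst_power)

lemma subst_of_nat: "poly_subst h \<sigma> (of_nat n) = of_nat n"
  by (induction n) (simp_all add: subst_0 subst_1 subst_add)

lemma subst_numeral: "poly_subst h \<sigma> (numeral n) = numeral n"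
  using subst_of_nat[of \<sigma> "numeral n"] by simp

lemma subst_cong:
  assumes "\<And>x. x \<in> poly_vars p \<Longrightarrow> \<sigma> x = \<tau> x"
  shows "poly_subst h \<sigma> p = poly_subst h \<tau> p"
  unfolding poly_subst_def mpow_def[symmetric]
  by (intro sum.cong arg_cong2[where f = "(*)"] mpow_cong assms) (auto simp: poly_vars_def)

lemmas subst_simps = subst_add subst_const subst_0 subst_1 subst_var subst_sum subst_uminus subst_diff
  subst_mult subst_power subst_prod subst_mpow subst_numeral subst_of_nat

end

interpretation ev: coeff_hom "id :: complex \<Rightarrow> complex"
  by unfold_locales auto

interpretation sb: coeff_hom "const_poly :: complex \<Rightarrow> 'x cpoly"
  by unfold_locales (auto simp: const_poly_add const_poly_mult)

definition eval :: "('x \<Rightarrow> complex) \<Rightarrow> 'x cpoly \<Rightarrow> complex" where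
  "eval \<sigma> p = poly_subst id \<sigma> p"

lemmas eval_simps = ev.subst_add[folded eval_def] ev.subst_const[folded eval_def, unfolded id_apply]
  ev.subst_0[folded eval_def] ev.subst_1[folded eval_def] ev.subst_var[folded eval_def]
  ev.subst_sum[folded eval_def] ev.subst_uminus[folded eval_def] ev.subst_diff[folded eval_def]
  ev.subst_mult[folded eval_def] ev.subst_power[folded eval_def] ev.subst_prod[folded eval_def]
  ev.subst_mpow[folded eval_def] ev.subst_numeral[folded eval_def] ev.subst_of_nat[folded eval_def]
lemmas eval_cong = ev.subst_cong[folded eval_def]

abbreviation sbst :: "('x \<Rightarrow> 'y cpoly) \<Rightarrow> 'x cpoly \<Rightarrow> 'y cpoly" where
  "sbst \<tau> p \<equiv> poly_subst const_poly \<tau> p"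

lemma eval_sbst: "eval \<sigma> (sbst \<tau> p) = eval (\<lambda>x. eval \<sigma> (\<tau> x)) p"
  by (induction p rule: cpoly_induct) (simp_all add: eval_simps sb.subst_simps)

section \<open>Polynomials in prescribed variables and homogeneous components\<close>

definition cpolys_in :: "'x set \<Rightarrow> 'x cpoly set" where
  "cpolys_in V = {p. poly_vars p \<subseteq> V}"

lemma cpolys_in_iff: "p \<in> cpolys_in V \<longleftrightarrow> (\<forall>u\<in>keys p. keys u \<subseteq> V)"
  by (auto simp: cpolys_in_def poly_vars_def)

lemma cpolys_in_add [intro]: "p \<in> cpolys_in V \<Longrightarrow> q \<in> cpolys_in V \<Longrightarrow> p + q \<in> cpolys_in V"
  using Poly_Mapping.keys_add[of p q] by (auto simp: cpolys_in_iff)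
lemma cpolys_in_const [intro, simp]: "const_poly c \<in> cpolys_in V"
  by (auto simp: cpolys_in_iff const_poly_def split: if_splits)
lemma cpolys_in_0 [intro, simp]: "0 \<in> cpolys_in V"
  by (auto simp: cpolys_in_iff)
lemma cpolys_in_1 [intro, simp]: "1 \<in> cpolys_in V"
  by (auto simp: cpolys_in_iff)
lemma cpolys_in_var [intro]: "x \<in> V \<Longrightarrow> var x \<in> cpolys_in V"
  by (auto simp: cpolys_in_iff var_def)
lemma cpolys_in_mult [intro]: "p \<in> cpolys_in V \<Longrightarrow> q \<in> cpolys_in V \<Longrightarrow> p * q \<in> cpolys_in V"
  using Poly_Mapping.keys_mult[of p q] by (fastforce simp: cpolys_in_iff keys_plus_nat)
lemma cpolys_in_uminus [intro]: "p \<in> cpolys_in V \<Longrightarrow> - p \<in> cpolys_in V"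
  by (auto simp: cpolys_in_iff in_keys_iff)
lemma cpolys_in_diff [intro]: "p \<in> cpolys_in V \<Longrightarrow> q \<in> cpolys_in V \<Longrightarrow> p - q \<in> cpolys_in V"
  using cpolys_in_add[of p V "- q"] by (simp add: cpolys_in_uminus)
lemma cpolys_in_sum [intro]: "(\<And>i. i \<in> A \<Longrightarrow> f i \<in> cpolys_in V) \<Longrightarrow> sum f A \<in> cpolys_in V"
  by (induction A rule: infinite_finite_induct) auto
lemma cpolys_in_prod [intro]: "(\<And>i. i \<in> A \<Longrightarrow> f i \<in> cpolys_in V) \<Longrightarrow> prod f A \<in> cpolys_in V"
  by (induction A rule: infinite_finite_induct) auto
lemma cpolys_in_power [intro]: "p \<in> cpolys_in V \<Longrightarrow> p ^ n \<in> cpolys_in V"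
  by (induction n) auto

lemma cpolys_in_sbst:
  assumes "\<And>x. x \<in> poly_vars p \<Longrightarrow> \<sigma> x \<in> cpolys_in V"
  shows "sbst \<sigma> p \<in> cpolys_in V"
  unfolding poly_subst_def using assms
  by (intro cpolys_in_sum cpolys_in_mult cpolys_in_prod cpolys_in_power) (auto simp: poly_vars_def)

lemma homogeneous_add [intro]: "homogeneous d p \<Longrightarrow> homogeneous d q \<Longrightarrow> homogeneous d (p + q)"
  using Poly_Mapping.keys_add[of p q] by (auto simp: homogeneous_def)
lemma homogeneous_0 [intro, simp]: "homogeneous d 0"
  by (auto simp: homogeneous_def)
lemma homogeneous_const [intro, simp]: "homogeneous 0 (const_poly c)"
  by (auto simp: homogeneous_def const_poly_def split: if_splits)
lemma homogeneous_1 [intro, simp]: "homogeneous 0 1"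
  by (auto simp: homogeneous_def)
lemma homogeneous_var [intro, simp]: "homogeneous 1 (var x)"
  by (auto simp: homogeneous_def var_def)
lemma homogeneous_mult [intro]: "homogeneous d p \<Longrightarrow> homogeneous e q \<Longrightarrow> homogeneous (d + e) (p * q)"
  using Poly_Mapping.keys_mult[of p q] by (fastforce simp: homogeneous_def monom_degree_add)
lemma homogeneous_const_mult [intro]: "homogeneous d p \<Longrightarrow> homogeneous d (const_poly c * p)"
  using homogeneous_mult[of 0 "const_poly c" d p] by simp
lemma homogeneous_uminus [intro]: "homogeneous d p \<Longrightarrow> homogeneous d (- p)"
  by (auto simp: homogeneous_def in_keys_iff)
lemma homogeneous_diff [intro]: "homogeneous d p \<Longrightarrow> homogeneous d q \<Longrightarrow> homogeneous d (p - q)"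
  using homogeneous_add[of d p "- q"] by (simp add: homogeneous_uminus)
lemma homogeneous_sum [intro]: "(\<And>i. i \<in> A \<Longrightarrow> homogeneous d (f i)) \<Longrightarrow> homogeneous d (sum f A)"
  by (induction A rule: infinite_finite_induct) auto
lemma homogeneous_power [intro]: "homogeneous d p \<Longrightarrow> homogeneous (d * n) (p ^ n)"
  by (induction n) (auto dest: homogeneous_mult)

lemma homogeneous_mpow:
  assumes "\<And>x. x \<in> keys u \<Longrightarrow> homogeneous d (f x)"
  shows "homogeneous (d * monom_degree u) (mpow f u)"
  using assms
proof (induction u rule: monom_induct)
  case (step x v)
  then have "homogeneous (d + d * monom_degree v) (f x * mpow f v)"
    by (intro homogeneous_mult step.IH) (auto simp: keys_plus_nat)
  then show ?case by (simp add: mpow_add monom_degree_add)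
qed auto

lemma homogeneous_sbst:
  assumes "homogeneous e p" "\<And>x. x \<in> poly_vars p \<Longrightarrow> homogeneous d (\<sigma> x)"
  shows "homogeneous (d * e) (sbst \<sigma> p)"
  unfolding poly_subst_def mpow_def[symmetric]
proof (intro homogeneous_sum homogeneous_const_mult)
  fix u assume u: "u \<in> keys p"
  then have "homogeneous (d * monom_degree u) (mpow \<sigma> u)"
    by (intro homogeneous_mpow assms(2)) (auto simp: poly_vars_def)
  then show "homogeneous (d * e) (mpow \<sigma> u)" using assms(1) u by (simp add: homogeneous_def)
qed

definition hcomp :: "nat \<Rightarrow> 'x cpoly \<Rightarrow> 'x cpoly" where
  "hcomp d p = (\<Sum>u\<in>{u\<in>keys p. monom_degree u = d}. single u (lookup p u))"

lemma lookup_hcomp: "lookup (hcomp d p) u = (if monom_degree u = d then lookup p u else 0)"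
proof -
  let ?K = "{u\<in>keys p. monom_degree u = d}"
  have "lookup (hcomp d p) u = (\<Sum>v\<in>?K. if v = u then lookup p v else 0)"
    by (simp add: hcomp_def lookup_sum lookup_single when_def)
  also have "\<dots> = (if u \<in> ?K then lookup p u else 0)"
    by (subst sum.delta) simp_all
  finally show ?thesis by (simp add: in_keys_iff)
qed

lemma hcomp_add: "hcomp d (p + q) = hcomp d p + hcomp d q"
  by (intro poly_mapping_eqI) (auto simp: lookup_hcomp lookup_add)
lemma hcomp_0 [simp]: "hcomp d 0 = 0"
  by (intro poly_mapping_eqI) (auto simp: lookup_hcomp)
lemma hcomp_sum: "hcomp d (sum f A) = (\<Sum>i\<in>A. hcomp d (f i))"
  by (induction A rule: infinite_finite_induct) (auto simp: hcomp_add)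
lemma homogeneous_hcomp [intro, simp]: "homogeneous d (hcomp d p)"
  by (auto simp: homogeneous_def in_keys_iff lookup_hcomp split: if_splits)
lemma cpolys_in_hcomp [intro]: "p \<in> cpolys_in V \<Longrightarrow> hcomp d p \<in> cpolys_in V"
  by (auto simp: cpolys_in_iff in_keys_iff lookup_hcomp split: if_splits)
lemma hcomp_homogeneous: "homogeneous e p \<Longrightarrow> hcomp d p = (if d = e then p else 0)"
  by (intro poly_mapping_eqI) (auto simp: lookup_hcomp homogeneous_def in_keys_iff)

lemma hcomp_decomp:
  assumes "\<And>u. u \<in> keys p \<Longrightarrow> monom_degree u \<le> D"
  shows "p = (\<Sum>d\<le>D. hcomp d p)"
  using assms
  by (intro poly_mapping_eqI) (auto simp: lookup_sum lookup_hcomp in_keys_iff)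

lemma ex_degree_bound: "\<exists>D. \<forall>u \<in> keys p. monom_degree u \<le> D"
proof -
  have "finite (monom_degree ` keys p)" by simp
  then show ?thesis by (metis finite_nat_set_iff_bounded_le imageI)
qed

lemma ex_hcomp_decomp: "\<exists>D. p = (\<Sum>d\<le>D. hcomp d p)"
  by (metis ex_degree_bound hcomp_decomp)

lemma hcomp_mult:
  assumes "homogeneous e q"
  shows "hcomp d (p * q) = (if e \<le> d then hcomp (d - e) p * q else 0)"
proof -
  obtain D where D: "p = (\<Sum>d\<le>D. hcomp d p)" using ex_hcomp_decomp by blast
  have "hcomp d (p * q) = (\<Sum>i\<le>D. hcomp d (hcomp i p * q))"
    by (subst D) (simp add: sum_distrib_right hcomp_sum)
  also have "\<dots> = (\<Sum>i\<le>D. if d = i + e then hcomp i p * q else 0)"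
    by (intro sum.cong refl hcomp_homogeneous homogeneous_mult assms homogeneous_hcomp)
  also have "\<dots> = (if e \<le> d then hcomp (d - e) p * q else 0)"
  proof (cases "e \<le> d")
    case True
    \<comment> \<open>The index \<open>d - e\<close> may exceed the range of the sum; the component
      is then zero, so that the formula needs no upper bound on \<open>d\<close>.\<close>
    have "hcomp (d - e) p = 0" if "d - e > D"
      using that by (subst D) (auto simp: hcomp_sum hcomp_homogeneous[OF homogeneous_hcomp])
    moreover have "(\<Sum>i\<le>D. if d = i + e then hcomp i p * q else 0) =
        (\<Sum>i\<le>D. if i = d - e then hcomp i p * q else 0)"
      using True by (intro sum.cong) auto
    ultimately show ?thesis using True by auto
  next
    case False
    then show ?thesis by (auto intro!: sum.neutral)
  qed
  finally show ?thesis .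
qed

lemma eval_homogeneous:
  assumes "homogeneous d p"
  shows "eval (\<lambda>x. t * \<sigma> x) p = t ^ d * eval \<sigma> p"
proof -
  have "mpow (\<lambda>x. t * \<sigma> x) u = t ^ monom_degree u * mpow \<sigma> u" for u
    by (simp add: mpow_def monom_degree_def power_mult_distrib prod.distrib power_sum)
  then show ?thesis using assms
    by (auto simp: eval_def poly_subst_def mpow_def[symmetric] homogeneous_def sum_distrib_left mult_ac intro!: sum.cong)
qed

section \<open>Formal partial derivatives, and equality of polynomials by values\<close>

definition pdiff :: "'x \<Rightarrow> 'x cpoly \<Rightarrow> 'x cpoly" where
  "pdiff x p = Abs_poly_mapping (\<lambda>u. of_nat (lookup u x + 1) *
     lookup p (u + single x 1))"

lemma lookup_pdiff: "lookup (pdiff x p) u =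
    of_nat (lookup u x + 1) * lookup p (u + single x 1)"
proof -
  have "inj (\<lambda>u :: 'a \<Rightarrow>\<^sub>0 nat. u + single x 1)" by (auto simp: inj_def)
  then have "finite ((\<lambda>u. u + single x 1) -` keys p)"
    by (intro finite_vimageI) auto
  then have "finite {u. of_nat (lookup u x + 1) *
     lookup p (u + single x 1) \<noteq> 0}"
    by (rule rev_finite_subset) (auto simp: in_keys_iff)
  then show ?thesis unfolding pdiff_def by simp
qed

lemma pdiff_add: "pdiff x (p + q) = pdiff x p + pdiff x q"
  by (intro poly_mapping_eqI) (simp add: lookup_pdiff lookup_add algebra_simps)

lemma pdiff_const [simp]: "pdiff x (const_poly c) = 0"
proof (intro poly_mapping_eqI)
  fix u :: "'a \<Rightarrow>\<^sub>0 nat"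
  have "u + single x 1 \<noteq> 0"
    by (metis add_eq_0_iff_both_eq_0 monom_degree_0 monom_degree_add monom_degree_single one_neq_zero)
  then show "lookup (pdiff x (const_poly c)) u = lookup 0 u"
    by (simp add: lookup_pdiff const_poly_def lookup_single when_def)
qed

lemma pdiff_0 [simp]: "pdiff x 0 = 0"
  using pdiff_const[of x 0] by simp

lemma pdiff_sum: "pdiff x (sum f A) = (\<Sum>i\<in>A. pdiff x (f i))"
  by (induction A rule: infinite_finite_induct) (auto simp: pdiff_add)

lemma pdiff_const_mult: "pdiff x (const_poly c * p) = const_poly c * pdiff x p"
  by (intro poly_mapping_eqI) (simp add: lookup_pdiff lookup_const_mult)

lemma lookup_var_mult_add: "lookup (var y * p) (single y 1 + u) = lookup p u"
proof -
  have "var y * p = (\<Sum>v\<in>keys p. single (single y 1 + v) (lookup p v))"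
    by (subst cpoly_sum_monomials[of p, symmetric]) (simp add: sum_distrib_left var_def mult_single)
  then have "lookup (var y * p) (single y 1 + u)
      = (\<Sum>v\<in>keys p. if v = u then lookup p v else 0)"
    by (simp add: lookup_sum lookup_single when_def)
  also have "\<dots> = lookup p u"
    by (subst sum.delta) (simp_all add: in_keys_iff)
  finally show ?thesis .
qed

lemma lookup_var_mult_0:
  assumes "lookup u y = 0"
  shows "lookup (var y * p) u = 0"
proof -
  have *: "var y * p = (\<Sum>v\<in>keys p. single (single y 1 + v) (lookup p v))"
    by (subst cpoly_sum_monomials[of p, symmetric]) (simp add: sum_distrib_left var_def mult_single)
  have "single y 1 + v \<noteq> u" for v
    using assms by (auto simp: lookup_add)
  then show ?thesis unfolding *
    by (auto simp: lookup_sum lookup_single when_def intro!: sum.neutral)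
qed

lemma pdiff_var_mult: "pdiff x (var y * p) = (if x = y then p else 0) + var y * pdiff x p"
proof (intro poly_mapping_eqI)
  fix u :: "'a \<Rightarrow>\<^sub>0 nat"
  show "lookup (pdiff x (var y * p)) u =
        lookup ((if x = y then p else 0) + var y * pdiff x p) u"
  proof (cases "lookup u y = 0")
    case True
    show ?thesis
    proof (cases "x = y")
      case True
      then show ?thesis using \<open>lookup u y = 0\<close>
        using lookup_var_mult_add[of y p u]
        by (simp add: lookup_pdiff lookup_add lookup_var_mult_0 add.commute)
    next
      case False
      then have "lookup (u + single x 1) y = 0"
        using True by (simp add: lookup_add lookup_single)
      then show ?thesis using False True
        by (simp add: lookup_pdiff lookup_add lookup_var_mult_0)
    qed
  next
    case False
    then obtain v where v: "u = single y 1 + v"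
      using monom_split[of y u] by (auto simp: in_keys_iff)
    have e: "u + single x 1 = single y 1 + (v + single x 1)"
      by (simp add: v add_ac)
    have a: "lookup (var y * pdiff x p) u = lookup (pdiff x p) v"
      unfolding v by (rule lookup_var_mult_add)
    show ?thesis unfolding lookup_add a lookup_pdiff e lookup_var_mult_add
      by (simp add: v lookup_add lookup_single when_def algebra_simps)
  qed
qed

lemma cpolys_in_pdiff [intro]: 
  assumes "p \<in> cpolys_in V" shows "pdiff x p \<in> cpolys_in V"
  unfolding cpolys_in_iff
proof
  fix u assume "u \<in> keys (pdiff x p)"
  then have "u + single x 1 \<in> keys p" by (auto simp: in_keys_iff lookup_pdiff)
  then have "keys (u + single x 1) \<subseteq> V" using assms by (auto simp: cpolys_in_iff)
  then show "keys u \<subseteq> V" by (simp add: keys_plus_nat)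
qed

lemma eval_pdiff: "((\<lambda>t. eval (\<sigma>(x := t)) p) has_field_derivative eval (\<sigma>(x := t)) (pdiff x p)) (at t)"
proof (induction p rule: cpoly_induct)
  case (const c)
  then show ?case by (simp add: eval_simps)
next
  case (add p q)
  then show ?case by (simp add: eval_simps pdiff_add DERIV_add)
next
  case (var y p)
  show ?case
  proof (cases "x = y")
    case True
    have "((\<lambda>t. t * eval (\<sigma>(x := t)) p) has_field_derivative
        (eval (\<sigma>(x := t)) p + t * eval (\<sigma>(x := t)) (pdiff x p))) (at t)"
      using DERIV_mult[OF DERIV_ident var] by (simp add: mult.commute fun_upd_def)
    then show ?thesis using True by (simp add: eval_simps pdiff_var_mult fun_upd_def)
  next
    case False
    then show ?thesis using DERIV_cmult[OF var, of "\<sigma> y"] by (simp add: eval_simps pdiff_var_mult)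
  qed
qed

text \<open>Induction on the degree: if all values of \<open>p\<close> vanish, so do those of its
  partial derivatives, which have smaller degree and are zero by induction; what remains is a
  constant.\<close>

theorem cpoly_eqI_eval_0:
  assumes "\<And>\<sigma>. eval \<sigma> p = 0"
  shows "p = 0"
proof -
  have "p = 0" if "\<forall>u \<in> keys p. monom_degree u < n" "\<And>\<sigma>. eval \<sigma> p = 0" for n and p :: "'a cpoly"
    using that
  proof (induction n arbitrary: p)
    case 0
    then show ?case by (metis keys_nonempty less_nat_zero_code)
  next
    case (Suc n)
    have D: "pdiff x p = 0" for x
    proof (rule Suc.IH)
      show "\<forall>u\<in>keys (pdiff x p). monom_degree u < n"
      proof
        fix u assume "u \<in> keys (pdiff x p)"
        then have "u + single x 1 \<in> keys p" by (auto simp: in_keys_iff lookup_pdiff)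
        then show "monom_degree u < n" using Suc.prems(1) by (auto simp: monom_degree_add)
      qed
      fix \<sigma> :: "'a \<Rightarrow> complex"
      have "((\<lambda>t. eval (\<sigma>(x := t)) p) has_field_derivative eval (\<sigma>(x := \<sigma> x)) (pdiff x p)) (at (\<sigma> x))"
        by (rule eval_pdiff)
      moreover have "((\<lambda>t. eval (\<sigma>(x := t)) p) has_field_derivative 0) (at (\<sigma> x))"
        by (simp add: Suc.prems(2))
      ultimately show "eval \<sigma> (pdiff x p) = 0" using DERIV_unique by fastforce
    qed
    have "lookup p u = 0" if u: "u \<noteq> 0" for u
    proof -
      obtain x where "x \<in> keys u" using keys_nonempty[OF u] by blast
      then obtain v where v: "u = single x 1 + v" by (rule monom_split)
      \<comment> \<open>The derivative multiplies the coefficient of \<open>u\<close> by a positive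
        integer, which is invertible in characteristic zero.\<close>
      have "lookup (pdiff x p) v = 0" by (simp add: D)
      then show ?thesis unfolding lookup_pdiff by (metis v add.commute mult_eq_0_iff of_nat_eq_0_iff Suc_eq_plus1 nat.distinct(1))
    qed
    then have "p = const_poly (lookup p 0)"
      by (intro poly_mapping_eqI) (auto simp: const_poly_def lookup_single when_def)
    then show ?case using Suc.prems(2) by (metis const_poly_0 eval_simps)
  qed
  then show ?thesis using ex_degree_bound[of p] assms by (metis le_imp_less_Suc)
qed

lemma cpoly_eqI_eval: "(\<And>\<sigma>. eval \<sigma> p = eval \<sigma> q) \<Longrightarrow> p = q"
  using cpoly_eqI_eval_0[of "p - q"] by (simp add: eval_simps)

section \<open>Hilbert basis theorem and Nullstellensatz\<close>

lemma const_poly_uminus: "const_poly (- b) = - const_poly b"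
  by (intro poly_mapping_eqI) (simp add: const_poly_def lookup_single when_def)

text \<open>Gaussian elimination: an equation \<open>b\<close> that is not identically zero is
  solved for the unknown \<open>a0\<close>, which leaves one equation and one unknown less.\<close>

lemma lin_dep:
  fixes M :: "'a \<Rightarrow> 'b \<Rightarrow> complex"
  assumes "finite B" "finite A" "card B < card A"
  shows "\<exists>c. (\<exists>a\<in>A. c a \<noteq> 0) \<and> (\<forall>b\<in>B. (\<Sum>a\<in>A. c a * M a b) = 0)"
  using assms
proof (induction B arbitrary: A M rule: finite_induct)
  case empty
  then obtain a where "a \<in> A" by fastforce
  then show ?case by (intro exI[of _ "\<lambda>_. 1 :: complex"] conjI bexI[of _ a]) simp_all
next
  case (insert b B)
  show ?case
  proof (cases "\<forall>a\<in>A. M a b = 0")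
    case True
    have "card B < card A" using insert.prems(2) insert.hyps by simp
    then obtain c where "\<exists>a\<in>A. c a \<noteq> 0" "\<forall>b\<in>B. (\<Sum>a\<in>A. c a * M a b) = 0"
      using insert.IH[OF insert.prems(1), of M] by blast
    moreover have "(\<Sum>a\<in>A. c a * M a b) = 0" using True by simp
    ultimately show ?thesis by blast
  next
    case False
    then obtain a0 where a0: "a0 \<in> A" "M a0 b \<noteq> 0" by blast
    define A' where "A' = A - {a0}"
    define M' where "M' a b' = M a b' - M a b / M a0 b * M a0 b'" for a b'
    have A: "A = insert a0 A'" "a0 \<notin> A'" "finite A'" using a0 insert.prems by (auto simp: A'_def)
    have "card B < card A'" using insert.prems insert.hyps A by simp
    then obtain c where c: "\<exists>a\<in>A'. c a \<noteq> 0" "\<forall>b\<in>B. (\<Sum>a\<in>A'. c a * M' a b) = 0"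
      using insert.IH[OF A(3), of M'] by blast
    \<comment> \<open>This value at the pivot makes equation \<open>b\<close> hold and turns the
      others into those of \<open>M'\<close>.\<close>
    define c' where "c' = c(a0 := - (\<Sum>a\<in>A'. c a * (M a b / M a0 b)))"
    have eq: "(\<Sum>a\<in>A. c' a * M a b') = (\<Sum>a\<in>A'. c a * M' a b')" for b'
    proof -
      have "(\<Sum>a\<in>A. c' a * M a b') = c' a0 * M a0 b' + (\<Sum>a\<in>A'. c' a * M a b')"
        using A by simp
      moreover have "(\<Sum>a\<in>A'. c' a * M a b') = (\<Sum>a\<in>A'. c a * M a b')"
        using A by (intro sum.cong) (auto simp: c'_def)
      moreover have "(\<Sum>a\<in>A'. c a * M' a b') = (\<Sum>a\<in>A'. c a * M a b') - (\<Sum>a\<in>A'. c a * (M a b / M a0 b)) * M a0 b'"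
        unfolding M'_def by (simp add: right_diff_distrib sum_subtractf sum_distrib_right mult.assoc)
      ultimately show ?thesis by (simp add: c'_def)
    qed
    have "(\<Sum>a\<in>A. c' a * M a b) = 0"
      unfolding eq by (intro sum.neutral) (simp add: M'_def a0)
    moreover have "\<exists>a\<in>A. c' a \<noteq> 0"
    proof -
      obtain a where "a \<in> A'" "c a \<noteq> 0" using c(1) by blast
      then have "a \<in> A" "c' a \<noteq> 0" using A by (auto simp: c'_def)
      then show ?thesis by blast
    qed
    moreover have "\<forall>b\<in>B. (\<Sum>a\<in>A. c' a * M a b) = 0" using c(2) eq by simp
    ultimately show ?thesis by blast
  qed
qed

text \<open>This pigeonhole principle, more polynomials than admissible monomials, drives the
  Nullstellensatz and the upper bound on the number of invariants.\<close>

lemma lin_dep_cpoly: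
  fixes f :: "'a \<Rightarrow> 'x cpoly"
  assumes "finite S" "finite A" "card S < card A" "\<And>a. a \<in> A \<Longrightarrow> keys (f a) \<subseteq> S"
  shows "\<exists>c. (\<exists>a\<in>A. c a \<noteq> 0) \<and> (\<Sum>a\<in>A. const_poly (c a) * f a) = 0"
proof -
  obtain c where c: "\<exists>a\<in>A. c a \<noteq> 0" "\<forall>u\<in>S. (\<Sum>a\<in>A. c a * lookup (f a) u) = 0"
    using lin_dep[OF assms(1,2,3), of "\<lambda>a u. lookup (f a) u"] by blast
  have "(\<Sum>a\<in>A. const_poly (c a) * f a) = 0"
  proof (intro poly_mapping_eqI)
    fix u
    have "(\<Sum>a\<in>A. c a * lookup (f a) u) = 0"
    proof (cases "u \<in> S")
      case False
      then have "\<forall>a\<in>A. lookup (f a) u = 0" using assms(4) by (meson in_keys_iff subsetD)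
      then show ?thesis by simp
    qed (use c in auto)
    then show "lookup (\<Sum>a\<in>A. const_poly (c a) * f a) u = lookup 0 u"
      by (simp add: lookup_sum lookup_const_mult)
  qed
  then show ?thesis using c(1) by blast
qed

text \<open>Exponents are bounded separately instead of by total degree: the box has exactly
  \<open>n ^ card A\<close> elements, and growth rates can be compared without binomial
  coefficients.\<close>

definition monom_box :: "'x set \<Rightarrow> nat \<Rightarrow> ('x \<Rightarrow>\<^sub>0 nat) set" where
  "monom_box A n = {u. keys u \<subseteq> A \<and> (\<forall>x\<in>A. lookup u x < n)}"

lemma monom_box_bij:
  assumes "finite A"
  shows "bij_betw (\<lambda>u. restrict (lookup u) A) (monom_box A n) (A \<rightarrow>\<^sub>E {..<n})"
proof (rule bij_betwI[where g = "\<lambda>f. Abs_poly_mapping (\<lambda>x. if x \<in> A then f x else 0)"])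
  have look: "lookup (Abs_poly_mapping (\<lambda>x. if x \<in> A then f x else 0)) = (\<lambda>x. if x \<in> A then f x else 0)"
    for f :: "'a \<Rightarrow> nat"
  proof -
    have "finite {x. (if x \<in> A then f x else 0) \<noteq> 0}"
      by (rule finite_subset[OF _ assms]) (simp add: subset_iff)
    then show ?thesis by simp
  qed
  show "(\<lambda>u. restrict (lookup u) A) \<in> monom_box A n \<rightarrow> A \<rightarrow>\<^sub>E {..<n}"
    by (auto simp: monom_box_def)
  show "(\<lambda>f. Abs_poly_mapping (\<lambda>x. if x \<in> A then f x else 0)) \<in> (A \<rightarrow>\<^sub>E {..<n}) \<rightarrow> monom_box A n"
    by (auto simp: monom_box_def look in_keys_iff split: if_splits)
  show "Abs_poly_mapping (\<lambda>x. if x \<in> A then restrict (lookup u) A x else 0) = u"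
    if "u \<in> monom_box A n" for u
    using that by (intro poly_mapping_eqI) (auto simp: look monom_box_def in_keys_iff)
  show "restrict (lookup (Abs_poly_mapping (\<lambda>x. if x \<in> A then f x else 0))) A = f"
    if "f \<in> A \<rightarrow>\<^sub>E {..<n}" for f
    using that by (auto simp: look fun_eq_iff PiE_def extensional_def restrict_def)
qed

lemma finite_monom_box: "finite A \<Longrightarrow> finite (monom_box A n)"
  using bij_betw_finite[OF monom_box_bij, of A n] by (simp add: finite_PiE)

lemma card_monom_box: "finite A \<Longrightarrow> card (monom_box A n) = n ^ card A"
  using bij_betw_same_card[OF monom_box_bij, of A n] by (simp add: card_PiE)

section \<open>Ideals\<close>

definition is_ideal :: "'a::comm_ring_1 set \<Rightarrow> bool" where
  "is_ideal I \<longleftrightarrow> 0 \<in> I \<and> (\<forall>p\<in>I. \<forall>q\<in>I. p + q \<in> I) \<and> (\<forall>p\<in>I. \<forall>r. r * p \<in> I)"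

lemma is_idealD:
  assumes "is_ideal I"
  shows "0 \<in> I" "p \<in> I \<Longrightarrow> q \<in> I \<Longrightarrow> p + q \<in> I" "p \<in> I \<Longrightarrow> r * p \<in> I" "p \<in> I \<Longrightarrow> p * r \<in> I"
    "p \<in> I \<Longrightarrow> q \<in> I \<Longrightarrow> p - q \<in> I" "p \<in> I \<Longrightarrow> - p \<in> I"
proof -
  show m: "r * p \<in> I" if "p \<in> I" for r p using assms that by (simp add: is_ideal_def)
  show a: "p + q \<in> I" if "p \<in> I" "q \<in> I" for p q using assms that by (simp add: is_ideal_def)
  show "0 \<in> I" using assms by (simp add: is_ideal_def)
  show "p * r \<in> I" if "p \<in> I" using m[OF that, of r] by (simp add: mult.commute)
  show u: "- p \<in> I" if "p \<in> I" for p using m[OF that, of "-1"] by simp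
  show "p - q \<in> I" if "p \<in> I" "q \<in> I" using a[OF that(1) u[OF that(2)]] by simp
qed

lemma is_ideal_sum: "is_ideal I \<Longrightarrow> (\<And>i. i \<in> A \<Longrightarrow> f i \<in> I) \<Longrightarrow> sum f A \<in> I"
  by (induction A rule: infinite_finite_induct) (auto simp: is_idealD)

definition idl :: "'a::comm_ring_1 set \<Rightarrow> 'a set" where
  "idl T = {p. \<exists>T0 a. finite T0 \<and> T0 \<subseteq> T \<and> p = (\<Sum>t\<in>T0. a t * t)}"

lemma idl_least: "is_ideal I \<Longrightarrow> T \<subseteq> I \<Longrightarrow> idl T \<subseteq> I"
  unfolding idl_def by (blast intro: is_ideal_sum is_idealD(3))

lemma idl_finite:
  assumes "finite T"
  shows "idl T = {\<Sum>t\<in>T. a t * t | a. True}"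
proof -
  have "\<exists>b. (\<Sum>t\<in>T0. a t * t) = (\<Sum>t\<in>T. b t * t)" if "T0 \<subseteq> T" for T0 a
  proof
    show "(\<Sum>t\<in>T0. a t * t) = (\<Sum>t\<in>T. (if t \<in> T0 then a t else 0) * t)"
      using that assms by (intro sum.mono_neutral_cong_left) auto
  qed
  then show ?thesis using assms by (fastforce simp: idl_def)
qed

lemma is_ideal_idl: "is_ideal (idl T)"
proof -
  have "p + q \<in> idl T" if "p \<in> idl T" "q \<in> idl T" for p q
  proof -
    from that obtain T1 a T2 b where
      p: "finite T1" "T1 \<subseteq> T" "p = (\<Sum>t\<in>T1. a t * t)" and
      q: "finite T2" "T2 \<subseteq> T" "q = (\<Sum>t\<in>T2. b t * t)"
      by (auto simp: idl_def)
    let ?c = "\<lambda>t. (if t \<in> T1 then a t else 0) + (if t \<in> T2 then b t else 0)"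
    have "p = (\<Sum>t\<in>T1\<union>T2. (if t \<in> T1 then a t else 0) * t)"
      unfolding p(3) using p q by (intro sum.mono_neutral_cong_left) auto
    moreover have "q = (\<Sum>t\<in>T1\<union>T2. (if t \<in> T2 then b t else 0) * t)"
      unfolding q(3) using p q by (intro sum.mono_neutral_cong_left) auto
    ultimately have "p + q = (\<Sum>t\<in>T1\<union>T2. ?c t * t)"
      by (simp add: sum.distrib distrib_right)
    then show ?thesis unfolding idl_def using p q
      by (intro CollectI exI[of _ "T1 \<union> T2"] exI[of _ ?c]) auto
  qed
  moreover have "r * p \<in> idl T" if p: "p \<in> idl T" for p r
  proof -
    obtain T1 a where "finite T1" "T1 \<subseteq> T" "p = (\<Sum>t\<in>T1. a t * t)" using p by (auto simp: idl_def)
    then show ?thesis unfolding idl_def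
      by (intro CollectI exI[of _ "T1"] exI[of _ "\<lambda>t. r * a t"]) (auto simp: sum_distrib_left mult_ac)
  qed
  moreover have "0 \<in> idl T" unfolding idl_def by (intro CollectI exI[of _ "{}"]) auto
  ultimately show ?thesis by (simp add: is_ideal_def)
qed

lemma idl_superset: "t \<in> T \<Longrightarrow> t \<in> idl T"
  unfolding idl_def by (intro CollectI exI[of _ "{t}"] exI[of _ "\<lambda>_. 1"]) auto

section \<open>Dickson's lemma\<close>

lemma nat_seq_mono_subseq:
  fixes s :: "nat \<Rightarrow> nat"
  shows "\<exists>r :: nat \<Rightarrow> nat. strict_mono r \<and> mono (\<lambda>n. s (r n))"
proof -
  obtain f where f: "strict_mono f" "monoseq (\<lambda>n. s (f n))" using seq_monosub by blast
  show ?thesis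
  proof (cases "incseq (\<lambda>n. s (f n))")
    case False
    then have dec: "decseq (\<lambda>n. s (f n))" using f(2) by (auto simp: monoseq_iff)
    \<comment> \<open>A nonincreasing sequence of natural numbers is constant from the place of its
      minimum on.\<close>
    define n0 where "n0 = (ARG_MIN (\<lambda>n. s (f n)) n. True)"
    have n0: "s (f n0) \<le> s (f n)" for n
      unfolding n0_def by (rule arg_min_nat_le[where P = "\<lambda>_. True"]) simp
    have "s (f (n0 + n)) = s (f n0)" for n
      using n0[of "n0 + n"] decseqD[OF dec, of n0 "n0 + n"] by simp
    moreover have "strict_mono (\<lambda>n. f (n0 + n))" using f(1) by (auto simp: strict_mono_def)
    ultimately show ?thesis by (intro exI[of _ "\<lambda>n. f (n0 + n)"]) (auto simp: mono_def)
  qed (use f in auto)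
qed

lemma dickson_subseq:
  fixes u :: "nat \<Rightarrow> 'x \<Rightarrow> nat"
  assumes "finite V"
  shows "\<exists>r :: nat \<Rightarrow> nat. strict_mono r \<and> (\<forall>x\<in>V. mono (\<lambda>n. u (r n) x))"
  using assms
proof induction
  case empty
  then show ?case by (intro exI[of _ id]) (auto simp: strict_mono_def)
next
  case (insert x V)
  then obtain r :: "nat \<Rightarrow> nat" where r: "strict_mono r" "\<forall>x\<in>V. mono (\<lambda>n. u (r n) x)" by blast
  obtain f :: "nat \<Rightarrow> nat" where f: "strict_mono f" "mono (\<lambda>n. u (r (f n)) x)"
    using nat_seq_mono_subseq[of "\<lambda>n. u (r n) x"] by blast
  have "mono (\<lambda>n. u (r (f n)) y)" if "y \<in> V" for y
    using r(2) f(1) that by (auto simp: mono_def strict_mono_less_eq)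
  then show ?case using f r(1)
    by (intro exI[of _ "\<lambda>n. r (f n)"]) (auto simp: strict_mono_def)
qed

text \<open>Along a subsequence all of the finitely many exponents are nondecreasing, so already its
  first monomial divides its second.\<close>

lemma dickson:
  fixes u :: "nat \<Rightarrow> ('x \<Rightarrow>\<^sub>0 nat)"
  assumes "finite V" "\<And>n. keys (u n) \<subseteq> V"
  shows "\<exists>i j v. i < j \<and> u j = u i + v"
proof -
  obtain r :: "nat \<Rightarrow> nat" where r: "strict_mono r" "\<forall>x\<in>V. mono (\<lambda>n. lookup (u (r n)) x)"
    using dickson_subseq[OF assms(1), of "\<lambda>n. lookup (u n)"] by blast
  have le: "lookup (u (r 0)) x \<le> lookup (u (r 1)) x" for x
  proof (cases "x \<in> V")
    case True
    then show ?thesis using r(2) by (auto simp: mono_def)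
  next
    case False
    then have "lookup (u (r 0)) x = 0" using assms(2)[of "r 0"] by (auto simp: in_keys_iff)
    then show ?thesis by simp
  qed
  have "u (r 1) = u (r 0) + (u (r 1) - u (r 0))"
    by (intro poly_mapping_eqI) (simp add: lookup_add lookup_minus le[unfolded One_nat_def])
  moreover have "r 0 < r 1" using r(1) by (auto simp: strict_mono_def)
  ultimately show ?thesis by blast
qed

section \<open>A monomial order and the basis theorem\<close>

definition nth_prime :: "nat \<Rightarrow> nat" where
  "nth_prime = enumerate {p. prime p}"

lemma prime_nth_prime: "prime (nth_prime n)"
  using enumerate_in_set[OF primes_infinite, of n] by (simp add: nth_prime_def)

lemma nth_prime_pos [simp]: "nth_prime n > 0"
  using prime_nth_prime prime_gt_0_nat by blast

lemma nth_prime_neq_0 [simp]: "nth_prime n \<noteq> 0"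
  using nth_prime_pos[of n] by simp

lemma nth_prime_eq_iff: "nth_prime m = nth_prime n \<longleftrightarrow> m = n"
  unfolding nth_prime_def
  by (metis enumerate_mono[OF _ primes_infinite] linorder_neq_iff less_irrefl)

text \<open>Encoding exponents by prime factorizations gives a monomial order that is multiplicative and, being a
  comparison of natural numbers, well-founded.\<close>

definition monom_code :: "('x::countable \<Rightarrow>\<^sub>0 nat) \<Rightarrow> nat" where
  "monom_code = mpow (\<lambda>x. nth_prime (to_nat x))"

lemma monom_code_add: "monom_code (u + v) = monom_code u * monom_code v"
  by (simp add: monom_code_def mpow_add)



text \<open>By unique factorization the exponent of \<open>x\<close> is the multiplicity of the
  prime attached to \<open>x\<close>.\<close>

lemma monom_code_inj: 
  assumes "monom_code u = monom_code v" shows "u = v"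
proof (rule poly_mapping_eqI)
  fix x :: 'a
  let ?p = "\<lambda>x::'a. nth_prime (to_nat x)"
  note prime_enum = prime_nth_prime
  have "multiplicity (?p x) (monom_code w) = lookup w x" for w
  proof -
    have "multiplicity (?p x) (monom_code w) = (\<Sum>y\<in>keys w. multiplicity (?p x) (?p y ^ lookup w y))"
      unfolding monom_code_def mpow_def
      using prime_enum by (intro prime_elem_multiplicity_prod_distrib) (auto simp: prime_imp_prime_elem)
    also have "\<dots> = (\<Sum>y\<in>keys w. if y = x then lookup w y else 0)"
    proof (intro sum.cong refl)
      fix y
      show "multiplicity (?p x) (?p y ^ lookup w y) = (if y = x then lookup w y else 0)"
      proof (cases "y = x")
        case True
        then show ?thesis using prime_gt_1_nat[OF prime_enum, of "to_nat x"] by (simp add: multiplicity_same_power)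
      next
        case False
        then have "?p x \<noteq> ?p y" by (simp add: nth_prime_eq_iff)
        then show ?thesis using False prime_enum by (simp add: multiplicity_distinct_prime_power)
      qed
    qed
    also have "\<dots> = lookup w x"
      by (subst sum.delta) (simp_all add: in_keys_iff)
    finally show ?thesis .
  qed
  then show "lookup u x = lookup v x" using assms by metis
qed

definition lead_monom :: "'x::countable cpoly \<Rightarrow> ('x \<Rightarrow>\<^sub>0 nat)" where
  "lead_monom p = (ARG_MAX monom_code u. u \<in> keys p)"

lemma lead_monom:
  assumes "p \<noteq> 0"
  shows "lead_monom p \<in> keys p" 
    "u \<in> keys p \<Longrightarrow> monom_code u \<le> monom_code (lead_monom p)"
proof -
  obtain u0 where u0: "u0 \<in> keys p" using keys_nonempty[OF assms] by blast
  have bound: "\<forall>u. u \<in> keys p \<longrightarrow> monom_code u \<le> Max (monom_code ` keys p)" by auto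
  then have b: "\<forall>u. u \<in> keys p \<longrightarrow> monom_code u < Suc (Max (monom_code ` keys p))"
    by (simp add: less_Suc_eq_le)
  show "lead_monom p \<in> keys p" 
    unfolding lead_monom_def using arg_max_natI[of "\<lambda>u. u \<in> keys p", OF u0 b] .
  show "u \<in> keys p \<Longrightarrow> monom_code u \<le> monom_code (lead_monom p)"
    unfolding lead_monom_def using arg_max_nat_le[of "\<lambda>u. u \<in> keys p", OF _ b] .
qed

lemma keys_single_mult: "keys (single v c * p) \<subseteq> (\<lambda>u. v + u) ` keys (p :: 'x cpoly)"
  using Poly_Mapping.keys_mult[of "single v c" p] by (auto split: if_splits)

lemma lookup_single_mult: "lookup (single v c * (p :: 'x cpoly)) (v + u) = c * lookup p u"
proof -
  have "single v c * p = (\<Sum>w\<in>keys p. single (v + w) (c * lookup p w))"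
    by (subst cpoly_sum_monomials[of p, symmetric]) (simp add: sum_distrib_left mult_single)
  then have "lookup (single v c * p) (v + u)
      = (\<Sum>w\<in>keys p. if w = u then c * lookup p w else 0)"
    by (simp add: lookup_sum lookup_single when_def)
  also have "\<dots> = c * lookup p u"
    by (subst sum.delta) (simp_all add: in_keys_iff)
  finally show ?thesis .
qed

text \<open>If no finite set worked, one could keep adding an element outside the ideal generated so
  far whose leading monomial has the least code. By Dickson's lemma one leading monomial divides a
  later one; cancelling the later leading term gives an element outside the ideal with a smaller
  code, against the choice.\<close>

theorem hilbert_basis:
  fixes S :: "'x::countable cpoly set"
  assumes V: "finite V" and S: "S \<subseteq> cpolys_in V"
  shows "\<exists>T. finite T \<and> T \<subseteq> S \<and> S \<subseteq> idl T"
proof -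
  \<comment> \<open>Multipliers in \<open>idl S\<close> may contain any variables. Intersecting with
    \<open>cpolys_in V\<close> confines the leading monomials to finitely many variables, as
    Dickson's lemma requires.\<close>
  define J where "J = {p \<in> idl S. p \<in> cpolys_in V}"
  have J: "p - single v c * q \<in> J"
    if "p \<in> J" "q \<in> J" "keys v \<subseteq> V" for p q v c
  proof -
    have "single v c \<in> cpolys_in V" using that by (auto simp: cpolys_in_iff split: if_splits)
    moreover have "p - single v c * q \<in> idl S"
      using that is_idealD(5)[OF is_ideal_idl _ is_idealD(3)[OF is_ideal_idl]] by (auto simp: J_def)
    ultimately show ?thesis using that by (auto simp: J_def)
  qed
  have "\<exists>T. finite T \<and> T \<subseteq> J \<and> J \<subseteq> idl T"
  proof (rule ccontr)
    assume no: "\<not> ?thesis"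
    define pick where "pick T = (ARG_MIN (\<lambda>h. monom_code (lead_monom h)) h. h \<in> J - idl T)" for T
    have pick: "pick T \<in> J - idl T" "h \<in> J - idl T \<Longrightarrow> monom_code (lead_monom (pick T)) \<le> monom_code (lead_monom h)"
      if T: "finite T" "T \<subseteq> J" for T h
    proof -
      from no T obtain h0 where h0: "h0 \<in> J - idl T" by blast
      show "pick T \<in> J - idl T" unfolding pick_def
        using arg_min_natI[of "\<lambda>h. h \<in> J - idl T", OF h0] .
      show "h \<in> J - idl T \<Longrightarrow> monom_code (lead_monom (pick T)) \<le> monom_code (lead_monom h)"
        unfolding pick_def using arg_min_nat_le[of "\<lambda>h. h \<in> J - idl T"] .
    qed
    define Tn where "Tn = rec_nat {} (\<lambda>_ T. insert (pick T) T)"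
    have Tn: "Tn 0 = {}" "Tn (Suc n) = insert (pick (Tn n)) (Tn n)" for n by (simp_all add: Tn_def)
    have Tn_ok: "finite (Tn n) \<and> Tn n \<subseteq> J" for n
      by (induction n) (use pick in \<open>auto simp: Tn\<close>)
    define h where "h n = pick (Tn n)" for n
    have hJ: "h n \<in> J" "h n \<notin> idl (Tn n)" for n using pick(1)[of "Tn n"] Tn_ok[of n] by (auto simp: h_def)
    have h0: "h n \<noteq> 0" for n using hJ(2)[of n] is_idealD(1)[OF is_ideal_idl] by metis
    have hT: "h i \<in> Tn (i + Suc k)" for i k by (induction k) (auto simp: Tn h_def)
    have lmV: "keys (lead_monom (h n)) \<subseteq> V" for n
      using hJ(1)[of n] lead_monom(1)[OF h0[of n]] by (auto simp: J_def cpolys_in_iff)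
    obtain i j v where ij: "i < j" "lead_monom (h j) = lead_monom (h i) + v"
      using dickson[of V "\<lambda>n. lead_monom (h n)"] V lmV by blast
    have hi: "h i \<in> idl (Tn j)" using hT[of i "j - Suc i"] ij(1) by (auto intro: idl_superset)
    define c where "c = lookup (h j) (lead_monom (h j)) / lookup (h i) (lead_monom (h i))"
    define g where "g = h j - single v c * h i"
    have vV: "keys v \<subseteq> V" using lmV[of j] ij(2) by (simp add: keys_plus_nat)
    have "g \<notin> idl (Tn j)"
    proof
      assume "g \<in> idl (Tn j)"
      then have "g + single v c * h i \<in> idl (Tn j)"
        by (rule is_idealD(2)[OF is_ideal_idl _ is_idealD(3)[OF is_ideal_idl hi]])
      then show False using hJ(2)[of j] by (simp add: g_def)
    qed
    moreover have "g \<in> J" unfolding g_def by (rule J[OF hJ(1) hJ(1) vV])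
    ultimately have gJ: "g \<in> J - idl (Tn j)" by blast
    then have g0: "g \<noteq> 0" using is_idealD(1)[OF is_ideal_idl] by blast
    have "monom_code (lead_monom (h j)) \<le> monom_code (lead_monom g)"
      using pick(2)[OF _ _ gJ] Tn_ok[of j] by (simp add: h_def)
    moreover have "monom_code (lead_monom g) < monom_code (lead_monom (h j))"
    proof -
      let ?u = "lead_monom g"
      have u: "?u \<in> keys g" by (rule lead_monom(1)[OF g0])
      have "lookup g (lead_monom (h j)) = 0"
        unfolding g_def lookup_minus using lookup_single_mult[of v c "h i" "lead_monom (h i)"] lead_monom(1)[OF h0[of i]]
        by (simp add: ij(2) add.commute c_def in_keys_iff)
      then have ne: "?u \<noteq> lead_monom (h j)" using u by (auto simp: in_keys_iff)
      have "?u \<in> keys (h j) \<or> ?u \<in> keys (single v c * h i)"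
        using u by (auto simp: g_def in_keys_iff lookup_minus)
      then have "monom_code ?u \<le> monom_code (lead_monom (h j))"
      proof
        assume "?u \<in> keys (h j)"
        then show ?thesis by (rule lead_monom(2)[OF h0])
      next
        assume "?u \<in> keys (single v c * h i)"
        then obtain w where w: "w \<in> keys (h i)" "?u = v + w" using keys_single_mult by blast
        then show ?thesis using lead_monom(2)[OF h0 w(1)]
          by (simp add: w(2) ij(2) monom_code_add mult.commute)
      qed
      moreover have "monom_code ?u \<noteq> monom_code (lead_monom (h j))" using ne monom_code_inj by blast
      ultimately show ?thesis by simp
    qed
    ultimately show False by simp
  qed
  then obtain T where T: "finite T" "T \<subseteq> J" "J \<subseteq> idl T" by blast
  \<comment> \<open>Each of the finitely many generators found in \<open>J\<close> involves only
    finitely many elements of \<open>S\<close>; together these replace \<open>T\<close>.\<close>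
  have "\<forall>t\<in>T. \<exists>U. finite U \<and> U \<subseteq> S \<and> t \<in> idl U"
  proof
    fix t assume "t \<in> T"
    then have "t \<in> idl S" using T(2) by (auto simp: J_def)
    then obtain U a where "finite U" "U \<subseteq> S" "t = (\<Sum>s\<in>U. a s * s)" by (auto simp: idl_def)
    then show "\<exists>U. finite U \<and> U \<subseteq> S \<and> t \<in> idl U" by (auto simp: idl_finite intro!: exI[of _ U])
  qed
  then obtain U where U: "\<And>t. t \<in> T \<Longrightarrow> finite (U t) \<and> U t \<subseteq> S \<and> t \<in> idl (U t)" by metis
  have "idl (U t) \<subseteq> idl (\<Union>t\<in>T. U t)" if "t \<in> T" for t
    using that by (intro idl_least is_ideal_idl) (auto intro: idl_superset)
  then have "T \<subseteq> idl (\<Union>t\<in>T. U t)" using U by blast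
  then have "idl T \<subseteq> idl (\<Union>t\<in>T. U t)" by (intro idl_least is_ideal_idl)
  moreover have "S \<subseteq> J" using S by (auto simp: J_def intro: idl_superset)
  moreover have "(\<Union>t\<in>T. U t) \<subseteq> S" "finite (\<Union>t\<in>T. U t)" using U T(1) by blast+
  ultimately show ?thesis using T(3) by (intro exI[of _ "\<Union>t\<in>T. U t"]) blast
qed

text \<open>Value of a univariate polynomial at an element \<open>y\<close> of a larger ring.
  Factorization over the complex numbers then applies to polynomials in a single
  \<open>var x\<close>.\<close>

definition usub :: "'a::comm_ring_1 \<Rightarrow> (complex \<Rightarrow> 'a) \<Rightarrow> complex poly \<Rightarrow> 'a" where
  "usub y h p = poly (map_poly h p) y"

context coeff_hom begin

lemma usub_pCons: "usub y h (pCons a p) = h a + y * usub y h p"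
  by (simp add: usub_def map_poly_pCons h_0)
lemma usub_0: "usub y h 0 = 0"
  by (simp add: usub_def)
lemma usub_add: "usub y h (p + q) = usub y h p + usub y h q"
  by (induction p q rule: poly_induct2) (simp_all add: usub_pCons usub_0 h_add algebra_simps)
lemma usub_smult: "usub y h (smult c p) = h c * usub y h p"
  by (induction p) (simp_all add: usub_pCons usub_0 h_mult algebra_simps)
lemma usub_mult: "usub y h (p * q) = usub y h p * usub y h q"
  by (induction p) (simp_all add: usub_pCons usub_0 usub_add usub_smult h_0 algebra_simps)
lemma usub_sum: "usub y h (sum f A) = (\<Sum>i\<in>A. usub y h (f i))"
  by (induction A rule: infinite_finite_induct) (auto simp: usub_0 usub_add)
lemma usub_1: "usub y h 1 = 1"
  unfolding one_pCons usub_pCons usub_0 h_1 by simp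
lemma usub_prod: "usub y h (prod f A) = (\<Prod>i\<in>A. usub y h (f i))"
  by (induction A rule: infinite_finite_induct) (auto simp: usub_1 usub_mult)

end

text \<open>Let \<open>M\<close> be maximal among the ideals that contain \<open>F\<close> and avoid all powers of \<open>g\<close>. If no \<open>var x - const_poly a\<close>
  were in \<open>M\<close>, each would divide a power of \<open>g\<close> modulo \<open>M\<close>; the quotients are uncountably many polynomials with
  countably many monomials, hence linearly dependent, and clearing denominators puts a nonzero univariate
  polynomial in \<open>var x\<close> into the prime ideal \<open>M\<close>. So \<open>M\<close> is the ideal of a point.\<close>

theorem nullstellensatz:
  fixes g :: "'x::countable cpoly"
  assumes F: "\<And>\<sigma>. (\<And>f. f \<in> F \<Longrightarrow> eval \<sigma> f = 0) \<Longrightarrow> eval \<sigma> g = 0"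
  shows "\<exists>k. g ^ k \<in> idl F"
proof (rule ccontr)
  assume no: "\<not> (\<exists>k. g ^ k \<in> idl F)"
  define \<A> where "\<A> = {J. is_ideal J \<and> idl F \<subseteq> J \<and> (\<forall>k. g ^ k \<notin> J)}"
  have "\<exists>M\<in>\<A>. \<forall>X\<in>\<A>. M \<subseteq> X \<longrightarrow> X = M"
  proof (rule subset_Zorn_nonempty)
    show "\<A> \<noteq> {}" using no is_ideal_idl[of F] by (auto simp: \<A>_def)
    fix C assume C: "C \<noteq> {}" "subset.chain \<A> C"
    then have CA: "C \<subseteq> \<A>" and ch: "\<And>X Y. X \<in> C \<Longrightarrow> Y \<in> C \<Longrightarrow> X \<subseteq> Y \<or> Y \<subseteq> X"
      by (auto simp: subset_chain_def)
    have "p + q \<in> \<Union>C" if pq: "p \<in> \<Union>C" "q \<in> \<Union>C" for p q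
    proof -
      obtain X Y where XY: "X \<in> C" "p \<in> X" "Y \<in> C" "q \<in> Y" using pq by blast
      then obtain Z where "Z \<in> C" "p \<in> Z" "q \<in> Z" using ch[of X Y] by blast
      moreover have "is_ideal Z" using \<open>Z \<in> C\<close> CA by (auto simp: \<A>_def)
      ultimately show ?thesis using is_idealD(2) by blast
    qed
    moreover have "r * p \<in> \<Union>C" if p: "p \<in> \<Union>C" for p r
    proof -
      obtain X where X: "X \<in> C" "p \<in> X" using p by blast
      then have "is_ideal X" using CA by (auto simp: \<A>_def)
      then show ?thesis using X is_idealD(3) by blast
    qed
    moreover have "idl F \<subseteq> \<Union>C" using C(1) CA by (auto simp: \<A>_def)
    moreover have "0 \<in> \<Union>C" using \<open>idl F \<subseteq> \<Union>C\<close> is_idealD(1)[OF is_ideal_idl] by blast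
    moreover have "g ^ k \<notin> \<Union>C" for k using CA by (auto simp: \<A>_def)
    ultimately show "\<Union>C \<in> \<A>" by (simp add: \<A>_def is_ideal_def)
  qed
  then obtain M where "M \<in> \<A>" and max: "\<And>X. X \<in> \<A> \<Longrightarrow> M \<subseteq> X \<Longrightarrow> X = M" by blast
  then have M: "is_ideal M" "idl F \<subseteq> M" "\<And>k. g ^ k \<notin> M" by (auto simp: \<A>_def)
  \<comment> \<open>Maximality in usable form: the ideal generated by \<open>M\<close> and
    \<open>y\<close> is larger than \<open>M\<close>, so it contains a power of \<open>g\<close>.
    Primality of \<open>M\<close> follows from this.\<close>
  have ext: "\<exists>k q. g ^ k - y * q \<in> M" if y: "y \<notin> M" for y
  proof (rule ccontr)
    assume n: "\<not> ?thesis"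
    define X where "X = {m + y * q | m q. m \<in> M}"
    have inX: "p \<in> X \<longleftrightarrow> (\<exists>q. p - y * q \<in> M)" for p
    proof
      assume "p \<in> X"
      then obtain m q where "m \<in> M" "p = m + y * q" by (auto simp: X_def)
      then show "\<exists>q. p - y * q \<in> M" by (intro exI[of _ q]) simp
    next
      assume "\<exists>q. p - y * q \<in> M"
      then obtain q where "p - y * q \<in> M" by blast
      then show "p \<in> X" unfolding X_def by (intro CollectI exI[of _ "p - y * q"] exI[of _ q]) auto
    qed
    have "is_ideal X" unfolding is_ideal_def
    proof (intro conjI ballI allI)
      show "0 \<in> X" unfolding inX using is_idealD(1)[OF M(1)] by (intro exI[of _ 0]) simp
      fix p assume "p \<in> X"
      then obtain a where a: "p - y * a \<in> M" using inX by blast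
      have "r * p - y * (r * a) \<in> M" for r using is_idealD(3)[OF M(1) a, of r] by (simp add: algebra_simps)
      then show "r * p \<in> X" for r unfolding inX by blast
      fix q assume "q \<in> X"
      then obtain b where b: "q - y * b \<in> M" using inX by blast
      have "p + q - y * (a + b) \<in> M" using is_idealD(2)[OF M(1) a b] by (simp add: algebra_simps)
      then show "p + q \<in> X" unfolding inX by blast
    qed
    moreover have MX: "M \<subseteq> X" 
    proof
      fix p assume "p \<in> M" then have "p - y * 0 \<in> M" by simp
      then show "p \<in> X" unfolding inX by blast
    qed
    moreover have "g ^ k \<notin> X" for k using n inX by blast
    ultimately have "X \<in> \<A>" using M(2) by (auto simp: \<A>_def)
    then have "X = M" using max MX by blast
    moreover have "y - y * 1 \<in> M" using is_idealD(1)[OF M(1)] by simp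
    then have "y \<in> X" unfolding inX by blast
    ultimately show False using y by blast
  qed
  have prime: "a \<in> M \<or> b \<in> M" if ab: "a * b \<in> M" for a b
  proof (rule ccontr)
    assume "\<not> ?thesis"
    then obtain k q l r where k: "g ^ k - a * q \<in> M" and l: "g ^ l - b * r \<in> M" using ext by meson
    have "g ^ l * (g ^ k - a * q) + a * q * (g ^ l - b * r) + (q * r) * (a * b) \<in> M"
      by (rule is_idealD(2)[OF M(1) is_idealD(2)[OF M(1) is_idealD(3)[OF M(1) k] is_idealD(3)[OF M(1) l]] is_idealD(3)[OF M(1) ab]])
    then have "g ^ (k + l) \<in> M" by (simp add: algebra_simps power_add)
    then show False using M(3) by blast
  qed
  have M1: "1 \<notin> M" using M(3)[of 0] by simp
  have const: "const_poly c \<notin> M" if "c \<noteq> 0" for c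
  proof
    assume "const_poly c \<in> M"
    then have "const_poly (inverse c) * const_poly c \<in> M" by (rule is_idealD(3)[OF M(1)])
    then show False using M1 that by (simp add: const_poly_mult[symmetric])
  qed
  \<comment> \<open>A linear factor over the complex numbers can be split off; as \<open>M\<close>
    is prime, either it or the cofactor of lower degree lies in \<open>M\<close>.\<close>
  have lin: "\<exists>a. var x - const_poly a \<in> M" if "p \<noteq> 0" "usub (var x) const_poly p \<in> M" for p x
    using that
  proof (induction "degree p" arbitrary: p)
    case 0
    then obtain c where "p = [:c:]" by (metis degree_eq_zeroE)
    then have "usub (var x) const_poly p = const_poly c" by (simp add: sb.usub_pCons sb.usub_0)
    then show ?case using 0 const \<open>p = [:c:]\<close> by auto
  next
    case (Suc n)
    then have "\<not> constant (poly p)" by (simp add: constant_degree)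
    then obtain z where "poly p z = 0" using fundamental_theorem_of_algebra by blast
    then obtain q where q: "p = [:-z, 1:] * q" by (metis dvd_def poly_eq_0_iff_dvd)
    then have "q \<noteq> 0" using Suc.prems by auto
    have "degree p = Suc (degree q)" unfolding q using \<open>q \<noteq> 0\<close> by (subst degree_mult_eq) auto
    then have "n = degree q" using Suc.hyps(2) by simp
    have "usub (var x) const_poly p = (var x - const_poly z) * usub (var x) const_poly q"
      unfolding q sb.usub_mult by (simp add: sb.usub_pCons sb.usub_0 const_poly_uminus)
    then have "var x - const_poly z \<in> M \<or> usub (var x) const_poly q \<in> M" using prime Suc.prems(2) by simp
    then show ?case using Suc.hyps(1)[OF \<open>n = degree q\<close> \<open>q \<noteq> 0\<close>] by blast
  qed
  have "\<exists>a. var x - const_poly a \<in> M" for x :: 'x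
  proof (rule ccontr)
    assume n: "\<not> ?thesis"
    then have "\<forall>a. \<exists>k q. g ^ k - (var x - const_poly a) * q \<in> M" using ext by blast
    then obtain kk q where kq: "\<And>a. g ^ kk a - (var x - const_poly a) * q a \<in> M" by metis
    define B where "B D = monom_box {x::'x. to_nat x < D} D" for D
    have finB: "finite (B D)" for D
    proof -
      have "finite {x::'x. to_nat x < D}"
        by (rule finite_imageD[of to_nat]) (auto intro: finite_subset[of _ "{..<D}"])
      then show ?thesis unfolding B_def by (rule finite_monom_box)
    qed
    have exB: "\<exists>D. keys p \<subseteq> B D" for p :: "'x cpoly"
    proof -
      have "finite (to_nat ` poly_vars p \<union> (\<Union>u\<in>keys p. lookup u ` keys u))"
        by (auto simp: poly_vars_def)
      then obtain D where D: "\<And>i. i \<in> to_nat ` poly_vars p \<union> (\<Union>u\<in>keys p. lookup u ` keys u) \<Longrightarrow> i < D"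
        by (metis finite_nat_set_iff_bounded)
      have "keys p \<subseteq> B (Suc D)"
      proof
        fix u assume u: "u \<in> keys p"
        have "keys u \<subseteq> {x. to_nat x < Suc D}"
          using D u by (fastforce simp: poly_vars_def less_Suc_eq)
        moreover have "lookup u x < Suc D" for x
        proof (cases "x \<in> keys u")
          case True
          then have "lookup u x < D" using D u by blast
          then show ?thesis by simp
        qed (simp add: in_keys_iff)
        ultimately show "u \<in> B (Suc D)" by (simp add: B_def monom_box_def)
      qed
      then show ?thesis by blast
    qed
    define W where "W k D = {a. kk a = k \<and> keys (q a) \<subseteq> B D}" for k D
    \<comment> \<open>Countably many classes \<open>W k D\<close> cover the uncountable field, so
      one is infinite: its members share the exponent \<open>k\<close> and the finite set
      \<open>B D\<close> of possible monomials.\<close>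
    have "\<exists>k D. infinite (W k D)"
    proof (rule ccontr)
      assume "\<not> ?thesis"
      then have "countable (\<Union>k. \<Union>D. W k D)" by (intro countable_UN) (auto intro: countable_finite)
      moreover have "(\<Union>k. \<Union>D. W k D) = UNIV" using exB by (auto simp: W_def)
      ultimately show False using uncountable_UNIV_complex by simp
    qed
    then obtain k D where inf: "infinite (W k D)" by blast
    then obtain A where A: "A \<subseteq> W k D" "finite A" "card A = Suc (card (B D))"
      using infinite_arbitrarily_large by metis
    have qB: "\<And>a. a \<in> A \<Longrightarrow> keys (q a) \<subseteq> B D" using A(1) by (auto simp: W_def)
    have "\<exists>c. (\<exists>a\<in>A. c a \<noteq> 0) \<and> (\<Sum>a\<in>A. const_poly (c a) * q a) = 0"
      by (rule lin_dep_cpoly[OF finB[of D] A(2)]) (use A(3) qB in auto)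
    then obtain c where c: "\<exists>a\<in>A. c a \<noteq> 0" "(\<Sum>a\<in>A. const_poly (c a) * q a) = 0"
      by (elim exE conjE)
    define P where "P a = (\<Prod>b\<in>A-{a}. (var x - const_poly b))" for a
    define h where "h = (\<Sum>a\<in>A. smult (c a) (\<Prod>b\<in>A-{a}. [:-b, 1:]))"
    have hP: "usub (var x) const_poly h = (\<Sum>a\<in>A. const_poly (c a) * P a)"
      by (simp add: h_def P_def sb.usub_sum sb.usub_smult sb.usub_prod sb.usub_pCons sb.usub_0 const_poly_uminus)
    have "const_poly (c a) * (P a * (g ^ k - (var x - const_poly a) * q a)) \<in> M" if "a \<in> A" for a
      using kq[of a] A(1) that by (auto simp: W_def intro!: is_idealD(3)[OF M(1)])
    then have "(\<Sum>a\<in>A. const_poly (c a) * (P a * (g ^ k - (var x - const_poly a) * q a))) \<in> M"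
      by (rule is_ideal_sum[OF M(1)])
    also have "(\<Sum>a\<in>A. const_poly (c a) * (P a * (g ^ k - (var x - const_poly a) * q a))) =
        (\<Sum>a\<in>A. const_poly (c a) * P a * g ^ k - const_poly (c a) * q a * (\<Prod>b\<in>A. (var x - const_poly b)))"
      using A(2) by (intro sum.cong refl) (simp add: P_def prod.remove algebra_simps)
    also have "\<dots> = (\<Sum>a\<in>A. const_poly (c a) * P a) * g ^ k - (\<Sum>a\<in>A. const_poly (c a) * q a) * (\<Prod>b\<in>A. (var x - const_poly b))"
      by (simp add: sum_subtractf sum_distrib_right)
    finally have "usub (var x) const_poly h * g ^ k \<in> M" by (simp add: c(2) hP)
    then have "usub (var x) const_poly h \<in> M" using prime M(3) by blast
    \<comment> \<open>At a point \<open>a\<close> of \<open>A\<close> with \<open>c a\<close>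
      nonzero all summands but one vanish, as in Lagrange interpolation.\<close>
    moreover have "h \<noteq> 0"
    proof
      assume "h = 0"
      obtain a where a: "a \<in> A" "c a \<noteq> 0" using c(1) by blast
      have "0 = poly h a" using \<open>h = 0\<close> by simp
      also have "poly h a = (\<Sum>a'\<in>A. c a' * (\<Prod>b\<in>A-{a'}. a - b))"
        by (simp add: h_def poly_sum poly_prod)
      also have "\<dots> = (\<Sum>a'\<in>A. if a' = a then c a * (\<Prod>b\<in>A-{a}. a - b) else 0)"
        using a A(2) by (intro sum.cong refl) auto
      also have "\<dots> = c a * (\<Prod>b\<in>A-{a}. a - b)" using a A(2) by simp
      finally show False using a A(2) by simp
    qed
    ultimately show False using lin n by blast
  qed
  then obtain \<sigma> where \<sigma>: "\<And>x. var x - const_poly (\<sigma> x) \<in> M" by metis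
  have ev: "p - const_poly (eval \<sigma> p) \<in> M" for p
  proof (induction p rule: cpoly_induct)
    case (const c)
    then show ?case using is_idealD(1)[OF M(1)] by (simp add: eval_simps)
  next
    case (add p q)
    then show ?case using is_idealD(2)[OF M(1) add] by (simp add: eval_simps const_poly_add algebra_simps)
  next
    case (var x p)
    have "var x * (p - const_poly (eval \<sigma> p)) + const_poly (eval \<sigma> p) * (var x - const_poly (\<sigma> x)) \<in> M"
      by (rule is_idealD(2)[OF M(1) is_idealD(3)[OF M(1) var] is_idealD(3)[OF M(1) \<sigma>]])
    then show ?case by (simp add: eval_simps const_poly_mult algebra_simps)
  qed
  have "eval \<sigma> f = 0" if "f \<in> F" for f
  proof -
    have "f \<in> M" using that M(2) idl_superset by blast
    then have "f - (f - const_poly (eval \<sigma> f)) \<in> M" by (rule is_idealD(5)[OF M(1) _ ev])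
    then have "const_poly (eval \<sigma> f) \<in> M" by simp
    then show ?thesis using const by blast
  qed
  then have "eval \<sigma> g = 0" by (rule F)
  then have "g \<in> M" using ev[of g] by simp
  then show False using M(3)[of 1] by simp
qed

section \<open>The Reynolds argument for self-adjoint groups\<close>

lemma const_poly_sum: "const_poly (sum g I) = (\<Sum>i\<in>I. const_poly (g i))"
  by (induction I rule: infinite_finite_induct) (auto simp: const_poly_add)

inductive_set cspan :: "'x cpoly set \<Rightarrow> 'x cpoly set" for A where
  cspan_0: "0 \<in> cspan A"
| cspan_step: "a \<in> A \<Longrightarrow> p \<in> cspan A \<Longrightarrow> const_poly c * a + p \<in> cspan A"

lemma cspan_add: "p \<in> cspan A \<Longrightarrow> q \<in> cspan A \<Longrightarrow> p + q \<in> cspan A"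
  by (induction rule: cspan.induct) (auto simp: add.assoc intro: cspan.intros)

lemma cspan_base: "a \<in> A \<Longrightarrow> const_poly c * a \<in> cspan A"
  using cspan_step[OF _ cspan_0, of a A c] by simp

lemma cspan_sum: "(\<And>i. i \<in> I \<Longrightarrow> f i \<in> cspan A) \<Longrightarrow> sum f I \<in> cspan A"
  by (induction I rule: infinite_finite_induct) (auto intro: cspan_0 cspan_add)

lemma cspan_mult_map:
  assumes "p \<in> cspan A" "\<And>a. a \<in> A \<Longrightarrow> t * a \<in> B"
  shows "t * p \<in> cspan B"
  using assms(1)
proof induction
  case (cspan_step a p c)
  have "t * (const_poly c * a + p) = const_poly c * (t * a) + t * p" by (simp add: algebra_simps)
  then show ?case using cspan.cspan_step[OF assms(2)[OF cspan_step(1)] cspan_step(3)] by simp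
qed (simp add: cspan.cspan_0)

lemma cspan_mono: "A \<subseteq> B \<Longrightarrow> cspan A \<subseteq> cspan B"
  using cspan_mult_map[where t = 1] by (auto simp: subset_iff)

lemma cspan_finite:
  assumes "p \<in> cspan A" "finite A"
  shows "\<exists>c. p = (\<Sum>a\<in>A. const_poly (c a) * a)"
  using assms(1)
proof induction
  case cspan_0
  show ?case by (intro exI[of _ "\<lambda>_. 0"]) simp
next
  case (cspan_step a p d)
  then obtain c where c: "p = (\<Sum>a\<in>A. const_poly (c a) * a)" by (elim exE)
  define c' where "c' b = c b + (if b = a then d else 0)" for b
  have "(\<Sum>b\<in>A. const_poly (c' b) * b) = p + (\<Sum>b\<in>A. if b = a then const_poly d * b else 0)"
    unfolding c sum.distrib[symmetric] by (intro sum.cong refl) (simp add: c'_def const_poly_add distrib_right)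
  also have "\<dots> = const_poly d * a + p" using cspan_step assms(2) by (simp add: add.commute)
  finally show ?case by (intro exI[of _ c']) simp
qed

text \<open>Counterpart of \<open>lin_dep_cpoly\<close> for elements of a finitely spanned space: a
  dependence among coordinate vectors suffices, whether or not the spanning set is itself
  independent.\<close>

lemma cspan_dependent:
  assumes "finite A" "finite I" "card A < card I" "\<And>i. i \<in> I \<Longrightarrow> f i \<in> cspan A"
  shows "\<exists>c. (\<exists>i\<in>I. c i \<noteq> 0) \<and> (\<Sum>i\<in>I. const_poly (c i) * f i) = 0"
proof -
  have "\<forall>i\<in>I. \<exists>M. f i = (\<Sum>a\<in>A. const_poly (M a) * a)"
    using cspan_finite[OF assms(4) assms(1)] by (intro ballI)
  from bchoice[OF this] obtain M where M: "\<forall>i\<in>I. f i = (\<Sum>a\<in>A. const_poly (M i a) * a)" by (elim exE)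
  have "\<exists>c. (\<exists>i\<in>I. c i \<noteq> 0) \<and> (\<forall>a\<in>A. (\<Sum>i\<in>I. c i * M i a) = 0)"
    by (rule lin_dep[OF assms(1,2,3)])
  then obtain c where c: "\<exists>i\<in>I. c i \<noteq> 0" "\<forall>a\<in>A. (\<Sum>i\<in>I. c i * M i a) = 0" by (elim exE conjE)
  have "(\<Sum>i\<in>I. const_poly (c i) * f i) = (\<Sum>i\<in>I. \<Sum>a\<in>A. const_poly (c i * M i a) * a)"
    by (intro sum.cong refl) (simp add: M sum_distrib_left const_poly_mult mult.assoc)
  also have "\<dots> = (\<Sum>a\<in>A. const_poly (\<Sum>i\<in>I. c i * M i a) * a)"
    by (subst sum.swap) (simp add: const_poly_sum sum_distrib_right)
  also have "\<dots> = 0" using c(2) by simp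
  finally have e: "(\<Sum>i\<in>I. const_poly (c i) * f i) = 0" .
  show ?thesis by (rule exI[of _ c], rule conjI, rule c(1), rule e)
qed

section \<open>The Fischer inner product\<close>

definition monom_fact :: "('x \<Rightarrow>\<^sub>0 nat) \<Rightarrow> complex" where
  "monom_fact u = (\<Prod>x\<in>keys u. fact (lookup u x))"

lemma monom_fact_step: "monom_fact (single x 1 + u) = of_nat (lookup u x + 1) * monom_fact u"
proof -
  have sup: "monom_fact v = (\<Prod>y\<in>S. fact (lookup v y))" if "finite S" "keys v \<subseteq> S" for v S
    unfolding monom_fact_def using that by (intro prod.mono_neutral_left) (auto simp: in_keys_iff)
  let ?K = "keys u - {x}"
  have "monom_fact (single x 1 + u) = (\<Prod>y\<in>insert x ?K. fact (lookup (single x 1 + u) y))"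
    by (rule sup) (auto simp: keys_plus_nat)
  also have "\<dots> = fact (lookup (single x 1 + u) x) *
      (\<Prod>y\<in>?K. fact (lookup (single x 1 + u) y))"
    by (subst prod.insert) auto
  also have "(\<Prod>y\<in>?K. fact (lookup (single x 1 + u) y) :: complex) = (\<Prod>y\<in>?K. fact (lookup u y))"
    by (intro prod.cong refl) (auto simp: lookup_add lookup_single)
  also have "fact (lookup (single x 1 + u) x) =
      of_nat (lookup u x + 1) * (fact (lookup u x) :: complex)"
    by (simp add: lookup_add)
  finally have "monom_fact (single x 1 + u) = of_nat (lookup u x + 1) *
      (\<Prod>y\<in>insert x ?K. fact (lookup u y))"
    by (subst prod.insert) (auto simp: mult.assoc)
  also have "(\<Prod>y\<in>insert x ?K. fact (lookup u y)) = monom_fact u"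
    by (rule sup[symmetric]) auto
  finally show ?thesis .
qed

lemma monom_fact_0 [simp]: "monom_fact 0 = 1"
  by (simp add: monom_fact_def)

lemma monom_fact_real: "\<exists>r > 0. monom_fact u = of_real r"
  by (intro exI[of _ "\<Prod>x\<in>keys u. fact (lookup u x)"])
    (simp add: monom_fact_def prod_pos)

text \<open>Also known as the apolar product. The factorial weights make multiplication by a
  variable adjoint to the derivative in that variable, and the adjoint of a linear substitution
  again a linear substitution.\<close>

definition fischer :: "'x cpoly \<Rightarrow> 'x cpoly \<Rightarrow> complex" where
  "fischer p q = (\<Sum>u\<in>keys p. monom_fact u * lookup p u * cnj (lookup q u))"

lemma fischer_superset:
  assumes "finite S" "keys p \<subseteq> S"
  shows "fischer p q = (\<Sum>u\<in>S. monom_fact u * lookup p u * cnj (lookup q u))"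
  unfolding fischer_def using assms by (intro sum.mono_neutral_left) (auto simp: in_keys_iff)

lemma fischer_add_left: "fischer (p + p') q = fischer p q + fischer p' q"
proof -
  let ?S = "keys p \<union> keys p'"
  have "keys (p + p') \<subseteq> ?S" by (rule Poly_Mapping.keys_add)
  then show ?thesis
    by (simp add: fischer_superset[where S = ?S] lookup_add algebra_simps sum.distrib)
qed

lemma fischer_add_right: "fischer p (q + q') = fischer p q + fischer p q'"
  by (simp add: fischer_def lookup_add algebra_simps sum.distrib)

lemma fischer_0 [simp]: "fischer 0 q = 0" "fischer p 0 = 0"
  by (simp_all add: fischer_def)

lemma fischer_const_left: "fischer (const_poly c * p) q = c * fischer p q"
proof -
  have "keys (const_poly c * p) \<subseteq> keys p"
    by (auto simp: in_keys_iff lookup_const_mult)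
  then show ?thesis
    by (simp add: fischer_superset[where S = "keys p"] lookup_const_mult sum_distrib_left mult.assoc mult.left_commute)
qed

lemma fischer_const_right: "fischer p (const_poly c * q) = cnj c * fischer p q"
  by (simp add: fischer_def lookup_const_mult sum_distrib_left mult.assoc mult.left_commute)

lemma fischer_sum_left: "fischer (sum f A) q = (\<Sum>i\<in>A. fischer (f i) q)"
  by (induction A rule: infinite_finite_induct) (auto simp: fischer_add_left)
lemma fischer_sum_right: "fischer p (sum f A) = (\<Sum>i\<in>A. fischer p (f i))"
  by (induction A rule: infinite_finite_induct) (auto simp: fischer_add_right)
lemma fischer_diff_left: "fischer (p - p') q = fischer p q - fischer p' q"
  using fischer_add_left[of "p - p'" p' q] by simp
lemma fischer_diff_right: "fischer p (q - q') = fischer p q - fischer p q'"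
  using fischer_add_right[of p "q - q'" q'] by simp

lemma fischer_cnj: "cnj (fischer p q) = fischer q p"
proof -
  let ?S = "keys p \<union> keys q"
  have "cnj (monom_fact u) = monom_fact u" for u :: "'a \<Rightarrow>\<^sub>0 nat" using monom_fact_real[of u] by auto
  then show ?thesis
    by (simp add: fischer_superset[where S = ?S] cnj_sum algebra_simps)
qed

lemma fischer_eq_0: 
  assumes "fischer p p = 0" shows "p = 0"
proof (rule poly_mapping_eqI)
  fix u
  obtain r :: "('a \<Rightarrow>\<^sub>0 nat) \<Rightarrow> real" where r: "\<And>u. r u > 0" "\<And>u. monom_fact u = of_real (r u)" using monom_fact_real by metis
  have "fischer p p = of_real (\<Sum>u\<in>keys p. r u * (cmod (lookup p u))\<^sup>2)"
    unfolding fischer_def of_real_sum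
    by (intro sum.cong refl) (simp add: r mult.assoc complex_norm_square[symmetric] del: of_real_power)
  then have "(\<Sum>u\<in>keys p. r u * (cmod (lookup p u))\<^sup>2) = 0" using assms of_real_eq_0_iff by metis
  then have "\<forall>u\<in>keys p. r u * (cmod (lookup p u))\<^sup>2 = 0"
    by (subst (asm) sum_nonneg_eq_0_iff) (auto simp: r less_imp_le)
  then show "lookup p u = lookup 0 u"
    using r(1)[of u] by (cases "u \<in> keys p") (auto simp: in_keys_iff)
qed

lemma fischer_single: "fischer (single u c) q = monom_fact u * c * cnj (lookup q u)"
  by (subst fischer_superset[where S = "{u}"]) auto

lemma fischer_const: "fischer (const_poly c) q = c * cnj (lookup q 0)"
  by (simp add: const_poly_def fischer_single)

text \<open>Multiplying a monomial by \<open>x\<close> multiplies its weight by the new exponent of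
  \<open>x\<close>, and differentiation produces the same factor.\<close>

lemma fischer_var: "fischer (var x * p) q = fischer p (pdiff x q)"
proof -
  have "fischer (var x * p) q = (\<Sum>u\<in>keys p. fischer (single (single x 1 + u) (lookup p u)) q)"
    by (subst cpoly_sum_monomials[of p, symmetric]) (simp add: sum_distrib_left var_def mult_single fischer_sum_left)
  also have "\<dots> = fischer p (pdiff x q)"
    unfolding fischer_def[of p]
  proof (intro sum.cong refl)
    fix u
    have m: "monom_fact (u + single x 1) = of_nat (lookup u x + 1) * monom_fact u"
      by (subst add.commute) (rule monom_fact_step)
    show "fischer (single (single x 1 + u) (lookup p u)) q =
        monom_fact u * lookup p u * cnj (lookup (pdiff x q) u)"
      unfolding add.commute[of "single x 1" u] fischer_single lookup_pdiff m
        complex_cnj_mult complex_cnj_of_nat by (simp only: mult_ac)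
  qed
  finally show ?thesis .
qed

lemma fischer_hcomp:
  assumes "homogeneous d p"
  shows "fischer p q = fischer p (hcomp d q)"
  unfolding fischer_def using assms by (intro sum.cong refl) (auto simp: lookup_hcomp homogeneous_def)

text \<open>The adjoint is the differential operator obtained from \<open>r\<close> by conjugating
  coefficients and replacing variables by derivatives, hence it introduces no new variables.\<close>

lemma mult_adjoint:
  "\<exists>T. (\<forall>f s. fischer (r * f) s = fischer f (T s)) \<and> (\<forall>s\<in>cpolys_in V. T s \<in> cpolys_in V)"
proof (induction r rule: cpoly_induct)
  case (const c)
  show ?case
    by (intro exI[of _ "\<lambda>s. const_poly (cnj c) * s"] conjI allI ballI)
      (auto simp: fischer_const_left fischer_const_right)
next
  case (add p q)
  then obtain T U where "\<forall>f s. fischer (p * f) s = fischer f (T s)" "\<forall>s\<in>cpolys_in V. T s \<in> cpolys_in V"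
     "\<forall>f s. fischer (q * f) s = fischer f (U s)" "\<forall>s\<in>cpolys_in V. U s \<in> cpolys_in V" by (elim exE conjE)
  then show ?case
    by (intro exI[of _ "\<lambda>s. T s + U s"] conjI allI ballI)
      (auto simp: distrib_right fischer_add_left fischer_add_right)
next
  case (var x p)
  then obtain T where "\<forall>f s. fischer (p * f) s = fischer f (T s)" "\<forall>s\<in>cpolys_in V. T s \<in> cpolys_in V" by (elim exE conjE)
  then show ?case
    by (intro exI[of _ "\<lambda>s. T (pdiff x s)"] conjI allI ballI)
      (auto simp: mult.assoc fischer_var)
qed

text \<open>An orthogonal set of nonzero elements is independent, so its size is at most
  \<open>card S\<close>. For one of maximal size the residue of \<open>w\<close> after projection
  must vanish, since it could otherwise be added. The lemma also serves merely to produce finite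
  spanning sets.\<close>

lemma finite_orthogonal_basis:
  assumes S: "finite S" "\<And>w. w \<in> W \<Longrightarrow> keys w \<subseteq> S"
    and W: "\<And>v w. v \<in> W \<Longrightarrow> w \<in> W \<Longrightarrow> v + w \<in> W" "\<And>c w. w \<in> W \<Longrightarrow> const_poly c * w \<in> W"
  shows "\<exists>B. finite B \<and> B \<subseteq> W \<and> W \<subseteq> cspan B \<and> 0 \<notin> B \<and> (\<forall>a\<in>B. \<forall>b\<in>B. a \<noteq> b \<longrightarrow> fischer a b = 0)"
proof (cases "W = {}")
  case True
  then show ?thesis by (intro exI[of _ "{}"]) auto
next
  case False
  then have W0: "0 \<in> W" using W(2)[of _ 0] by auto
  define orth where "orth B \<longleftrightarrow> finite B \<and> B \<subseteq> W \<and> 0 \<notin> B \<and> (\<forall>a\<in>B. \<forall>b\<in>B. a \<noteq> b \<longrightarrow> fischer a b = 0)" for B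
  have bound: "card B \<le> card S" if B: "orth B" for B
  proof (rule ccontr)
    assume "\<not> card B \<le> card S"
    then have "card S < card B" by simp
    moreover have "finite B" "\<And>a. a \<in> B \<Longrightarrow> keys a \<subseteq> S" using B S(2) by (auto simp: orth_def)
    ultimately have "\<exists>c. (\<exists>a\<in>B. c a \<noteq> 0) \<and> (\<Sum>a\<in>B. const_poly (c a) * a) = 0"
      by (intro lin_dep_cpoly[OF S(1)])
    then obtain c where c: "\<exists>a\<in>B. c a \<noteq> 0" "(\<Sum>a\<in>B. const_poly (c a) * a) = 0" by (elim exE conjE)
    obtain b where b: "b \<in> B" "c b \<noteq> 0" using c(1) by blast
    have "0 = fischer (\<Sum>a\<in>B. const_poly (c a) * a) b" by (simp add: c(2))
    also have "\<dots> = (\<Sum>a\<in>B. if a = b then c b * fischer b b else 0)"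
      unfolding fischer_sum_left fischer_const_left
      using B b(1) by (intro sum.cong refl) (auto simp: orth_def)
    also have "\<dots> = c b * fischer b b" using b(1) \<open>finite B\<close> by simp
    finally have "fischer b b = 0" using b(2) by simp
    then have "b = 0" by (rule fischer_eq_0)
    then show False using b B by (auto simp: orth_def)
  qed
  have "orth {}" by (simp add: orth_def)
  have "\<exists>B. orth B \<and> (\<forall>C. orth C \<longrightarrow> card C \<le> card B)"
    by (rule ex_has_greatest_nat[of orth "{}" card "Suc (card S)"]) (use \<open>orth {}\<close> bound in \<open>auto simp: less_Suc_eq_le\<close>)
  then obtain B where B: "orth B" "\<And>C. orth C \<Longrightarrow> card C \<le> card B" by blast
  have fB: "finite B" "B \<subseteq> W" using B(1) by (auto simp: orth_def)
  have sumW: "(\<Sum>b\<in>C. const_poly (c b) * b) \<in> W" if "finite C" "C \<subseteq> B" for c C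
    using that by (induction C) (use W0 W fB in auto)
  have "w \<in> cspan B" if w: "w \<in> W" for w
  proof -
    define c where "c b = fischer w b / fischer b b" for b
    define v where "v = (\<Sum>b\<in>B. const_poly (c b) * b)"
    have "w - v \<in> W"
    proof -
      have "const_poly (-1) * v \<in> W" using sumW[of B c] fB W(2) by (simp add: v_def)
      then have "w + const_poly (-1) * v \<in> W" using w W(1) by blast
      then show ?thesis by (simp add: const_poly_uminus)
    qed
    have orth_b: "fischer (w - v) b = 0" if b: "b \<in> B" for b
    proof -
      have "fischer v b = (\<Sum>a\<in>B. if a = b then c b * fischer b b else 0)"
        unfolding v_def fischer_sum_left fischer_const_left
        using B(1) b by (intro sum.cong refl) (auto simp: orth_def)
      also have "\<dots> = c b * fischer b b" using b fB by simp
      also have "\<dots> = fischer w b"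
      proof -
        have "b \<noteq> 0" using b B(1) by (auto simp: orth_def)
        then have "fischer b b \<noteq> 0" using fischer_eq_0[of b] by blast
        then show ?thesis by (simp add: c_def)
      qed
      finally show ?thesis by (simp add: fischer_diff_left)
    qed
    have "w - v = 0"
    proof (rule ccontr)
      assume ne: "w - v \<noteq> 0"
      have nin: "w - v \<notin> B"
      proof
        assume "w - v \<in> B"
        then have "fischer (w - v) (w - v) = 0" by (rule orth_b)
        then show False using ne fischer_eq_0 by blast
      qed
      have "orth (insert (w - v) B)"
        unfolding orth_def
      proof (intro conjI ballI impI)
        fix a b assume ab: "a \<in> insert (w - v) B" "b \<in> insert (w - v) B" "a \<noteq> b"
        have "fischer b (w - v) = 0" if "b \<in> B" for b
          using orth_b[OF that] fischer_cnj[of "w - v" b] by simp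
        then show "fischer a b = 0" using ab orth_b B(1) by (auto simp: orth_def)
      qed (use ne B(1) \<open>w - v \<in> W\<close> in \<open>auto simp: orth_def\<close>)
      from B(2)[OF this] show False using nin fB by simp
    qed
    then have "w = v" by simp
    then show ?thesis unfolding v_def by (auto intro: cspan_sum cspan_base)
  qed
  then show ?thesis using B(1) by (intro exI[of _ B]) (auto simp: orth_def)
qed

section \<open>Linear substitutions and their invariants\<close>

definition lin_sub :: "('x \<Rightarrow> 'x set) \<Rightarrow> ('x \<Rightarrow> 'x \<Rightarrow> complex) \<Rightarrow> 'x \<Rightarrow> 'x cpoly" where
  "lin_sub N L x = (\<Sum>y\<in>N x. const_poly (L x y) * var y)"

text \<open>\<open>N x\<close> lists the variables that may occur in the image of \<open>x\<close>;
  it keeps the linear forms finite although there may be infinitely many variables. Closure of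
  \<open>\<G>\<close> under conjugate transposition takes the place of a compact form of the
  group.\<close>

locale selfadjoint_family =
  fixes N :: "'x::countable \<Rightarrow> 'x set" and V :: "'x set" and \<G> :: "('x \<Rightarrow> 'x \<Rightarrow> complex) set"
  assumes finite_N: "finite (N x)" and N_sym: "y \<in> N x \<longleftrightarrow> x \<in> N y" and N_V: "x \<in> V \<Longrightarrow> N x \<subseteq> V"
    and finite_V: "finite V"
    and adjoint_in: "L \<in> \<G> \<Longrightarrow> (\<lambda>x y. cnj (L y x)) \<in> \<G>"
begin

lemma pdiff_lin_form_mult:
  "pdiff z (lin_sub N L x * r) = (if x \<in> N z then const_poly (L x z) * r else 0) + lin_sub N L x * pdiff z r"
proof -
  have "pdiff z (lin_sub N L x * r) = (\<Sum>y\<in>N x. pdiff z (const_poly (L x y) * (var y * r)))"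
    by (simp add: lin_sub_def sum_distrib_right pdiff_sum mult.assoc)
  also have "\<dots> = (\<Sum>y\<in>N x. (if y = z then const_poly (L x z) * r else 0) + const_poly (L x y) * var y * pdiff z r)"
    by (intro sum.cong refl) (auto simp: pdiff_const_mult pdiff_var_mult distrib_left mult.assoc)
  also have "\<dots> = (if x \<in> N z then const_poly (L x z) * r else 0) + lin_sub N L x * pdiff z r"
    by (simp add: sum.distrib lin_sub_def sum_distrib_right finite_N N_sym[of z])
  finally show ?thesis .
qed

text \<open>The chain rule. Symmetry of \<open>N\<close> turns the condition that \<open>z\<close>
  may occur in the form of \<open>x\<close> into \<open>x \<in> N z\<close>.\<close>

lemma pdiff_lin_sub:
  "pdiff z (sbst (lin_sub N L) q) = (\<Sum>x\<in>N z. const_poly (L x z) * sbst (lin_sub N L) (pdiff x q))"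
proof (induction q rule: cpoly_induct)
  case (const c)
  then show ?case by (simp add: sb.subst_simps)
next
  case (add p q)
  then show ?case by (simp add: sb.subst_simps pdiff_add sum.distrib algebra_simps)
next
  case (var y q)
  have "(\<Sum>x\<in>N z. const_poly (L x z) * sbst (lin_sub N L) (pdiff x (var y * q))) =
     (\<Sum>x\<in>N z. (if x = y then const_poly (L y z) * sbst (lin_sub N L) q else 0) +
        lin_sub N L y * (const_poly (L x z) * sbst (lin_sub N L) (pdiff x q)))"
    by (intro sum.cong refl) (simp add: pdiff_var_mult sb.subst_simps distrib_left mult.left_commute)
  also have "\<dots> = pdiff z (sbst (lin_sub N L) (var y * q))"
    by (simp add: sum.distrib sum_distrib_left[symmetric] var.IH[symmetric] sb.subst_simps pdiff_lin_form_mult finite_N)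
  finally show ?case by simp
qed

lemma lookup_0_eval: "lookup p 0 = eval (\<lambda>_. 0) p"
proof -
  have "eval (\<lambda>_. 0) p = (\<Sum>u\<in>keys p. if u = 0 then lookup p u else 0)"
    unfolding eval_def poly_subst_def mpow_def[symmetric] id_apply
  proof (intro sum.cong refl)
    fix u
    show "lookup p u * mpow (\<lambda>_. 0) u = (if u = 0 then lookup p u else 0)"
    proof (cases "u = 0")
      case False
      then obtain x where "x \<in> keys u" using keys_nonempty by blast
      then have "mpow (\<lambda>_. 0 :: complex) u = 0"
        unfolding mpow_def by (intro prod_zero) (auto simp: in_keys_iff)
      then show ?thesis using False by simp
    qed simp
  qed
  then show ?thesis by (simp add: in_keys_iff)
qed

text \<open>Multiplication by a variable and differentiation are adjoint, and the chain rule for the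
  conjugate transpose reproduces the coefficients of the form substituted for the variable; the
  claim follows by induction on \<open>p\<close>.\<close>

lemma fischer_lin_sub:
  "fischer (sbst (lin_sub N L) p) q = fischer p (sbst (lin_sub N (\<lambda>x y. cnj (L y x))) q)"
proof (induction p arbitrary: q rule: cpoly_induct)
  case (const c)
  have "eval (\<lambda>_. 0) (sbst (lin_sub N L) q) = eval (\<lambda>_. 0) q" for L
    by (simp add: eval_sbst lin_sub_def eval_simps)
  then show ?case by (simp add: sb.subst_simps fischer_const lookup_0_eval)
next
  case (add p q)
  then show ?case by (simp add: sb.subst_simps fischer_add_left)
next
  case (var x p)
  have "fischer (sbst (lin_sub N L) (var x * p)) q = (\<Sum>y\<in>N x. L x y * fischer (sbst (lin_sub N L) p) (pdiff y q))"
    by (simp add: sb.subst_simps lin_sub_def sum_distrib_right fischer_sum_left mult.assoc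
        fischer_const_left fischer_var)
  also have "\<dots> = fischer p (\<Sum>y\<in>N x. const_poly (cnj (L x y)) * sbst (lin_sub N (\<lambda>x y. cnj (L y x))) (pdiff y q))"
    by (simp add: var.IH fischer_sum_right fischer_const_right)
  also have "\<dots> = fischer (var x * p) (sbst (lin_sub N (\<lambda>x y. cnj (L y x))) q)"
    by (simp add: fischer_var pdiff_lin_sub)
  finally show ?case .
qed

definition invs :: "'x cpoly set" where
  "invs = {p \<in> cpolys_in V. \<forall>L\<in>\<G>. sbst (lin_sub N L) p = p}"

lemma invs_const [intro, simp]: "const_poly c \<in> invs"
  by (auto simp: invs_def sb.subst_simps)
lemma invs_0 [intro, simp]: "0 \<in> invs"
  by (auto simp: invs_def sb.subst_simps)
lemma invs_1 [intro, simp]: "1 \<in> invs"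
  by (auto simp: invs_def sb.subst_simps)
lemma invs_add [intro]: "p \<in> invs \<Longrightarrow> q \<in> invs \<Longrightarrow> p + q \<in> invs"
  by (auto simp: invs_def sb.subst_simps)
lemma invs_mult [intro]: "p \<in> invs \<Longrightarrow> q \<in> invs \<Longrightarrow> p * q \<in> invs"
  by (auto simp: invs_def sb.subst_simps)
lemma invs_diff [intro]: "p \<in> invs \<Longrightarrow> q \<in> invs \<Longrightarrow> p - q \<in> invs"
  by (auto simp: invs_def sb.subst_simps)
lemma invs_sum [intro]: "(\<And>i. i \<in> A \<Longrightarrow> f i \<in> invs) \<Longrightarrow> sum f A \<in> invs"
  by (induction A rule: infinite_finite_induct) auto
lemma invs_power [intro]: "p \<in> invs \<Longrightarrow> p ^ n \<in> invs"
  by (induction n) auto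
lemma invs_prod [intro]: "(\<And>i. i \<in> A \<Longrightarrow> f i \<in> invs) \<Longrightarrow> prod f A \<in> invs"
  by (induction A rule: infinite_finite_induct) auto
lemma invs_mpow: "(\<And>x. x \<in> keys u \<Longrightarrow> f x \<in> invs) \<Longrightarrow> mpow f u \<in> invs"
  unfolding mpow_def by (intro invs_prod invs_power)
lemma invs_cpolys_in: "p \<in> invs \<Longrightarrow> p \<in> cpolys_in V"
  by (simp add: invs_def)

lemma hcomp_lin_sub: "hcomp d (sbst (lin_sub N L) p) = sbst (lin_sub N L) (hcomp d p)"
proof -
  have hom: "homogeneous e (sbst (lin_sub N L) q)" if "homogeneous e q" for e q
  proof -
    have "homogeneous 1 (lin_sub N L x)" for x
      unfolding lin_sub_def by (intro homogeneous_sum homogeneous_const_mult homogeneous_var)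
    from homogeneous_sbst[OF that this] show ?thesis by simp
  qed
  obtain D where D: "p = (\<Sum>d\<le>D. hcomp d p)" using ex_hcomp_decomp by blast
  have "hcomp d (sbst (lin_sub N L) p) = (\<Sum>e\<le>D. hcomp d (sbst (lin_sub N L) (hcomp e p)))"
    by (subst D) (simp add: sb.subst_sum hcomp_sum)
  also have "\<dots> = (\<Sum>e\<le>D. sbst (lin_sub N L) (hcomp d (hcomp e p)))"
    by (intro sum.cong refl)
      (simp add: hcomp_homogeneous[OF hom[OF homogeneous_hcomp]] hcomp_homogeneous[OF homogeneous_hcomp] sb.subst_simps)
  also have "\<dots> = sbst (lin_sub N L) (hcomp d (\<Sum>e\<le>D. hcomp e p))"
    by (simp add: sb.subst_sum hcomp_sum)
  finally show ?thesis using D by simp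
qed

lemma invs_hcomp [intro]: "p \<in> invs \<Longrightarrow> hcomp d p \<in> invs"
  by (auto simp: invs_def hcomp_lin_sub[symmetric])

text \<open>Move the substitution \<open>L\<close> from \<open>T s\<close> to the test polynomial as
  its conjugate transpose. There it commutes with multiplication by the invariant \<open>r\<close>,
  and moved back it acts on \<open>s\<close>, which it fixes. Since the product is definite,
  \<open>L\<close> fixes \<open>T s\<close>.\<close>

lemma mult_adjoint_invs:
  assumes r: "r \<in> invs"
    and T: "\<And>f s. fischer (r * f) s = fischer f (T s)" "\<And>s. s \<in> cpolys_in V \<Longrightarrow> T s \<in> cpolys_in V"
    and s: "s \<in> invs"
  shows "T s \<in> invs"
proof -
  have "sbst (lin_sub N L) (T s) = T s" if L: "L \<in> \<G>" for L
  proof -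
    let ?L' = "\<lambda>x y. cnj (L y x)"
    have L': "?L' \<in> \<G>" by (rule adjoint_in[OF L])
    have adj: "fischer (sbst (lin_sub N ?L') f) q = fischer f (sbst (lin_sub N L) q)" for f q
      using fischer_lin_sub[of ?L'] by simp
    have "fischer f (sbst (lin_sub N L) (T s)) = fischer f (T s)" for f
    proof -
      have "fischer f (sbst (lin_sub N L) (T s)) = fischer (r * sbst (lin_sub N ?L') f) s"
        by (simp add: adj[symmetric] T(1))
      also have "r * sbst (lin_sub N ?L') f = sbst (lin_sub N ?L') (r * f)"
        using r L' by (simp add: sb.subst_simps invs_def)
      also have "fischer \<dots> s = fischer (r * f) s"
        using s L by (simp add: adj invs_def)
      finally show ?thesis by (simp add: T(1))
    qed
    then have "fischer (sbst (lin_sub N L) (T s) - T s) (sbst (lin_sub N L) (T s) - T s) = 0"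
      unfolding fischer_diff_right by simp
    from fischer_eq_0[OF this] show ?thesis by simp
  qed
  then show ?thesis using T(2) s by (simp add: invs_def)
qed

section \<open>Ideals of the ring of invariants\<close>

definition ridl :: "'x cpoly set \<Rightarrow> 'x cpoly set" where
  "ridl T = {\<Sum>t\<in>T. b t * t | b. \<forall>t\<in>T. b t \<in> invs}"

lemma ridl_0: "0 \<in> ridl T"
  unfolding ridl_def by (intro CollectI exI[of _ "\<lambda>_. 0"]) auto

lemma ridl_add: 
  assumes "p \<in> ridl T" "q \<in> ridl T" shows "p + q \<in> ridl T"
proof -
  obtain a b where "\<forall>t\<in>T. a t \<in> invs" "p = (\<Sum>t\<in>T. a t * t)" "\<forall>t\<in>T. b t \<in> invs" "q = (\<Sum>t\<in>T. b t * t)"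
    using assms unfolding ridl_def by (elim CollectE exE conjE)
  then show ?thesis unfolding ridl_def
    by (intro CollectI exI[of _ "\<lambda>t. a t + b t"]) (auto simp: distrib_right sum.distrib)
qed

lemma ridl_mult: 
  assumes "p \<in> ridl T" "r \<in> invs" shows "r * p \<in> ridl T"
proof -
  obtain a where "\<forall>t\<in>T. a t \<in> invs" "p = (\<Sum>t\<in>T. a t * t)"
    using assms unfolding ridl_def by (elim CollectE exE conjE)
  then show ?thesis unfolding ridl_def using assms(2)
    by (intro CollectI exI[of _ "\<lambda>t. r * a t"]) (auto simp: sum_distrib_left mult.assoc)
qed

lemma ridl_mono:
  assumes "T \<subseteq> U" "finite U" shows "ridl T \<subseteq> ridl U"
proof
  fix p assume "p \<in> ridl T"
  then obtain a where a: "\<forall>t\<in>T. a t \<in> invs" "p = (\<Sum>t\<in>T. a t * t)"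
    unfolding ridl_def by (elim CollectE exE conjE)
  have "p = (\<Sum>t\<in>U. (if t \<in> T then a t else 0) * t)"
    unfolding a(2) using assms by (intro sum.mono_neutral_cong_left) auto
  then show "p \<in> ridl U" unfolding ridl_def using a(1)
    by (intro CollectI exI[of _ "\<lambda>t. if t \<in> T then a t else 0"]) auto
qed

text \<open>Taking the component of degree \<open>d\<close> of each product makes the coefficients
  homogeneous. Subtraction of natural numbers is cut off at 0, so for generators of degree above
  \<open>d\<close> the vanishing of the term is asserted separately.\<close>

lemma ridl_hcomp:
  assumes "p \<in> ridl T" "\<forall>t\<in>T. \<exists>e. homogeneous e t"
  shows "\<exists>b. (\<forall>t\<in>T. b t \<in> invs \<and> (\<forall>e. homogeneous e t \<longrightarrow> homogeneous (d - e) (b t) \<and> (d < e \<longrightarrow> b t * t = 0))) \<and>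
    hcomp d p = (\<Sum>t\<in>T. b t * t)"
proof -
  obtain a where a: "\<forall>t\<in>T. a t \<in> invs" "p = (\<Sum>t\<in>T. a t * t)"
    using assms(1) unfolding ridl_def by (elim CollectE exE conjE)
  define e where "e t = (SOME e. homogeneous e t)" for t :: "'x cpoly"
  have e: "homogeneous (e t) t" if "t \<in> T" for t unfolding e_def using bspec[OF assms(2) that] by (rule someI_ex)
  \<comment> \<open>The polynomial 0 is homogeneous of every degree \<open>e\<close>; the
    coefficient 0 satisfies the degree condition for all of them at once.\<close>
  define b where "b t = (if t = 0 then 0 else if e t \<le> d then hcomp (d - e t) (a t) else 0)" for t
  have ee: "e' = e t" if "t \<in> T" "homogeneous e' t" "t \<noteq> 0" for t e'
    using e[OF that(1)] that(2) keys_nonempty[OF that(3)] by (auto simp: homogeneous_def)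
  have "hcomp d p = (\<Sum>t\<in>T. hcomp d (a t * t))" by (simp add: a(2) hcomp_sum)
  also have "\<dots> = (\<Sum>t\<in>T. b t * t)"
    by (intro sum.cong refl) (simp add: hcomp_mult[OF e] b_def)
  finally have "hcomp d p = (\<Sum>t\<in>T. b t * t)" .
  moreover have "\<forall>t\<in>T. b t \<in> invs \<and> (\<forall>e. homogeneous e t \<longrightarrow> homogeneous (d - e) (b t) \<and> (d < e \<longrightarrow> b t * t = 0))"
  proof (intro ballI conjI allI impI)
    fix t assume t: "t \<in> T"
    show "b t \<in> invs" using a(1) t by (auto simp: b_def)
    fix e' assume h: "homogeneous e' t"
    show "homogeneous (d - e') (b t)" using ee[OF t h] by (cases "t = 0") (auto simp: b_def)
    show "b t * t = 0" if "d < e'" using ee[OF t h] that by (cases "t = 0") (auto simp: b_def)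
  qed
  ultimately show ?thesis by (intro exI[of _ b]) (rule conjI)
qed

definition monoms :: "nat \<Rightarrow> ('x \<Rightarrow>\<^sub>0 nat) set" where
  "monoms d = monom_box V (Suc d)"

lemma finite_monoms: "finite (monoms d)"
  by (simp add: monoms_def finite_monom_box finite_V)

lemma keys_monoms: "p \<in> cpolys_in V \<Longrightarrow> homogeneous d p \<Longrightarrow> keys p \<subseteq> monoms d"
  using lookup_le_monom_degree
  by (fastforce simp: monoms_def monom_box_def cpolys_in_iff homogeneous_def less_Suc_eq_le)

text \<open>Split off from \<open>f\<close> its orthogonal projection to the degree \<open>d\<close> part of \<open>ridl T\<close>. The rest \<open>h\<close> is invariant, so the
  adjoint of multiplication by \<open>t \<in> T\<close> maps it to an invariant that is orthogonal to all invariants, hence to 0;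
  therefore \<open>h\<close> is orthogonal to the whole ideal, in particular to itself.\<close>

theorem reynolds:
  assumes T: "finite T" "T \<subseteq> invs" "\<forall>t\<in>T. \<exists>e. homogeneous e t"
    and f: "f \<in> invs" "homogeneous d f" "f \<in> idl T"
  shows "f \<in> ridl T"
proof -
  define W where "W = {w \<in> ridl T. homogeneous d w}"
  have ridl_invs: "ridl T \<subseteq> invs" using T(2) by (auto simp: ridl_def)
  have "\<exists>B. finite B \<and> B \<subseteq> W \<and> W \<subseteq> cspan B \<and> 0 \<notin> B \<and> (\<forall>a\<in>B. \<forall>b\<in>B. a \<noteq> b \<longrightarrow> fischer a b = 0)"
  proof (rule finite_orthogonal_basis[OF finite_monoms[of d]])
    show "keys w \<subseteq> monoms d" if "w \<in> W" for w
      using that ridl_invs invs_cpolys_in by (intro keys_monoms) (auto simp: W_def)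
    show "v + w \<in> W" if "v \<in> W" "w \<in> W" for v w using that by (auto simp: W_def ridl_add)
    show "const_poly c * w \<in> W" if "w \<in> W" for c w using that by (auto simp: W_def ridl_mult)
  qed
  then obtain B where B: "finite B" "B \<subseteq> W" "W \<subseteq> cspan B" "0 \<notin> B" "\<forall>a\<in>B. \<forall>b\<in>B. a \<noteq> b \<longrightarrow> fischer a b = 0"
    by (elim exE conjE)
  define w where "w = (\<Sum>b\<in>B. const_poly (fischer f b / fischer b b) * b)"
  define h where "h = f - w"
  have wW: "w \<in> W"
  proof -
    have "(\<Sum>b\<in>C. const_poly (fischer f b / fischer b b) * b) \<in> W" if "finite C" "C \<subseteq> B" for C
      using that
    proof (induction C)
      case empty
      then show ?case by (simp add: W_def ridl_0)
    next
      case (insert b C)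
      then have "b \<in> W" using B(2) by blast
      then have "const_poly (fischer f b / fischer b b) * b \<in> W" by (auto simp: W_def ridl_mult)
      then show ?case using insert by (auto simp: W_def ridl_add)
    qed
    then show ?thesis using B(1) by (simp add: w_def)
  qed
  have hB: "fischer h b = 0" if b: "b \<in> B" for b
  proof -
    have "fischer w b = (\<Sum>a\<in>B. if a = b then fischer f b / fischer b b * fischer b b else 0)"
      unfolding w_def fischer_sum_left fischer_const_left
      using B(5) b by (intro sum.cong refl) auto
    also have "\<dots> = fischer f b / fischer b b * fischer b b" using b B(1) by simp
    also have "\<dots> = fischer f b" using fischer_eq_0[of b] b B(4) by auto
    finally show ?thesis by (simp add: h_def fischer_diff_left)
  qed
  have hW: "fischer h v = 0" if "v \<in> W" for v
  proof -
    have "v \<in> cspan B" using that B(3) by blast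
    then show ?thesis by induction (auto simp: fischer_add_right fischer_const_right hB)
  qed
  have h_inv: "h \<in> invs" "homogeneous d h"
    using f wW ridl_invs by (auto simp: h_def W_def)
  have h_orth: "fischer (t * a) h = 0" if t: "t \<in> T" for t a
  proof -
    obtain A where A': "\<forall>f s. fischer (t * f) s = fischer f (A s)" "\<forall>s\<in>cpolys_in V. A s \<in> cpolys_in V"
      using mult_adjoint[of t V] by (elim exE conjE)
    note A = A'(1)[rule_format] A'(2)[rule_format]
    have Ah: "A h \<in> invs" using mult_adjoint_invs[OF _ A h_inv(1)] T(2) t by blast
    have Aht: "A h * t \<in> ridl T"
    proof -
      have "t \<in> ridl T" unfolding ridl_def
        using t T(1) by (intro CollectI exI[of _ "\<lambda>s. if s = t then 1 else 0"]) (auto simp: if_distrib[of "\<lambda>x. x * _"] cong: if_cong)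
      then show ?thesis using ridl_mult Ah by blast
    qed
    \<comment> \<open>\<open>A h * t\<close> may have several components. Only that of degree
      \<open>d\<close> pairs with \<open>h\<close>, and it lies in \<open>W\<close>, to which
      \<open>h\<close> is orthogonal.\<close>
    from ridl_hcomp[OF this T(3), of d] obtain b where
      "\<forall>t\<in>T. b t \<in> invs \<and> (\<forall>e. homogeneous e t \<longrightarrow> homogeneous (d - e) (b t) \<and> (d < e \<longrightarrow> b t * t = 0))"
      "hcomp d (A h * t) = (\<Sum>t\<in>T. b t * t)" by (elim exE conjE)
    then have "hcomp d (A h * t) \<in> ridl T" unfolding ridl_def by (intro CollectI exI[of _ b]) simp
    then have "hcomp d (A h * t) \<in> W" by (simp add: W_def)
    from hW[OF this] have "fischer h (A h * t) = 0" by (subst fischer_hcomp[OF h_inv(2)])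
    then have "fischer (t * A h) h = 0" using fischer_cnj[of h "A h * t"] by (simp add: mult.commute)
    then have "fischer (A h) (A h) = 0" by (simp add: A(1))
    then have "A h = 0" by (rule fischer_eq_0)
    then show ?thesis by (simp add: A(1))
  qed
  obtain a where a: "f = (\<Sum>t\<in>T. a t * t)" using f(3) idl_finite[OF T(1)] by blast
  obtain b where b: "w = (\<Sum>t\<in>T. b t * t)" using wW by (auto simp: W_def ridl_def)
  have "h = (\<Sum>t\<in>T. t * (a t - b t))" unfolding h_def a b by (simp add: sum_subtractf algebra_simps)
  moreover have "fischer (\<Sum>t\<in>T. t * (a t - b t)) h = 0"
    unfolding fischer_sum_left using h_orth by simp
  ultimately have "fischer h h = 0" by simp
  then have "h = 0" by (rule fischer_eq_0)
  then show ?thesis using wW by (simp add: h_def W_def)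
qed

text \<open>The generator \<open>g\<close> is nilpotent modulo \<open>F\<close>. Expanding the
  coefficient of \<open>g\<close> again and again shows that an invariant of large degree is a
  combination of the other generators plus a multiple of \<open>g ^ k\<close>, and
  \<open>g ^ k\<close> is itself such a combination. Each removal of a generator raises the degree
  bound by \<open>k * e\<close>.\<close>

lemma eliminate:
  assumes "finite U" "finite F" "F \<subseteq> invs" "\<forall>f\<in>F. \<exists>e. homogeneous e f"
    and "\<forall>g\<in>U. g \<in> invs \<and> (\<exists>e. homogeneous e g) \<and> (\<exists>k. g ^ k \<in> idl F)"
    and "\<forall>d\<ge>D. \<forall>f\<in>invs. homogeneous d f \<longrightarrow> f \<in> ridl (F \<union> U)"
  shows "\<exists>D. \<forall>d\<ge>D. \<forall>f\<in>invs. homogeneous d f \<longrightarrow> f \<in> ridl F"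
  using assms(1,5,6)
proof (induction U arbitrary: D rule: finite_induct)
  case empty
  then show ?case by (intro exI[of _ D]) simp
next
  case (insert g U)
  show ?case
  proof (cases "g \<in> F")
    case True
    then have "F \<union> insert g U = F \<union> U" by blast
    then show ?thesis using insert.IH[of D] insert.prems by simp
  next
    case False
    obtain e k where g: "g \<in> invs" "homogeneous e g" "g ^ k \<in> idl F" using insert.prems(1) by blast
    have fin: "finite (F \<union> U)" using assms(2) insert.hyps by simp
    have hom: "\<forall>t\<in>insert g (F \<union> U). \<exists>e. homogeneous e t"
      using assms(4) insert.prems(1) by blast
    \<comment> \<open>Every round lowers the degree of the coefficient by \<open>e\<close>; the
      summand \<open>n * e\<close> keeps it at least \<open>D\<close>, where the hypothesis
      applies.\<close>
    have iter: "\<exists>w\<in>ridl (F \<union> U). \<exists>b\<in>invs. homogeneous (d - n * e) b \<and> f = w + b * g ^ n"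
      if "d \<ge> D + n * e" "f \<in> invs" "homogeneous d f" for d n f
      using that
    proof (induction n)
      case 0
      then show ?case using ridl_0 by (intro bexI[of _ 0] bexI[of _ f]) auto
    next
      case (Suc n)
      then obtain w b where wb: "w \<in> ridl (F \<union> U)" "b \<in> invs" "homogeneous (d - n * e) b" "f = w + b * g ^ n"
        by auto
      have dn: "d - n * e \<ge> D" "d - n * e \<ge> e" using Suc.prems(1) by auto
      have "b \<in> ridl (insert g (F \<union> U))" using insert.prems(2) dn(1) wb by simp
      from ridl_hcomp[OF this hom, of "d - n * e"] obtain c where
        c: "\<forall>t\<in>insert g (F \<union> U). c t \<in> invs \<and> (\<forall>e'. homogeneous e' t \<longrightarrow> homogeneous (d - n * e - e') (c t) \<and> (d - n * e < e' \<longrightarrow> c t * t = 0))"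
          "hcomp (d - n * e) b = (\<Sum>t\<in>insert g (F \<union> U). c t * t)" by (elim exE conjE)
      have "b = c g * g + (\<Sum>t\<in>F \<union> U. c t * t)"
        using c(2) fin False insert.hyps wb(3) by (simp add: hcomp_homogeneous)
      then have "f = (w + g ^ n * (\<Sum>t\<in>F \<union> U. c t * t)) + c g * g ^ Suc n"
        by (simp add: wb(4) algebra_simps)
      moreover have "(\<Sum>t\<in>F \<union> U. c t * t) \<in> ridl (F \<union> U)" using c(1) by (auto simp: ridl_def)
      then have "w + g ^ n * (\<Sum>t\<in>F \<union> U. c t * t) \<in> ridl (F \<union> U)"
        using wb(1) g(1) by (intro ridl_add ridl_mult invs_power)
      moreover have "c g \<in> invs" "homogeneous (d - Suc n * e) (c g)" using c(1) g(2) by (auto simp: add.commute)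
      ultimately show ?case
        by (intro bexI[of _ "w + g ^ n * (\<Sum>t\<in>F \<union> U. c t * t)"] bexI[of _ "c g"] conjI)
    qed
    \<comment> \<open>Membership in \<open>idl F\<close> allows arbitrary coefficients; the Reynolds
      argument replaces them by invariant ones.\<close>
    have gk: "g ^ k \<in> ridl (F \<union> U)"
      using reynolds[OF assms(2,3,4) invs_power[OF g(1)] homogeneous_power[OF g(2)] g(3)] ridl_mono[OF Un_upper1 fin]
      by (rule subsetD[rotated])
    have "\<forall>d\<ge>D + k * e. \<forall>f\<in>invs. homogeneous d f \<longrightarrow> f \<in> ridl (F \<union> U)"
    proof (intro allI impI ballI)
      fix d f assume "D + k * e \<le> d" "f \<in> invs" "homogeneous d f"
      from iter[OF this] obtain w b where "w \<in> ridl (F \<union> U)" "b \<in> invs" "f = w + b * g ^ k" by (elim bexE conjE)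
      then show "f \<in> ridl (F \<union> U)" using ridl_mult[OF gk] ridl_add by simp
    qed
    then show ?thesis using insert.IH[of "D + k * e"] insert.prems(1) by simp
  qed
qed

text \<open>All invariants of degree at least \<open>D\<close> lie in the ideal of \<open>F\<close>
  with invariant coefficients. By recursion on the degree the invariants of degree below
  \<open>D\<close> then generate the module, and these form a finite-dimensional space. The explicit
  bound \<open>Suc d\<close> on the exponents is there for counting.\<close>

theorem invs_finite_module:
  assumes F: "finite F" "F \<subseteq> invs" "\<And>f. f \<in> F \<Longrightarrow> homogeneous e f" "e > 0"
    and Z: "\<And>\<sigma> g d. (\<And>f. f \<in> F \<Longrightarrow> eval \<sigma> f = 0) \<Longrightarrow> g \<in> invs \<Longrightarrow> homogeneous d g \<Longrightarrow> d > 0 \<Longrightarrow> eval \<sigma> g = 0"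
  shows "\<exists>G. finite G \<and> G \<subseteq> invs \<and> (\<forall>d. \<forall>f\<in>invs. homogeneous d f \<longrightarrow>
    f \<in> cspan ((\<lambda>(h, u). mpow (\<lambda>f. f) u * h) ` (G \<times> monom_box F (Suc d))))"
proof -
  define S where "S = {g\<in>invs. \<exists>d>0. homogeneous d g}"
  have "S \<subseteq> cpolys_in V" using invs_cpolys_in by (auto simp: S_def)
  from hilbert_basis[OF finite_V this] obtain T where T: "finite T" "T \<subseteq> S" "S \<subseteq> idl T" by blast
  have Tp: "\<forall>g\<in>T. g \<in> invs \<and> (\<exists>e. homogeneous e g) \<and> (\<exists>k. g ^ k \<in> idl F)"
  proof
    fix g assume "g \<in> T"
    obtain d where d: "g \<in> invs" "d > 0" "homogeneous d g" using T(2) \<open>g \<in> T\<close> by (auto simp: S_def)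
    have "\<exists>k. g ^ k \<in> idl F" by (rule nullstellensatz) (rule Z[OF _ d(1,3,2)])
    then show "g \<in> invs \<and> (\<exists>e. homogeneous e g) \<and> (\<exists>k. g ^ k \<in> idl F)" using d by blast
  qed
  have homF: "\<forall>f\<in>F. \<exists>e. homogeneous e f" using F(3) by blast
  have start: "\<forall>d\<ge>1. \<forall>f\<in>invs. homogeneous d f \<longrightarrow> f \<in> ridl (F \<union> T)"
  proof (intro allI impI ballI)
    fix d :: nat and f assume d: "1 \<le> d" "f \<in> invs" "homogeneous d f"
    then have "f \<in> S" by (auto simp: S_def intro!: exI[of _ d])
    then have "f \<in> idl T" using T(3) by blast
    then have "f \<in> ridl T" using T Tp d by (intro reynolds) blast+
    then show "f \<in> ridl (F \<union> T)" using ridl_mono[of T "F \<union> T"] F(1) T(1) by blast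
  qed
  obtain D where D: "\<forall>d\<ge>D. \<forall>f\<in>invs. homogeneous d f \<longrightarrow> f \<in> ridl F"
    using eliminate[OF T(1) F(1,2) homF Tp start] by blast
  have "\<exists>B. finite B \<and> B \<subseteq> invs \<and> (\<forall>f\<in>invs. homogeneous d f \<longrightarrow> f \<in> cspan B)" for d
  proof -
    define W where "W = {f \<in> invs. homogeneous d f}"
    have "\<exists>B. finite B \<and> B \<subseteq> W \<and> W \<subseteq> cspan B \<and> 0 \<notin> B \<and> (\<forall>a\<in>B. \<forall>b\<in>B. a \<noteq> b \<longrightarrow> fischer a b = 0)"
      by (rule finite_orthogonal_basis[OF finite_monoms[of d]])
        (auto simp: W_def dest: invs_cpolys_in keys_monoms[THEN subsetD, rotated 2])
    then show ?thesis by (auto simp: W_def)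
  qed
  then obtain B where B: "\<And>d. finite (B d) \<and> B d \<subseteq> invs \<and> (\<forall>f\<in>invs. homogeneous d f \<longrightarrow> f \<in> cspan (B d))"
    by metis
  define G where "G = (\<Union>d<D. B d)"
  define A where "A n = (\<lambda>(h, u). mpow (\<lambda>f. f) u * h) ` (G \<times> monom_box F (Suc n))" for n
  have A_mono: "A m \<subseteq> A n" if "m \<le> n" for m n
    using that by (fastforce simp: A_def monom_box_def)
  have "f \<in> cspan (A d)" if "f \<in> invs" "homogeneous d f" for d f
    using that
  proof (induction d arbitrary: f rule: less_induct)
    case (less d)
    show ?case
    proof (cases "d < D")
      case True
      have "B d \<subseteq> A d"
      proof
        fix b assume "b \<in> B d"
        then have "b \<in> G" using True by (auto simp: G_def)
        moreover have "0 \<in> monom_box F (Suc d)" by (simp add: monom_box_def)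
        ultimately show "b \<in> A d" unfolding A_def by (intro image_eqI[of _ _ "(b, 0)"]) simp_all
      qed
      moreover have "f \<in> cspan (B d)" using B[of d] less.prems by blast
      ultimately show ?thesis using cspan_mono[of "B d" "A d"] by (meson subsetD)
    next
      case False
      then have "D \<le> d" by simp
      then have "f \<in> ridl F" using D less.prems by blast
      from ridl_hcomp[OF this homF, of d] obtain b where
        b: "\<forall>t\<in>F. b t \<in> invs \<and> (\<forall>e. homogeneous e t \<longrightarrow> homogeneous (d - e) (b t) \<and> (d < e \<longrightarrow> b t * t = 0))"
          "hcomp d f = (\<Sum>t\<in>F. b t * t)" by (elim exE conjE)
      have "t * b t \<in> cspan (A d)" if t: "t \<in> F" for t
      proof (cases "d < e")
        case True
        then have "b t * t = 0" using b(1) F(3)[OF t] t by blast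
        then show ?thesis using cspan.cspan_0 by (simp add: mult.commute)
      next
        case False
        \<comment> \<open>Since \<open>e > 0\<close>, splitting off \<open>t\<close> lowers the
          degree, and exponents bounded by \<open>d - e\<close> stay bounded by \<open>d\<close>
          after one more factor \<open>t\<close>.\<close>
        then have de: "d - e < d" using F(4) by simp
        then have "b t \<in> cspan (A (d - e))" using b(1) F(3)[OF t] t by (intro less.IH) auto
        then show ?thesis
        proof (rule cspan_mult_map)
          fix a assume "a \<in> A (d - e)"
          then obtain h u where hu: "h \<in> G" "u \<in> monom_box F (Suc (d - e))" "a = mpow (\<lambda>f. f) u * h"
            by (auto simp: A_def)
          have "single t 1 + u \<in> monom_box F (Suc d)"
            using hu(2) t de by (fastforce simp: monom_box_def keys_plus_nat lookup_add lookup_single when_def)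
          moreover have "t * a = mpow (\<lambda>f. f) (single t 1 + u) * h"
            by (simp add: hu(3) mpow_add mult.assoc)
          ultimately show "t * a \<in> A d" unfolding A_def using hu(1) by (intro image_eqI[of _ _ "(h, single t 1 + u)"]) auto
        qed
      qed
      then have "(\<Sum>t\<in>F. t * b t) \<in> cspan (A d)" by (rule cspan_sum)
      moreover have "f = (\<Sum>t\<in>F. t * b t)" using b(2) less.prems(2) by (simp add: hcomp_homogeneous mult.commute)
      ultimately show ?thesis by simp
    qed
  qed
  moreover have "finite G" "G \<subseteq> invs" using B by (auto simp: G_def)
  ultimately show ?thesis unfolding A_def by (intro exI[of _ G]) blast
qed

end

section \<open>Spaces of singular three by three matrices\<close>

abbreviation mtranspose :: "'a^'n^'m \<Rightarrow> 'a^'m^'n" where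
  "mtranspose \<equiv> Finite_Cartesian_Product.transpose"

text \<open>The adjugate, written out over any commutative ring: the same formula serves for complex
  matrices, singular ones included, and for generic matrices.\<close>

definition adj3 :: "'a::comm_ring_1^3^3 \<Rightarrow> 'a^3^3" where
  "adj3 A = vector [
    vector [A$2$2 * A$3$3 - A$2$3 * A$3$2, A$1$3 * A$3$2 - A$1$2 * A$3$3, A$1$2 * A$2$3 - A$1$3 * A$2$2],
    vector [A$2$3 * A$3$1 - A$2$1 * A$3$3, A$1$1 * A$3$3 - A$1$3 * A$3$1, A$1$3 * A$2$1 - A$1$1 * A$2$3],
    vector [A$2$1 * A$3$2 - A$2$2 * A$3$1, A$1$2 * A$3$1 - A$1$1 * A$3$2, A$1$1 * A$2$2 - A$1$2 * A$2$1]]"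

definition mat3 :: "'a \<Rightarrow> 'a \<Rightarrow> 'a \<Rightarrow> 'a \<Rightarrow> 'a \<Rightarrow> 'a \<Rightarrow> 'a \<Rightarrow> 'a \<Rightarrow> 'a \<Rightarrow> 'a::zero^3^3" where
  "mat3 a b c d e f g h i = vector [vector [a, b, c], vector [d, e, f], vector [g, h, i]]"

definition cscale :: "'a::comm_ring_1 \<Rightarrow> 'a^3^3 \<Rightarrow> 'a^3^3" where
  "cscale c A = (\<chi> i j. c * A$i$j)"

lemma mat3_nth [simp]:
  "mat3 a b c d e f g h i $1$1 = a" "mat3 a b c d e f g h i $1$2 = b" "mat3 a b c d e f g h i $1$3 = c"
  "mat3 a b c d e f g h i $2$1 = d" "mat3 a b c d e f g h i $2$2 = e" "mat3 a b c d e f g h i $2$3 = f"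
  "mat3 a b c d e f g h i $3$1 = g" "mat3 a b c d e f g h i $3$2 = h" "mat3 a b c d e f g h i $3$3 = i"
  by (simp_all add: mat3_def)

lemma adj3_nth:
  "adj3 A $1$1 = A$2$2 * A$3$3 - A$2$3 * A$3$2" "adj3 A $1$2 = A$1$3 * A$3$2 - A$1$2 * A$3$3"
  "adj3 A $1$3 = A$1$2 * A$2$3 - A$1$3 * A$2$2" "adj3 A $2$1 = A$2$3 * A$3$1 - A$2$1 * A$3$3"
  "adj3 A $2$2 = A$1$1 * A$3$3 - A$1$3 * A$3$1" "adj3 A $2$3 = A$1$3 * A$2$1 - A$1$1 * A$2$3"
  "adj3 A $3$1 = A$2$1 * A$3$2 - A$2$2 * A$3$1" "adj3 A $3$2 = A$1$2 * A$3$1 - A$1$1 * A$3$2"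
  "adj3 A $3$3 = A$1$1 * A$2$2 - A$1$2 * A$2$1"
  by (simp_all add: adj3_def)

lemma mult3_nth: "(A ** B) $ i $ j = A$i$1 * B$1$j + A$i$2 * B$2$j + A$i$3 * (B :: 'a::comm_ring_1^3^3)$3$j"
  by (simp add: matrix_matrix_mult_def sum_3)

lemma mat3_eqI:
  assumes "A$1$1 = B$1$1" "A$1$2 = B$1$2" "A$1$3 = B$1$3" "A$2$1 = B$2$1" "A$2$2 = B$2$2" "A$2$3 = B$2$3"
    "A$3$1 = B$3$1" "A$3$2 = B$3$2" "A$3$3 = B$3$3"
  shows "A = (B :: 'a^3^3)"
  using assms by (simp add: vec_eq_iff forall_3)

lemma trace3: "trace (A :: 'a::comm_ring_1^3^3) = A$1$1 + A$2$2 + A$3$3"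
  by (simp add: trace_def sum_3)

lemma mat_nth3: "(mat c :: 'a::comm_ring_1^3^3) $ i $ j = (if i = j then c else 0)"
  by (simp add: mat_def)

lemma adj3_mult: "adj3 (A ** B) = adj3 B ** adj3 A"
  by (rule mat3_eqI) (simp_all only: adj3_nth mult3_nth, simp_all add: algebra_simps)

lemma adj3_left: "adj3 A ** A = mat (det A)"
  by (rule mat3_eqI) (simp_all add: adj3_nth mult3_nth mat_nth3 det_3 algebra_simps)

lemma adj3_right: "A ** adj3 A = mat (det A)"
  by (rule mat3_eqI) (simp_all add: adj3_nth mult3_nth mat_nth3 det_3 algebra_simps)

lemma mat_mult_left: "mat c ** A = cscale c A"
  by (rule mat3_eqI) (simp_all add: mult3_nth mat_nth3 cscale_def)

lemma mat_mult_right: "A ** mat c = cscale c A"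
  by (rule mat3_eqI) (simp_all add: mult3_nth mat_nth3 cscale_def mult.commute)

lemma cscale_mult: "cscale c A ** B = cscale c (A ** B)" "A ** cscale c B = cscale c (A ** B)"
  by (rule mat3_eqI; simp add: mult3_nth cscale_def algebra_simps)+

lemma cscale_1 [simp]: "cscale 1 A = A"
  by (rule mat3_eqI) (simp_all add: cscale_def)

lemma trace_cscale: "trace (cscale c A) = c * trace A"
  by (simp add: trace3 cscale_def distrib_left)

lemma cscale_cscale: "cscale c (cscale d A) = cscale (c * d) A"
  by (rule mat3_eqI) (simp_all add: cscale_def mult.assoc)

lemma det_cscale: "det (cscale c A) = c * c * c * det (A :: 'a::comm_ring_1^3^3)"
  by (simp add: det_3 cscale_def algebra_simps)

lemma conj_add:
  fixes P A B Q :: "'a::comm_ring_1^3^3"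
  shows "P ** (A + B) ** Q = P ** A ** Q + P ** B ** Q"
  by (rule mat3_eqI) (simp_all add: mult3_nth algebra_simps)

text \<open>Adjugation reverses products, so \<open>adj3 P\<close> meets \<open>P\<close> and leaves
  the scalar \<open>det P\<close>. What remains is, up to a scalar, a conjugation by
  \<open>Q\<close>: this is why \<open>adj3 A ** B\<close> is the building block of the trace
  invariants below.\<close>

lemma adj_conj_step:
  "adj3 (P ** A ** Q) ** (P ** B ** Q) = cscale (det P) (adj3 Q ** (adj3 A ** B) ** Q)"
proof -
  have "adj3 (P ** A ** Q) ** (P ** B ** Q) = adj3 Q ** adj3 A ** (adj3 P ** P) ** B ** Q"
    by (simp add: adj3_mult matrix_mul_assoc)
  also have "\<dots> = cscale (det P) (adj3 Q ** (adj3 A ** B) ** Q)"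
    by (simp add: adj3_left mat_mult_right cscale_mult matrix_mul_assoc)
  finally show ?thesis .
qed

lemma conj_mult: "(adj3 Q ** A ** Q) ** (adj3 Q ** B ** Q) = cscale (det Q) (adj3 Q ** (A ** B) ** Q)"
proof -
  have "(adj3 Q ** A ** Q) ** (adj3 Q ** B ** Q) = adj3 Q ** A ** (Q ** adj3 Q) ** B ** Q"
    by (simp add: matrix_mul_assoc)
  also have "\<dots> = cscale (det Q) (adj3 Q ** (A ** B) ** Q)"
    by (simp add: adj3_right mat_mult_right cscale_mult matrix_mul_assoc)
  finally show ?thesis .
qed

lemma trace_conj: "trace (adj3 Q ** A ** Q) = det Q * trace A"
proof -
  have "trace (adj3 Q ** A ** Q) = trace (Q ** (adj3 Q ** A))" by (rule trace_mul_sym)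
  also have "\<dots> = trace (cscale (det Q) A)" by (simp add: matrix_mul_assoc adj3_right mat_mult_left)
  finally show ?thesis by (simp add: trace_cscale)
qed

lemma trace_adj_product:
  "trace (adj3 (P ** A ** Q) ** (P ** B ** Q) ** adj3 (P ** C ** Q) ** (P ** D ** Q)) =
    (det P)\<^sup>2 * (det Q)\<^sup>2 * trace (adj3 A ** B ** adj3 C ** D)"
proof -
  have "adj3 (P ** A ** Q) ** (P ** B ** Q) ** adj3 (P ** C ** Q) ** (P ** D ** Q) =
      (adj3 (P ** A ** Q) ** (P ** B ** Q)) ** (adj3 (P ** C ** Q) ** (P ** D ** Q))"
    by (simp add: matrix_mul_assoc)
  also have "\<dots> = cscale (det P * (det P * det Q)) (adj3 Q ** (adj3 A ** B ** (adj3 C ** D)) ** Q)"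
    by (simp only: adj_conj_step cscale_mult conj_mult cscale_cscale)
  finally have e: "adj3 (P ** A ** Q) ** (P ** B ** Q) ** adj3 (P ** C ** Q) ** (P ** D ** Q) =
    cscale (det P * (det P * det Q)) (adj3 Q ** (adj3 A ** B ** (adj3 C ** D)) ** Q)" .
  show ?thesis unfolding e trace_cscale trace_conj by (simp add: power2_eq_square matrix_mul_assoc)
qed

text \<open>The matrix spaces with a shrunk subspace: after a change of bases, a zero row, a zero column, or a
  zero block of size two.\<close>

definition compressible :: "(complex^3^3) set \<Rightarrow> bool" where
  "compressible L \<longleftrightarrow> (\<exists>P Q. det P \<noteq> 0 \<and> det Q \<noteq> 0 \<and>
    ((\<forall>B\<in>L. \<forall>j. (P ** B ** Q)$3$j = 0) \<or> (\<forall>B\<in>L. \<forall>i. (P ** B ** Q)$i$3 = 0) \<or>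
     (\<forall>B\<in>L. \<forall>i\<in>{2,3}. \<forall>j\<in>{2,3}. (P ** B ** Q)$i$j = 0)))"

lemma compressible_transform:
  assumes "compressible ((\<lambda>B. P ** B ** Q) ` L)" "det P \<noteq> 0" "det Q \<noteq> 0"
  shows "compressible L"
proof -
  obtain P' Q' where PQ: "det P' \<noteq> 0" "det Q' \<noteq> 0"
    "(\<forall>B\<in>(\<lambda>B. P ** B ** Q) ` L. \<forall>j. (P' ** B ** Q')$3$j = 0) \<or>
     (\<forall>B\<in>(\<lambda>B. P ** B ** Q) ` L. \<forall>i. (P' ** B ** Q')$i$3 = 0) \<or>
     (\<forall>B\<in>(\<lambda>B. P ** B ** Q) ` L. \<forall>i\<in>{2,3}. \<forall>j\<in>{2,3}. (P' ** B ** Q')$i$j = 0)"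
    using assms(1) unfolding compressible_def by (elim exE conjE)
  have e: "P' ** (P ** B ** Q) ** Q' = (P' ** P) ** B ** (Q ** Q')" for B
    by (simp add: matrix_mul_assoc)
  show ?thesis unfolding compressible_def
    by (rule exI[of _ "P' ** P"], rule exI[of _ "Q ** Q'"]) (use PQ assms(2,3) in \<open>simp add: det_mul e\<close>)
qed

lemma compressible_transpose:
  assumes "compressible (mtranspose ` L)"
  shows "compressible L"
proof -
  obtain P Q where PQ: "det P \<noteq> 0" "det Q \<noteq> 0"
    "(\<forall>B\<in>L. \<forall>j. (P ** mtranspose B ** Q)$3$j = 0) \<or>
     (\<forall>B\<in>L. \<forall>i. (P ** mtranspose B ** Q)$i$3 = 0) \<or>
     (\<forall>B\<in>L. \<forall>i\<in>{2,3}. \<forall>j\<in>{2,3}. (P ** mtranspose B ** Q)$i$j = 0)"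
    using assms unfolding compressible_def by auto
  have e: "(mtranspose Q ** B ** mtranspose P) $ i $ j =
      (P ** mtranspose B ** Q) $ j $ i" for B i j
  proof -
    have "mtranspose Q ** B ** mtranspose P =
        mtranspose (P ** mtranspose B ** Q)"
      by (simp add: matrix_transpose_mul matrix_mul_assoc)
    then show ?thesis by (simp add: Finite_Cartesian_Product.transpose_def)
  qed
  show ?thesis unfolding compressible_def
    by (rule exI[of _ "mtranspose Q"], rule exI[of _ "mtranspose P"])
      (use PQ in \<open>auto simp: det_transpose e\<close>)
qed

section \<open>Linear spaces on which the invariants vanish\<close>

definition null_space3 :: "(complex^3^3) set \<Rightarrow> bool" where
  "null_space3 L \<longleftrightarrow> (\<forall>A\<in>L. \<forall>B\<in>L. A + B \<in> L) \<and> (\<forall>c. \<forall>A\<in>L. cscale c A \<in> L) \<and>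
    (\<forall>A\<in>L. det A = 0) \<and> (\<forall>A\<in>L. \<forall>B\<in>L. \<forall>C\<in>L. \<forall>D\<in>L. trace (adj3 A ** B ** adj3 C ** D) = 0)"

lemma null_space3_transform:
  assumes "null_space3 L"
  shows "null_space3 ((\<lambda>B. P ** B ** Q) ` L)"
proof -
  have "P ** A ** Q + P ** B ** Q = P ** (A + B) ** Q" for A B
    by (simp add: conj_add)
  moreover have "cscale c (P ** A ** Q) = P ** cscale c A ** Q" for c A by (simp add: cscale_mult)
  ultimately show ?thesis using assms
    unfolding null_space3_def by (auto simp: trace_adj_product det_mul)
qed

text \<open>Transposition reverses the word under the trace; a cyclic shift restores its shape with
  \<open>A\<close> and \<open>C\<close> exchanged, which is harmless since the condition is imposed
  on all quadruples.\<close>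

lemma null_space3_transpose:
  assumes "null_space3 L"
  shows "null_space3 (mtranspose ` L)"
proof -
  let ?t = "mtranspose :: complex^3^3 \<Rightarrow> _"
  have adj: "adj3 (?t A) = ?t (adj3 A)" for A
    by (rule mat3_eqI) (simp_all add: adj3_nth Finite_Cartesian_Product.transpose_def)
  have tr: "trace (adj3 (?t A) ** ?t B ** adj3 (?t C) ** ?t D) = trace (adj3 C ** B ** adj3 A ** D)" for A B C D
  proof -
    have "adj3 (?t A) ** ?t B ** adj3 (?t C) ** ?t D = ?t (D ** (adj3 C ** (B ** adj3 A)))"
      by (simp add: adj matrix_transpose_mul matrix_mul_assoc)
    then have "trace (adj3 (?t A) ** ?t B ** adj3 (?t C) ** ?t D) = trace (D ** (adj3 C ** (B ** adj3 A)))"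
      by (simp add: trace_def Finite_Cartesian_Product.transpose_def)
    also have "\<dots> = trace (adj3 C ** (B ** adj3 A) ** D)" by (rule trace_mul_sym)
    finally show ?thesis by (simp add: matrix_mul_assoc)
  qed
  have "?t A + ?t B = ?t (A + B)" "cscale c (?t A) = ?t (cscale c A)" for A B c
    by (simp_all add: vec_eq_iff Finite_Cartesian_Product.transpose_def cscale_def)
  then show ?thesis using assms unfolding null_space3_def
    by (auto simp: tr det_transpose)
qed

lemma pivot:
  assumes "(A :: complex^3^3) \<noteq> 0"
  shows "\<exists>P Q. det P \<noteq> 0 \<and> det Q \<noteq> 0 \<and> (P ** A ** Q)$1$1 = 1 \<and> (P ** A ** Q)$1$2 = 0 \<and> (P ** A ** Q)$1$3 = 0
    \<and> (P ** A ** Q)$2$1 = 0 \<and> (P ** A ** Q)$3$1 = 0"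
proof -
  \<comment> \<open>One permutation matrix serves for both sides: from the left it brings row
    \<open>i\<close> to the top, from the right column \<open>i\<close> to the front.\<close>
  have perm: "\<exists>S :: complex^3^3. det S \<noteq> 0 \<and> (\<forall>B :: complex^3^3. \<forall>j. (S ** B)$1$j = B$i$j) \<and>
    (\<forall>B :: complex^3^3. \<forall>j. (B ** S)$j$1 = B$j$i)" for i :: 3
  proof -
    consider "i = 1" | "i = 2" | "i = 3" using exhaust_3[of i] by blast
    then show ?thesis
    proof cases
      case 1
      then show ?thesis by (intro exI[of _ "mat3 1 0 0 0 1 0 0 0 1"]) (simp add: det_3 mult3_nth)
    next
      case 2
      then show ?thesis by (intro exI[of _ "mat3 0 1 0 1 0 0 0 0 1"]) (simp add: det_3 mult3_nth)
    next
      case 3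
      then show ?thesis by (intro exI[of _ "mat3 0 0 1 0 1 0 1 0 0"]) (simp add: det_3 mult3_nth)
    qed
  qed
  obtain i j where ij: "A$i$j \<noteq> 0" using assms by (auto simp: vec_eq_iff)
  obtain S :: "complex^3^3" where S: "det S \<noteq> 0" "\<And>(B :: complex^3^3) j. (S ** B)$1$j = B$i$j" using perm[of i] by blast
  obtain T :: "complex^3^3" where T: "det T \<noteq> 0" "\<And>(B :: complex^3^3) i. (B ** T)$i$1 = B$i$j" using perm[of j] by blast
  define B where "B = S ** A ** T"
  have a: "B$1$1 \<noteq> 0" using ij by (simp add: B_def S T)
  define P where "P = mat3 (1 / B$1$1) 0 0 (- B$2$1 / B$1$1) 1 0 (- B$3$1 / B$1$1) 0 1"
  define Q where "Q = mat3 1 (- B$1$2 / B$1$1) (- B$1$3 / B$1$1) 0 1 0 0 0 1"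
  have "det P \<noteq> 0" "det Q \<noteq> 0" using a by (simp_all add: P_def Q_def det_3)
  then have "det (P ** S) \<noteq> 0" "det (T ** Q) \<noteq> 0"
    using S(1) T(1) by (simp_all add: det_mul)
  moreover have "(P ** S) ** A ** (T ** Q) = P ** B ** Q"
    by (simp add: B_def matrix_mul_assoc)
  moreover have "(P ** B ** Q)$1$1 = 1 \<and> (P ** B ** Q)$1$2 = 0 \<and> (P ** B ** Q)$1$3 = 0
    \<and> (P ** B ** Q)$2$1 = 0 \<and> (P ** B ** Q)$3$1 = 0"
    using a by (simp add: mult3_nth P_def Q_def field_simps)
  ultimately show ?thesis
    by (intro exI[of _ "P ** S"] exI[of _ "T ** Q"]) simp
qed

text \<open>The matrix has rank two: its lower right block has determinant zero but is not zero.
  There is one case for each position of a nonzero entry of the block.\<close>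

lemma pivot2:
  assumes A: "(A :: complex^3^3)$1$1 = 1" "A$1$2 = 0" "A$1$3 = 0" "A$2$1 = 0" "A$3$1 = 0"
    and d: "det A = 0" and nz: "adj3 A \<noteq> 0"
  shows "\<exists>P Q. det P \<noteq> 0 \<and> det Q \<noteq> 0 \<and> P ** A ** Q = mat3 1 0 0 0 1 0 0 0 0"
proof -
  have d2: "A$2$2 * A$3$3 = A$2$3 * A$3$2" using d by (simp add: det_3 A)
  have "A$2$2 \<noteq> 0 \<or> A$2$3 \<noteq> 0 \<or> A$3$2 \<noteq> 0 \<or> A$3$3 \<noteq> 0"
  proof (rule ccontr)
    assume "\<not> ?thesis"
    then have "adj3 A = 0" by (intro mat3_eqI) (simp_all add: adj3_nth A)
    then show False using nz by simp
  qed
  moreover have ?thesis if a: "A$2$2 \<noteq> 0"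
  proof -
    have "mat3 1 0 0 0 (1 / A$2$2) 0 0 (- A$3$2 / A$2$2) 1 ** A ** mat3 1 0 0 0 1 (- A$2$3 / A$2$2) 0 0 1 = mat3 1 0 0 0 1 0 0 0 0"
      using a d2 by (intro mat3_eqI) (simp_all add: mult3_nth A field_simps)
    then show ?thesis using a
      by (intro exI[of _ "mat3 1 0 0 0 (1 / A$2$2) 0 0 (- A$3$2 / A$2$2) 1"] exI[of _ "mat3 1 0 0 0 1 (- A$2$3 / A$2$2) 0 0 1"])
        (simp add: det_3)
  qed
  moreover have ?thesis if a: "A$2$3 \<noteq> 0"
  proof -
    have "mat3 1 0 0 0 (1 / A$2$3) 0 0 (- A$3$3 / A$2$3) 1 ** A ** mat3 1 0 0 0 0 1 0 1 (- A$2$2 / A$2$3) = mat3 1 0 0 0 1 0 0 0 0"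
      using a d2 by (intro mat3_eqI) (simp_all add: mult3_nth A field_simps)
    then show ?thesis using a
      by (intro exI[of _ "mat3 1 0 0 0 (1 / A$2$3) 0 0 (- A$3$3 / A$2$3) 1"] exI[of _ "mat3 1 0 0 0 0 1 0 1 (- A$2$2 / A$2$3)"])
        (simp add: det_3)
  qed
  moreover have ?thesis if a: "A$3$2 \<noteq> 0"
  proof -
    have "mat3 1 0 0 0 0 (1 / A$3$2) 0 1 (- A$2$2 / A$3$2) ** A ** mat3 1 0 0 0 1 (- A$3$3 / A$3$2) 0 0 1 = mat3 1 0 0 0 1 0 0 0 0"
      using a d2 by (intro mat3_eqI) (simp_all add: mult3_nth A field_simps)
    then show ?thesis using a
      by (intro exI[of _ "mat3 1 0 0 0 0 (1 / A$3$2) 0 1 (- A$2$2 / A$3$2)"] exI[of _ "mat3 1 0 0 0 1 (- A$3$3 / A$3$2) 0 0 1"])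
        (simp add: det_3)
  qed
  moreover have ?thesis if a: "A$3$3 \<noteq> 0"
  proof -
    have "mat3 1 0 0 0 0 (1 / A$3$3) 0 1 (- A$2$3 / A$3$3) ** A ** mat3 1 0 0 0 0 1 0 1 (- A$3$2 / A$3$3) = mat3 1 0 0 0 1 0 0 0 0"
      using a d2 by (intro mat3_eqI) (simp_all add: mult3_nth A field_simps)
    then show ?thesis using a
      by (intro exI[of _ "mat3 1 0 0 0 0 (1 / A$3$3) 0 1 (- A$2$3 / A$3$3)"] exI[of _ "mat3 1 0 0 0 0 1 0 1 (- A$3$2 / A$3$3)"])
        (simp add: det_3)
  qed
  ultimately show ?thesis by blast
qed

text \<open>All two by two minors vanish on the space. With \<open>A\<close> in the form
  \<open>diag (1, 0, 0)\<close>, adding \<open>A\<close> to \<open>B\<close> changes the minors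
  through the corner (1,1) by entries of the lower right block of \<open>B\<close>, up to sign, so
  this block is zero.\<close>

lemma null_space3_rank_one:
  assumes L: "null_space3 L" and adj: "\<And>A. A \<in> L \<Longrightarrow> adj3 A = 0" and A: "A \<in> L" "A \<noteq> 0"
  shows "compressible L"
proof -
  obtain P Q where PQ: "det P \<noteq> 0" "det Q \<noteq> 0" "(P ** A ** Q)$1$1 = 1" "(P ** A ** Q)$1$2 = 0" "(P ** A ** Q)$1$3 = 0"
    "(P ** A ** Q)$2$1 = 0" "(P ** A ** Q)$3$1 = 0"
    using pivot[OF A(2)] by (elim exE conjE)
  define A' where "A' = P ** A ** Q"
  have adj': "adj3 (P ** B ** Q) = 0" if "B \<in> L" for B
    using adj[OF that] by (simp add: adj3_mult matrix_mul_assoc)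
  have A'e: "A'$2$2 = 0" "A'$2$3 = 0" "A'$3$2 = 0" "A'$3$3 = 0"
  proof -
    have z: "adj3 A' = 0" unfolding A'_def by (rule adj'[OF A(1)])
    have "adj3 A' $ 3 $ 3 = 0" "adj3 A' $ 2 $ 3 = 0" "adj3 A' $ 3 $ 2 = 0" "adj3 A' $ 2 $ 2 = 0" by (simp_all add: z)
    then show "A'$2$2 = 0" "A'$2$3 = 0" "A'$3$2 = 0" "A'$3$3 = 0"
      using PQ(3-7) by (simp_all add: adj3_nth A'_def)
  qed
  have block: "(P ** B ** Q)$i$j = 0" if B: "B \<in> L" and ij: "i \<in> {2,3}" "j \<in> {2,3}" for B i j
  proof -
    define B' where "B' = P ** B ** Q"
    have "P ** (A + B) ** Q = A' + B'"
      by (simp add: conj_add A'_def B'_def)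
    moreover have "A + B \<in> L" using L A(1) B by (simp add: null_space3_def)
    ultimately have z: "adj3 (A' + B') = 0" using adj'[of "A + B"] by simp
    have z': "adj3 B' = 0" unfolding B'_def by (rule adj'[OF B])
    have "adj3 (A' + B') $ a $ b - adj3 B' $ a $ b = 0" for a b by (simp add: z z')
    note this[of 2 2] this[of 2 3] this[of 3 2] this[of 3 3]
    then show ?thesis using ij PQ(3-7) A'e
      by (auto simp: adj3_nth B'_def[symmetric] A'_def[symmetric] algebra_simps)
  qed
  show ?thesis unfolding compressible_def
    by (rule exI[of _ P], rule exI[of _ Q], intro conjI disjI2 ballI PQ(1,2) block)
qed

text \<open>With \<open>E = diag (1, 1, 0)\<close>, the determinant of \<open>t E + B\<close> is at
  most quadratic in \<open>t\<close> and vanishes identically, which gives the first two claims. The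
  adjugate of \<open>E\<close> has a single nonzero entry, in the corner (3,3), so the trace reduces
  to the third row of \<open>B\<close>, \<open>adj3 C\<close> and the third column of
  \<open>D\<close>, and factors.\<close>

lemma null_space3_diag_facts:
  assumes L: "null_space3 L" and E: "mat3 1 0 0 0 1 0 0 0 0 \<in> L" and B: "B \<in> L"
  shows "B$3$3 = 0" "B$1$3 * B$3$1 + B$2$3 * B$3$2 = 0"
    "C \<in> L \<Longrightarrow> D \<in> L \<Longrightarrow> (C$1$3 * D$2$3 - C$2$3 * D$1$3) * (C$3$1 * B$3$2 - C$3$2 * B$3$1) = 0"
proof -
  have det0: "det B' = 0" if "B' \<in> L" for B' using L that by (simp add: null_space3_def)
  have zero33: "B'$3$3 = 0 \<and> B'$1$3 * B'$3$1 + B'$2$3 * B'$3$2 = 0" if B': "B' \<in> L" for B'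
  proof -
    have "cscale t (mat3 1 0 0 0 1 0 0 0 0) + B' \<in> L" for t using L E B' by (simp add: null_space3_def)
    then have *: "det (cscale t (mat3 1 0 0 0 1 0 0 0 0) + B') = 0" for t by (rule det0)
    define s where "s = B'$1$1 * B'$3$3 - B'$1$3 * B'$3$1 + B'$2$2 * B'$3$3 - B'$2$3 * B'$3$2"
    have e: "det (cscale t (mat3 1 0 0 0 1 0 0 0 0) + B') = t * t * B'$3$3 + t * s + det B'" for t
      by (simp add: det_3 cscale_def s_def algebra_simps)
    \<comment> \<open>The constant term \<open>det B'\<close> is zero; the values at 1 and -1 then
      separate the other two coefficients.\<close>
    have "B'$3$3 + s = 0" "B'$3$3 - s = 0" using *[of 1] *[of "-1"] det0[OF B'] unfolding e by simp_all
    then have "B'$3$3 = 0" "s = 0" by (simp_all add: algebra_simps eq_neg_iff_add_eq_0[symmetric])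
    have "B'$1$3 * B'$3$1 + B'$2$3 * B'$3$2 = - s" using \<open>B'$3$3 = 0\<close> by (simp add: s_def)
    then show ?thesis using \<open>B'$3$3 = 0\<close> \<open>s = 0\<close> by simp
  qed
  then show "B$3$3 = 0" "B$1$3 * B$3$1 + B$2$3 * B$3$2 = 0" using B by blast+
  assume C: "C \<in> L" and D: "D \<in> L"
  have "trace (adj3 (mat3 1 0 0 0 1 0 0 0 0) ** B ** adj3 C ** D) = 0"
    using L E B C D by (simp add: null_space3_def)
  moreover have "trace (adj3 (mat3 1 0 0 0 1 0 0 0 0) ** B ** adj3 C ** D) =
      - ((C$1$3 * D$2$3 - C$2$3 * D$1$3) * (C$3$1 * B$3$2 - C$3$2 * B$3$1))"
    using zero33[OF B] zero33[OF C] zero33[OF D]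
    by (simp add: trace3 mult3_nth adj3_nth algebra_simps)
  ultimately show "(C$1$3 * D$2$3 - C$2$3 * D$1$3) * (C$3$1 * B$3$2 - C$3$2 * B$3$1) = 0" by simp
qed

lemma exists_generic_scalar: "\<exists>t::complex. t \<noteq> 0 \<and> 1 + t * a \<noteq> 0 \<and> 1 + t * b \<noteq> 0"
proof -
  have fin: "finite {t. 1 + t * a = (0::complex)}" for a
  proof (rule finite_subset[of _ "{- 1 / a}"])
    show "{t. 1 + t * a = 0} \<subseteq> {- 1 / a}"
    proof
      fix t assume "t \<in> {t. 1 + t * a = 0}"
      then have e: "t * a = - 1" by (simp add: add_eq_0_iff)
      then have "a \<noteq> 0" by auto
      then show "t \<in> {- 1 / a}" using e nonzero_eq_divide_eq[of a t "- 1"] by blast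
    qed
  qed simp
  have "finite ({0} \<union> {t. 1 + t * a = 0} \<union> {t. 1 + t * b = 0})" using fin by simp
  from ex_new_if_finite[OF infinite_UNIV_char_0 this]
  obtain t where "t \<notin> {0} \<union> {t. 1 + t * a = 0} \<union> {t. 1 + t * b = 0}" by (elim exE)
  then show ?thesis by blast
qed

lemma parallel_pair:
  assumes "x * b2 = y * b1" "b1 \<noteq> 0 \<or> b2 \<noteq> (0::complex)"
  shows "\<exists>\<beta>. x = \<beta> * b1 \<and> y = \<beta> * b2"
proof (cases "b1 = 0")
  case True
  then show ?thesis using assms by (intro exI[of _ "y / b2"]) auto
next
  case False
  then show ?thesis using assms(1) by (intro exI[of _ "x / b1"]) (simp add: field_simps)
qed

text \<open>Consider the first two entries of the third column and of the third row. If neither pair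
  vanishes throughout, some \<open>G\<close> has both nonzero, say \<open>b\<close> and
  \<open>c\<close>. Comparing \<open>G\<close> with \<open>G + t B\<close> for generic
  \<open>t\<close> shows that every row pair is orthogonal to \<open>b\<close>, hence parallel to
  \<open>c\<close>, and that the upper left block pairs to zero with \<open>c\<close> and
  \<open>b\<close>. These are the entries of a zero block of size two in bases containing
  \<open>c\<close> and \<open>b\<close>.\<close>

lemma null_space3_diag_parallel:
  assumes L: "null_space3 L" and E: "mat3 1 0 0 0 1 0 0 0 0 \<in> L"
    and par: "\<And>C D. C \<in> L \<Longrightarrow> D \<in> L \<Longrightarrow> C$1$3 * D$2$3 = C$2$3 * D$1$3"
  shows "compressible L"
proof -
  note facts = null_space3_diag_facts[OF L E]
  have add: "A + B \<in> L" if "A \<in> L" "B \<in> L" for A B using L that by (simp add: null_space3_def)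
  have scale: "cscale c A \<in> L" if "A \<in> L" for c A using L that by (simp add: null_space3_def)
  have det0: "det A = 0" if "A \<in> L" for A using L that by (simp add: null_space3_def)
  have one: "det (mat3 1 0 0 0 1 0 0 0 (1::complex)) \<noteq> 0" by (simp add: det_3)
  have id: "mat3 1 0 0 0 1 0 0 0 1 ** B ** mat3 1 0 0 0 1 0 0 0 1 = B" for B :: "complex^3^3"
    by (rule mat3_eqI) (simp_all add: mult3_nth)
  show ?thesis
  proof (cases "(\<forall>B\<in>L. B$1$3 = 0 \<and> B$2$3 = 0) \<or> (\<forall>B\<in>L. B$3$1 = 0 \<and> B$3$2 = 0)")
    case True
    then have "(\<forall>B\<in>L. \<forall>i. B$i$3 = 0) \<or> (\<forall>B\<in>L. \<forall>j. B$3$j = 0)"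
      using facts(1) by (auto simp: forall_3)
    then show ?thesis unfolding compressible_def
      by (intro exI[of _ "mat3 1 0 0 0 1 0 0 0 1"]) (use one in \<open>auto simp: id\<close>)
  next
    case False
    then obtain E1 F1 where EF: "E1 \<in> L" "E1$1$3 \<noteq> 0 \<or> E1$2$3 \<noteq> 0" "F1 \<in> L" "F1$3$1 \<noteq> 0 \<or> F1$3$2 \<noteq> 0" by blast
    have "\<exists>G\<in>L. (G$1$3 \<noteq> 0 \<or> G$2$3 \<noteq> 0) \<and> (G$3$1 \<noteq> 0 \<or> G$3$2 \<noteq> 0)"
    proof (cases "(E1$3$1 \<noteq> 0 \<or> E1$3$2 \<noteq> 0) \<or> (F1$1$3 \<noteq> 0 \<or> F1$2$3 \<noteq> 0)")
      case True
      then show ?thesis using EF by blast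
    next
      case False
      then have "((E1 + F1)$1$3 \<noteq> 0 \<or> (E1 + F1)$2$3 \<noteq> 0) \<and> ((E1 + F1)$3$1 \<noteq> 0 \<or> (E1 + F1)$3$2 \<noteq> 0)"
        using EF by simp
      then show ?thesis using add[OF EF(1,3)] by blast
    qed
    then obtain G where G: "G \<in> L" "G$1$3 \<noteq> 0 \<or> G$2$3 \<noteq> 0" "G$3$1 \<noteq> 0 \<or> G$3$2 \<noteq> 0" by blast
    define b1 b2 c1 c2 where bc: "b1 = G$1$3" "b2 = G$2$3" "c1 = G$3$1" "c2 = G$3$2"
    have G0: "b1 * c1 + b2 * c2 = 0" using facts(2)[OF G(1)] by (simp add: bc)
    have beta: "\<exists>\<beta>. B$1$3 = \<beta> * b1 \<and> B$2$3 = \<beta> * b2" if B: "B \<in> L" for B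
      using par[OF B G(1)] G(2) by (intro parallel_pair) (simp_all add: bc)
    have ortho: "b1 * B$3$1 + b2 * B$3$2 = 0" if B: "B \<in> L" for B
    proof -
      obtain \<beta> where \<beta>: "B$1$3 = \<beta> * b1" "B$2$3 = \<beta> * b2" using beta[OF B] by blast
      obtain t where t: "t \<noteq> 0" "1 + t * \<beta> \<noteq> 0" using exists_generic_scalar[of \<beta> \<beta>] by blast
      have "G + cscale t B \<in> L" using add G(1) scale B by blast
      from facts(2)[OF this]
      have "(b1 + t * (\<beta> * b1)) * (c1 + t * B$3$1) + (b2 + t * (\<beta> * b2)) * (c2 + t * B$3$2) = 0"
        by (simp add: cscale_def \<beta> bc)
      moreover have "(b1 + t * (\<beta> * b1)) * (c1 + t * B$3$1) + (b2 + t * (\<beta> * b2)) * (c2 + t * B$3$2) =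
          (1 + t * \<beta>) * (b1 * c1 + b2 * c2) + (1 + t * \<beta>) * (t * (b1 * B$3$1 + b2 * B$3$2))"
        by (simp add: algebra_simps)
      ultimately show ?thesis using t G0 by simp
    qed
    have gamma: "\<exists>\<gamma>. B$3$1 = \<gamma> * c1 \<and> B$3$2 = \<gamma> * c2" if B: "B \<in> L" for B
    proof (rule parallel_pair)
      show "c1 \<noteq> 0 \<or> c2 \<noteq> 0" using G(3) by (simp add: bc)
      have o: "b1 * B$3$1 = - (b2 * B$3$2)" "b1 * c1 = - (b2 * c2)"
        using ortho[OF B] G0 by (simp_all add: eq_neg_iff_add_eq_0)
      show "B$3$1 * c2 = B$3$2 * c1"
      proof (cases "b1 = 0")
        case True
        then have "b2 \<noteq> 0" using G(2) by (simp add: bc)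
        then show ?thesis using o True by simp
      next
        case False
        have "b1 * (B$3$1 * c2) = b1 * (B$3$2 * c1)"
          using o by (metis mult.assoc mult.commute minus_mult_left)
        then show ?thesis using False by simp
      qed
    qed
    have quad: "c1 * (B$1$1 * b1 + B$1$2 * b2) + c2 * (B$2$1 * b1 + B$2$2 * b2) = 0" if B: "B \<in> L" for B
    proof -
      \<comment> \<open>For the upper left block \<open>M\<close> the expansion involves
        \<open>adj M = tr M - M\<close>; the trace term carries the factor
        \<open>b1 * c1 + b2 * c2\<close>, which is zero.\<close>
      have ev: "det A = \<gamma> * \<beta> * (c1 * (A$1$1 * b1 + A$1$2 * b2) + c2 * (A$2$1 * b1 + A$2$2 * b2))"
        if "A$1$3 = \<beta> * b1" "A$2$3 = \<beta> * b2" "A$3$1 = \<gamma> * c1" "A$3$2 = \<gamma> * c2" "A$3$3 = 0" for A :: "complex^3^3" and \<beta> \<gamma>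
      proof -
        have "det A - \<gamma> * \<beta> * (c1 * (A$1$1 * b1 + A$1$2 * b2) + c2 * (A$2$1 * b1 + A$2$2 * b2)) =
          - \<gamma> * \<beta> * (A$1$1 + A$2$2) * (b1 * c1 + b2 * c2)"
          by (simp add: det_3 that algebra_simps)
        then show ?thesis using G0 by simp
      qed
      obtain \<beta> where \<beta>: "B$1$3 = \<beta> * b1" "B$2$3 = \<beta> * b2" using beta[OF B] by blast
      obtain \<gamma> where \<gamma>: "B$3$1 = \<gamma> * c1" "B$3$2 = \<gamma> * c2" using gamma[OF B] by blast
      obtain t where t: "t \<noteq> 0" "1 + t * \<beta> \<noteq> 0" "1 + t * \<gamma> \<noteq> 0" using exists_generic_scalar[of \<beta> \<gamma>] by blast
      have G1: "c1 * (G$1$1 * b1 + G$1$2 * b2) + c2 * (G$2$1 * b1 + G$2$2 * b2) = 0"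
        using ev[of G 1 1] det0[OF G(1)] facts(1)[OF G(1)] by (simp add: bc)
      let ?A = "G + cscale t B"
      have A: "?A \<in> L" using add G(1) scale B by blast
      have "det ?A = (1 + t * \<gamma>) * (1 + t * \<beta>) * (c1 * (?A$1$1 * b1 + ?A$1$2 * b2) + c2 * (?A$2$1 * b1 + ?A$2$2 * b2))"
        by (rule ev) (use facts(1)[OF A] in \<open>simp_all add: cscale_def \<beta> \<gamma> bc[symmetric] algebra_simps\<close>)
      then have "c1 * (?A$1$1 * b1 + ?A$1$2 * b2) + c2 * (?A$2$1 * b1 + ?A$2$2 * b2) = 0"
        using det0[OF A] t by simp
      moreover have "c1 * (?A$1$1 * b1 + ?A$1$2 * b2) + c2 * (?A$2$1 * b1 + ?A$2$2 * b2) =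
         (c1 * (G$1$1 * b1 + G$1$2 * b2) + c2 * (G$2$1 * b1 + G$2$2 * b2)) +
         t * (c1 * (B$1$1 * b1 + B$1$2 * b2) + c2 * (B$2$1 * b1 + B$2$2 * b2))"
        by (simp add: cscale_def algebra_simps)
      ultimately show ?thesis using t(1) G1 by simp
    qed
    \<comment> \<open>The second row of \<open>P\<close> is \<open>c\<close> and the second column
      of \<open>Q\<close> is \<open>b\<close>; the conjugated entries complete them to matrices
      whose determinants are squared norms, hence nonzero.\<close>
    define P where "P = mat3 (cnj c2) (- cnj c1) 0 c1 c2 0 0 0 1"
    define Q where "Q = mat3 (cnj b2) b1 0 (- cnj b1) b2 0 0 0 1"
    have nrm: "x * cnj x + y * cnj y \<noteq> 0" if "x \<noteq> 0 \<or> y \<noteq> 0" for x y :: complex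
    proof -
      have "x * cnj x + y * cnj y = of_real ((cmod x)\<^sup>2 + (cmod y)\<^sup>2)"
        by (simp add: complex_norm_square del: of_real_power)
      moreover have "(cmod x)\<^sup>2 + (cmod y)\<^sup>2 \<noteq> 0" using that by (simp add: sum_power2_eq_zero_iff)
      ultimately show ?thesis by (metis of_real_eq_0_iff)
    qed
    have dPQ: "det P \<noteq> 0" "det Q \<noteq> 0" using nrm[of c1 c2] nrm[of b1 b2] G(2,3)
      by (simp_all add: P_def Q_def det_3 bc algebra_simps)
    have block: "(P ** B ** Q)$i$j = 0" if B: "B \<in> L" and ij: "i \<in> {2,3}" "j \<in> {2,3}" for B i j
    proof -
      obtain \<beta> where \<beta>: "B$1$3 = \<beta> * b1" "B$2$3 = \<beta> * b2" using beta[OF B] by blast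
      have "(P ** B ** Q)$2$2 = c1 * (B$1$1 * b1 + B$1$2 * b2) + c2 * (B$2$1 * b1 + B$2$2 * b2)"
        by (simp add: mult3_nth P_def Q_def algebra_simps)
      moreover have "(P ** B ** Q)$2$3 = \<beta> * (b1 * c1 + b2 * c2)"
        by (simp add: mult3_nth P_def Q_def \<beta> algebra_simps)
      moreover have "(P ** B ** Q)$3$2 = b1 * B$3$1 + b2 * B$3$2"
        by (simp add: mult3_nth P_def Q_def algebra_simps)
      moreover have "(P ** B ** Q)$3$3 = 0"
        by (simp add: mult3_nth P_def Q_def facts(1)[OF B])
      ultimately show ?thesis using ij quad[OF B] ortho[OF B] G0 by auto
    qed
    show ?thesis unfolding compressible_def
      by (rule exI[of _ P], rule exI[of _ Q], intro conjI disjI2 ballI dPQ block)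
  qed
qed

text \<open>The last of the facts reads \<open>bp C D * cp C B = 0\<close>. If \<open>bp C D\<close>
  and \<open>cp E1 F\<close> were both nonzero, the element \<open>C + E1\<close> would violate it,
  so one of the two forms vanishes identically. Transposition exchanges them.\<close>

lemma null_space3_diag:
  assumes L: "null_space3 L" and E: "mat3 1 0 0 0 1 0 0 0 0 \<in> L"
  shows "compressible L"
proof -
  note facts = null_space3_diag_facts[OF L E]
  have add: "A + B \<in> L" if "A \<in> L" "B \<in> L" for A B using L that by (simp add: null_space3_def)
  define bp where "bp C D = C$1$3 * D$2$3 - C$2$3 * D$1$3" for C D :: "complex^3^3"
  define cp where "cp C D = C$3$1 * D$3$2 - C$3$2 * D$3$1" for C D :: "complex^3^3"
  have bc: "bp C D * cp C B = 0" if "B \<in> L" "C \<in> L" "D \<in> L" for B C D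
    using facts(3)[OF that] by (simp add: bp_def cp_def)
  have "(\<forall>C\<in>L. \<forall>D\<in>L. bp C D = 0) \<or> (\<forall>C\<in>L. \<forall>D\<in>L. cp C D = 0)"
  proof (rule ccontr)
    assume "\<not> ?thesis"
    then obtain C D E1 F where CD: "C \<in> L" "D \<in> L" "bp C D \<noteq> 0" and EF: "E1 \<in> L" "F \<in> L" "cp E1 F \<noteq> 0" by blast
    have cC: "cp C B = 0" if "B \<in> L" for B using bc[OF that CD(1,2)] CD(3) by simp
    have "bp E1 D = 0" using bc[OF EF(2,1) CD(2)] EF(3) by simp
    then have "bp (C + E1) D \<noteq> 0" using CD(3) by (simp add: bp_def algebra_simps)
    then have "cp (C + E1) F = 0" using bc[OF EF(2) add[OF CD(1) EF(1)] CD(2)] by simp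
    moreover have "cp (C + E1) F = cp C F + cp E1 F" by (simp add: cp_def algebra_simps)
    ultimately show False using cC[OF EF(2)] EF(3) by simp
  qed
  then show ?thesis
  proof
    assume "\<forall>C\<in>L. \<forall>D\<in>L. bp C D = 0"
    then show ?thesis by (intro null_space3_diag_parallel[OF L E]) (simp add: bp_def)
  next
    assume cp: "\<forall>C\<in>L. \<forall>D\<in>L. cp C D = 0"
    have "mtranspose (mat3 1 0 0 0 1 0 0 0 0) = (mat3 1 0 0 0 1 0 0 0 0 :: complex^3^3)"
      by (rule mat3_eqI) (simp_all add: Finite_Cartesian_Product.transpose_def)
    then have "mat3 1 0 0 0 1 0 0 0 0 \<in> mtranspose ` L" using E by (metis image_eqI)
    then have "compressible (mtranspose ` L)"
      using cp by (intro null_space3_diag_parallel[OF null_space3_transpose[OF L]])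
        (auto simp: cp_def Finite_Cartesian_Product.transpose_def)
    then show ?thesis by (rule compressible_transpose)
  qed
qed

text \<open>All members are singular, so either all have rank at most one, where the adjugate
  vanishes, or one has rank two and can be moved to \<open>diag (1, 1, 0)\<close>.\<close>

theorem null_space3_compressible:
  assumes L: "null_space3 L"
  shows "compressible L"
proof (cases "\<forall>A\<in>L. adj3 A = 0")
  case adj0: True
  show ?thesis
  proof (cases "\<forall>A\<in>L. A = 0")
    case True
    have "(mat3 1 0 0 0 1 0 0 0 1 ** A ** mat3 1 0 0 0 1 0 0 0 (1::complex))$3$j = 0" if "A \<in> L" for A j
    proof -
      have "A = 0" using True that by blast
      then show ?thesis by (simp add: mult3_nth)
    qed
    then show ?thesis unfolding compressible_def
      by (intro exI[of _ "mat3 1 0 0 0 1 0 0 0 1"]) (simp add: det_3)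
  next
    case False
    then obtain A where "A \<in> L" "A \<noteq> 0" by blast
    from null_space3_rank_one[OF L bspec[OF adj0] this] show ?thesis .
  qed
next
  case False
  then obtain A where A: "A \<in> L" "adj3 A \<noteq> 0" by blast
  have A0: "A \<noteq> 0"
  proof
    assume "A = 0"
    then have "adj3 A = 0" by (intro mat3_eqI) (simp_all add: adj3_nth)
    then show False using A(2) by simp
  qed
  obtain P Q where PQ: "det P \<noteq> 0" "det Q \<noteq> 0" "(P ** A ** Q)$1$1 = 1" "(P ** A ** Q)$1$2 = 0" "(P ** A ** Q)$1$3 = 0"
    "(P ** A ** Q)$2$1 = 0" "(P ** A ** Q)$3$1 = 0"
    using pivot[OF A0] by (elim exE conjE)
  have nz: "adj3 (P ** A ** Q) \<noteq> 0"
  proof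
    assume "adj3 (P ** A ** Q) = 0"
    then have "Q ** adj3 (P ** A ** Q) ** P = 0" by (simp add: matrix_matrix_mult_def vec_eq_iff)
    moreover have "Q ** adj3 (P ** A ** Q) ** P = (Q ** adj3 Q) ** adj3 A ** (adj3 P ** P)"
      by (simp add: adj3_mult matrix_mul_assoc)
    ultimately have "cscale (det P) (cscale (det Q) (adj3 A)) = 0"
      by (simp add: adj3_left adj3_right mat_mult_left mat_mult_right)
    then have "adj3 A = 0" using PQ(1,2) by (simp add: cscale_def vec_eq_iff)
    then show False using A(2) by simp
  qed
  have "det A = 0" using L A(1) by (simp add: null_space3_def)
  then have d: "det (P ** A ** Q) = 0" by (simp add: det_mul)
  obtain P' Q' where PQ': "det P' \<noteq> 0" "det Q' \<noteq> 0" "P' ** (P ** A ** Q) ** Q' = mat3 1 0 0 0 1 0 0 0 0"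
    using pivot2[OF PQ(3-7) d nz] by (elim exE conjE)
  let ?L = "(\<lambda>B. (P' ** P) ** B ** (Q ** Q')) ` L"
  have "(P' ** P) ** A ** (Q ** Q') = mat3 1 0 0 0 1 0 0 0 0" using PQ'(3) by (simp add: matrix_mul_assoc)
  then have "mat3 1 0 0 0 1 0 0 0 0 \<in> ?L" using A(1) by (metis image_eqI)
  then have "compressible ?L" by (intro null_space3_diag null_space3_transform L)
  then show ?thesis by (rule compressible_transform) (use PQ PQ' in \<open>simp_all add: det_mul\<close>)
qed

section \<open>The null cone in degree six\<close>

lemma isCont_eval:
  assumes "\<And>x. isCont (\<lambda>t :: complex. \<sigma> t x) a"
  shows "isCont (\<lambda>t. eval (\<sigma> t) p) a"
proof (induction p rule: cpoly_induct)
  case (const c)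
  then show ?case by (simp add: eval_simps)
next
  case (add p q)
  then show ?case by (simp add: eval_simps)
next
  case (var x p)
  then show ?case using assms by (simp add: eval_simps)
qed

text \<open>Genericity assumptions are removed by perturbing the point along a curve.\<close>

lemma eval_perturb:
  assumes "\<And>x. isCont (\<lambda>t :: complex. \<sigma> t x) 0" "\<forall>\<^sub>F t in at 0. eval (\<sigma> t) p = c"
  shows "eval (\<sigma> 0) p = c"
proof -
  have "((\<lambda>t. eval (\<sigma> t) p) \<longlongrightarrow> eval (\<sigma> 0) p) (at 0)"
    using isCont_eval[OF assms(1)] by (simp add: isCont_def)
  moreover have "((\<lambda>t. eval (\<sigma> t) p) \<longlongrightarrow> c) (at 0)"
    by (rule tendsto_eventually[OF assms(2)])
  ultimately show ?thesis by (rule tendsto_unique[rotated]) simp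
qed

lemma poly_eventually_nonzero:
  assumes "(p :: complex poly) \<noteq> 0"
  shows "\<forall>\<^sub>F t in at 0. poly p t \<noteq> 0"
proof -
  have "finite {t. poly p t = 0}" by (rule poly_roots_finite[OF assms])
  then have "\<not> 0 islimpt {t. poly p t = 0}" by (simp add: islimpt_finite)
  then show ?thesis by (simp add: islimpt_iff_eventually)
qed

section \<open>Matrix tuples as points, and the group as a family of substitutions\<close>

type_synonym entry = "nat \<times> 3 \<times> 3"

definition pt :: "(nat \<Rightarrow> complex^3^3) \<Rightarrow> entry \<Rightarrow> complex" where
  "pt X = (\<lambda>(k, i, j). X k $ i $ j)"

definition unpt :: "(entry \<Rightarrow> complex) \<Rightarrow> nat \<Rightarrow> complex^3^3" where
  "unpt \<sigma> k = (\<chi> i j. \<sigma> (k, i, j))"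

lemma pt_unpt [simp]: "pt (unpt \<sigma>) = \<sigma>"
  by (auto simp: pt_def unpt_def)

lemma eval_matrices_pt: "eval_matrices p X = eval (pt X) p"
  by (simp add: eval_matrices_def eval_def pt_def)

definition entries :: "nat \<Rightarrow> entry set" where
  "entries m = {(k, i, j). k < m}"

text \<open>Serves as \<open>N\<close>: the group mixes only entries of one matrix, so these sets
  are finite although the variables are not confined to finitely many matrices.\<close>

definition same_matrix :: "entry \<Rightarrow> entry set" where
  "same_matrix x = {y. fst y = fst x}"

lemma same_matrix_Times: "same_matrix x = {fst x} \<times> UNIV"
  by (auto simp: same_matrix_def)

text \<open>Coefficients of the substitution that moves \<open>X k\<close> to
  \<open>P ** X k ** Q\<close>. The index \<open>k'\<close> does not appear on the right because
  sums run over \<open>same_matrix\<close> only; having \<open>Q\<close> in place of an inverse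
  makes the conjugate transpose visibly of the same shape.\<close>

definition two_sided :: "complex^3^3 \<Rightarrow> complex^3^3 \<Rightarrow> entry \<Rightarrow> entry \<Rightarrow> complex" where
  "two_sided P Q = (\<lambda>(k, i, j) (k', a, b). P$i$a * Q$b$j)"

definition sl_family :: "(entry \<Rightarrow> entry \<Rightarrow> complex) set" where
  "sl_family = {two_sided P Q | P Q. det P = 1 \<and> det Q = 1}"

lemma det_adjoint: "det (\<chi> i j. cnj (P$j$i)) = cnj (det (P :: complex^3^3))"
  by (simp add: det_3 algebra_simps)

lemma selfadjoint: "selfadjoint_family same_matrix (entries m) sl_family"
proof
  fix x y :: entry and L :: "entry \<Rightarrow> entry \<Rightarrow> complex"
  show "finite (same_matrix x)" by (simp add: same_matrix_Times)
  show "y \<in> same_matrix x \<longleftrightarrow> x \<in> same_matrix y" by (auto simp: same_matrix_def)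
  show "x \<in> entries m \<Longrightarrow> same_matrix x \<subseteq> entries m" by (auto simp: same_matrix_def entries_def)
  have "entries m = {..<m} \<times> UNIV" by (auto simp: entries_def)
  then show "finite (entries m)" by simp
  assume "L \<in> sl_family"
  then obtain P Q where PQ: "L = two_sided P Q" "det P = 1" "det Q = 1" by (auto simp: sl_family_def)
  have "(\<lambda>x y. cnj (L y x)) = two_sided (\<chi> i j. cnj (P$j$i)) (\<chi> i j. cnj (Q$j$i))"
    by (auto simp: PQ(1) two_sided_def fun_eq_iff)
  then show "(\<lambda>x y. cnj (L y x)) \<in> sl_family"
    unfolding sl_family_def using PQ(2,3) det_adjoint[of P] det_adjoint[of Q] by auto
qed

lemma eval_two_sided:
  "eval (pt X) (sbst (lin_sub same_matrix (two_sided P Q)) p) = eval (pt (\<lambda>k. P ** X k ** Q)) p"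
proof -
  have "eval (pt X) (lin_sub same_matrix (two_sided P Q) x) = pt (\<lambda>k. P ** X k ** Q) x" for x
  proof -
    obtain k i j where x: "x = (k, i, j)" by (cases x)
    have "eval (pt X) (lin_sub same_matrix (two_sided P Q) x) =
        (\<Sum>(k', a, b)\<in>{k} \<times> UNIV. P$i$a * Q$b$j * X k' $ a $ b)"
      by (simp add: x lin_sub_def eval_simps same_matrix_Times two_sided_def pt_def case_prod_beta)
    also have "\<dots> = (\<Sum>k'\<in>{k}. \<Sum>a\<in>UNIV. \<Sum>b\<in>UNIV. P$i$a * Q$b$j * X k' $ a $ b)"
      by (simp add: sum.cartesian_product[symmetric] UNIV_Times_UNIV[symmetric] del: UNIV_Times_UNIV)
    also have "\<dots> = pt (\<lambda>k. P ** X k ** Q) x"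
      by (simp add: x pt_def sum_3 mult3_nth algebra_simps)
    finally show ?thesis .
  qed
  then show ?thesis by (simp add: eval_sbst)
qed

text \<open>The inverse runs through all of \<open>SL\<close> together with the matrix, so right
  multiplication by \<open>Q\<close> may replace that by \<open>matrix_inv B\<close>.\<close>

lemma semi_invariant_iff:
  "p \<in> matrix_semi_invariants m \<longleftrightarrow> p \<in> cpolys_in (entries m) \<and>
    (\<forall>P Q X. det P = 1 \<longrightarrow> det Q = 1 \<longrightarrow> eval (pt (\<lambda>k. P ** X k ** Q)) p = eval (pt X) p)"
proof -
  have inv: "matrix_inv B ** B = mat 1 \<and> B ** matrix_inv B = mat 1" if "det B = 1" for B :: "complex^3^3"
  proof -
    have "invertible B" using that by (simp add: invertible_det_nz)
    then have "\<exists>B'. B ** B' = mat 1 \<and> B' ** B = mat 1" by (simp add: invertible_def)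
    from someI_ex[OF this] show ?thesis unfolding matrix_inv_def by blast
  qed
  have dinv: "det (matrix_inv B) = 1" if "det B = 1" for B :: "complex^3^3"
  proof -
    have "det (matrix_inv B ** B) = 1" using inv[OF that] by simp
    then show ?thesis using that by (simp add: det_mul)
  qed
  have inv2: "matrix_inv (matrix_inv Q) = Q" if "det Q = 1" for Q :: "complex^3^3"
  proof -
    have "matrix_inv (matrix_inv Q) = matrix_inv (matrix_inv Q) ** (matrix_inv Q ** Q)" using inv[OF that] by simp
    also have "\<dots> = Q" using inv[OF dinv[OF that]] by (simp add: matrix_mul_assoc)
    finally show ?thesis .
  qed
  show ?thesis
  proof (intro iffI conjI allI impI)
    assume p: "p \<in> matrix_semi_invariants m"
    then show "p \<in> cpolys_in (entries m)" by (simp add: matrix_semi_invariants_def cpolys_in_def entries_def)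
    fix P Q :: "complex^3^3" and X assume PQ: "det P = 1" "det Q = 1"
    have "\<forall>A\<in>SL. \<forall>B\<in>SL. \<forall>X. eval_matrices p (left_right_action A B X) = eval_matrices p X"
      using p unfolding matrix_semi_invariants_def by (elim CollectE conjE)
    then have "eval_matrices p (left_right_action P (matrix_inv Q) X) = eval_matrices p X"
      using PQ(1) dinv[OF PQ(2)] by (simp add: SL_def)
    then show "eval (pt (\<lambda>k. P ** X k ** Q)) p = eval (pt X) p"
      by (simp add: left_right_action_def eval_matrices_pt inv2[OF PQ(2)])
  next
    assume "p \<in> cpolys_in (entries m) \<and>
      (\<forall>P Q X. det P = 1 \<longrightarrow> det Q = 1 \<longrightarrow> eval (pt (\<lambda>k. P ** X k ** Q)) p = eval (pt X) p)"
    then show "p \<in> matrix_semi_invariants m"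
      using dinv unfolding matrix_semi_invariants_def SL_def left_right_action_def eval_matrices_pt
      by (auto simp: cpolys_in_def entries_def)
  qed
qed

text \<open>A polynomial is determined by its values, so invariance of the values is the same as
  being fixed by the substitutions.\<close>

lemma invs_eq: "selfadjoint_family.invs same_matrix (entries m) sl_family = matrix_semi_invariants m"
proof (rule set_eqI)
  fix p :: "entry cpoly"
  interpret selfadjoint_family same_matrix "entries m" sl_family by (rule selfadjoint)
  show "p \<in> invs \<longleftrightarrow> p \<in> matrix_semi_invariants m"
  proof
    assume "p \<in> invs"
    then have p: "p \<in> cpolys_in (entries m)" "\<And>L. L \<in> sl_family \<Longrightarrow> sbst (lin_sub same_matrix L) p = p" by (auto simp: invs_def)
    show "p \<in> matrix_semi_invariants m"
      unfolding semi_invariant_iff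
    proof (intro conjI allI impI p(1))
      fix P Q :: "complex^3^3" and X assume "det P = 1" "det Q = 1"
      then have "two_sided P Q \<in> sl_family" by (auto simp: sl_family_def)
      from p(2)[OF this] show "eval (pt (\<lambda>k. P ** X k ** Q)) p = eval (pt X) p"
        using eval_two_sided[of X P Q p] by simp
    qed
  next
    assume p: "p \<in> matrix_semi_invariants m"
    show "p \<in> invs" unfolding invs_def
    proof (intro CollectI conjI ballI)
      show "p \<in> cpolys_in (entries m)" using p by (simp add: semi_invariant_iff)
      fix L assume "L \<in> sl_family"
      then obtain P Q where PQ: "L = two_sided P Q" "det P = 1" "det Q = 1" by (auto simp: sl_family_def)
      show "sbst (lin_sub same_matrix L) p = p"
      proof (rule cpoly_eqI_eval)
        fix \<sigma> :: "entry \<Rightarrow> complex"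
        have "eval (pt (unpt \<sigma>)) (sbst (lin_sub same_matrix (two_sided P Q)) p) = eval (pt (unpt \<sigma>)) p"
          unfolding eval_two_sided using p PQ(2,3) by (simp add: semi_invariant_iff del: pt_unpt)
        then show "eval \<sigma> (sbst (lin_sub same_matrix L) p) = eval \<sigma> p" by (simp add: PQ(1))
      qed
    qed
  qed
qed

lemma semi_invariant_cong:
  assumes "p \<in> matrix_semi_invariants m" "\<And>k. k < m \<Longrightarrow> X k = Y k"
  shows "eval (pt X) p = eval (pt Y) p"
proof (rule eval_cong)
  fix x assume "x \<in> poly_vars p"
  then have "x \<in> entries m" using assms(1) by (auto simp: semi_invariant_iff cpolys_in_def)
  then show "pt X x = pt Y x" using assms(2) by (auto simp: pt_def entries_def)
qed

section \<open>Changes of bases and one-parameter subgroups\<close>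

lemma cube_root_exists: "\<exists>c :: complex. c ^ 3 = z"
proof (cases "z = 0")
  case False
  then have "exp (ln z / 3) ^ 3 = z" by (simp add: exp_of_nat_mult[symmetric])
  then show ?thesis by blast
qed (intro exI[of _ 0], simp)

lemma factor_sl:
  assumes "det P \<noteq> 0"
  shows "\<exists>c P'. c \<noteq> 0 \<and> det P' = 1 \<and> P = cscale c (P' :: complex^3^3)"
proof -
  obtain c where c: "c ^ 3 = det P" using cube_root_exists by blast
  then have "c \<noteq> 0" using assms by auto
  moreover have "det (cscale (1 / c) P) = 1" using c assms \<open>c \<noteq> 0\<close>
    by (simp add: det_cscale power3_eq_cube[symmetric])
  ultimately show ?thesis
    by (intro exI[of _ c] exI[of _ "cscale (1 / c) P"]) (simp add: cscale_cscale)
qed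

lemma eval_pt_cscale:
  assumes "homogeneous d p"
  shows "eval (pt (\<lambda>k. cscale c (X k))) p = c ^ d * eval (pt X) p"
proof -
  have "pt (\<lambda>k. cscale c (X k)) = (\<lambda>x. c * pt X x)" by (auto simp: pt_def cscale_def)
  then show ?thesis using eval_homogeneous[OF assms] by simp
qed

text \<open>An invertible complex matrix is a scalar times one of determinant one, and a scalar only
  multiplies the value of a homogeneous polynomial by a nonzero factor. Vanishing may thus be tested
  after any change of bases.\<close>

lemma semi_invariant_gl:
  assumes p: "p \<in> matrix_semi_invariants m" "homogeneous d p" and PQ: "det P \<noteq> 0" "det Q \<noteq> 0"
    and z: "eval (pt (\<lambda>k. P ** X k ** Q)) p = 0"
  shows "eval (pt X) p = 0"
proof -
  obtain c P' where P: "c \<noteq> 0" "det P' = 1" "P = cscale c P'" using factor_sl[OF PQ(1)] by (elim exE conjE)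
  obtain e Q' where Q: "e \<noteq> 0" "det Q' = 1" "Q = cscale e Q'" using factor_sl[OF PQ(2)] by (elim exE conjE)
  have "P ** X k ** Q = cscale (e * c) (P' ** X k ** Q')" for k
    by (simp add: P(3) Q(3) cscale_mult cscale_cscale)
  then have "(e * c) ^ d * eval (pt (\<lambda>k. P' ** X k ** Q')) p = 0"
    using z eval_pt_cscale[OF p(2), of "e * c" "\<lambda>k. P' ** X k ** Q'"] by simp
  then have "eval (pt (\<lambda>k. P' ** X k ** Q')) p = 0" using P(1) Q(1) by simp
  then show ?thesis using p(1) P(2) Q(2) by (simp add: semi_invariant_iff)
qed

text \<open>The value is constant along the orbit for \<open>t \<noteq> 0\<close>, and by continuity
  it equals the value at the limit 0, where homogeneous polynomials of positive degree vanish. The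
  curve \<open>Y\<close> is given separately because \<open>D\<close> and \<open>E\<close> may have
  poles at 0.\<close>

lemma semi_invariant_curve:
  assumes p: "p \<in> matrix_semi_invariants m" "homogeneous d p" "d > 0"
    and DE: "\<And>t. t \<noteq> 0 \<Longrightarrow> det (D t) = 1" "\<And>t. t \<noteq> 0 \<Longrightarrow> det (E t) = 1"
    and Y: "\<And>t k. t \<noteq> 0 \<Longrightarrow> k < m \<Longrightarrow> D t ** X k ** E t = Y t k"
    and Y0: "\<And>k. Y 0 k = 0" and cont: "\<And>k i j. isCont (\<lambda>t::complex. Y t k $ i $ j) 0"
  shows "eval (pt X) p = 0"
proof -
  have "eval (pt (Y t)) p = eval (pt X) p" if t: "t \<noteq> 0" for t
  proof -
    have "eval (pt (Y t)) p = eval (pt (\<lambda>k. D t ** X k ** E t)) p"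
      by (rule semi_invariant_cong[OF p(1)]) (simp add: Y[OF t])
    then show ?thesis using p(1) DE[OF t] by (simp add: semi_invariant_iff)
  qed
  then have "\<forall>\<^sub>F t in at 0. eval (pt (Y t)) p = eval (pt X) p"
    by (simp add: eventually_at_filter)
  then have "eval (pt (Y 0)) p = eval (pt X) p"
    by (rule eval_perturb[rotated]) (use cont in \<open>auto simp: pt_def\<close>)
  moreover have "pt (Y 0) = (\<lambda>x. 0)" by (auto simp: pt_def Y0)
  moreover have "eval (\<lambda>x. 0) p = 0" using eval_homogeneous[OF p(2), of 0 "\<lambda>_. 0"] zero_power[OF p(3), where ?'a = complex] by simp
  ultimately show ?thesis by simp
qed

lemma compressible_null:
  assumes p: "p \<in> matrix_semi_invariants m" "homogeneous d p" "d > 0"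
    and L: "compressible L" "\<And>k. k < m \<Longrightarrow> X k \<in> L"
  shows "eval (pt X) p = 0"
proof -
  obtain P Q where PQ: "det P \<noteq> 0" "det Q \<noteq> 0"
    "(\<forall>B\<in>L. \<forall>j. (P ** B ** Q)$3$j = 0) \<or> (\<forall>B\<in>L. \<forall>i. (P ** B ** Q)$i$3 = 0) \<or>
     (\<forall>B\<in>L. \<forall>i\<in>{2,3}. \<forall>j\<in>{2,3}. (P ** B ** Q)$i$j = 0)"
    using L(1) unfolding compressible_def by (elim exE conjE)
  define Z where "Z k = P ** X k ** Q" for k
  have "eval (pt Z) p = 0" using PQ(3)
  proof (elim disjE)
    assume a: "\<forall>B\<in>L. \<forall>j. (P ** B ** Q)$3$j = 0"
    have z: "Z k $ 3 $ j = 0" if "k < m" for k j using a L(2)[OF that] by (simp add: Z_def)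
    show ?thesis
    \<comment> \<open>The factor \<open>1 / (t * t)\<close> meets only the zero row, so the whole
      tuple is multiplied by \<open>t\<close>.\<close>
    proof (rule semi_invariant_curve[OF p, where D = "\<lambda>t. mat3 t 0 0 0 t 0 0 0 (1 / (t * t))"
          and E = "\<lambda>_. mat3 1 0 0 0 1 0 0 0 1" and Y = "\<lambda>t k. cscale t (Z k)"])
      show "mat3 t 0 0 0 t 0 0 0 (1 / (t * t)) ** Z k ** mat3 1 0 0 0 1 0 0 0 1 = cscale t (Z k)" if "k < m" for t k
        by (rule mat3_eqI) (simp_all add: mult3_nth cscale_def z[OF that])
    qed (auto simp: det_3 cscale_def vec_eq_iff)
  next
    assume a: "\<forall>B\<in>L. \<forall>i. (P ** B ** Q)$i$3 = 0"
    have z: "Z k $ j $ 3 = 0" if "k < m" for k j using a L(2)[OF that] by (simp add: Z_def)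
    show ?thesis
    proof (rule semi_invariant_curve[OF p, where E = "\<lambda>t. mat3 t 0 0 0 t 0 0 0 (1 / (t * t))"
          and D = "\<lambda>_. mat3 1 0 0 0 1 0 0 0 1" and Y = "\<lambda>t k. cscale t (Z k)"])
      show "mat3 1 0 0 0 1 0 0 0 1 ** Z k ** mat3 t 0 0 0 t 0 0 0 (1 / (t * t)) = cscale t (Z k)" if "k < m" for t k
        by (rule mat3_eqI) (simp_all add: mult3_nth cscale_def z[OF that])
    qed (auto simp: det_3 cscale_def vec_eq_iff)
  next
    assume a: "\<forall>B\<in>L. \<forall>i\<in>{2,3}. \<forall>j\<in>{2,3}. (P ** B ** Q)$i$j = 0"
    have z: "Z k $ 2 $ 2 = 0" "Z k $ 2 $ 3 = 0" "Z k $ 3 $ 2 = 0" "Z k $ 3 $ 3 = 0" if "k < m" for k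
      using a L(2)[OF that] by (simp_all add: Z_def)
    show ?thesis
    \<comment> \<open>The entry (1,1) gets weight 4 and the rest of the first row and column weight
      1; the only negative weight, -2, falls on the zero block.\<close>
    proof (rule semi_invariant_curve[OF p, where D = "\<lambda>t. mat3 (t * t) 0 0 0 (1 / t) 0 0 0 (1 / t)"
          and E = "\<lambda>t. mat3 (t * t) 0 0 0 (1 / t) 0 0 0 (1 / t)"
          and Y = "\<lambda>t k. mat3 (t * t * t * t * Z k $ 1 $ 1) (t * Z k $ 1 $ 2) (t * Z k $ 1 $ 3)
            (t * Z k $ 2 $ 1) 0 0 (t * Z k $ 3 $ 1) 0 0"])
      show "mat3 (t * t) 0 0 0 (1 / t) 0 0 0 (1 / t) ** Z k ** mat3 (t * t) 0 0 0 (1 / t) 0 0 0 (1 / t) =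
          mat3 (t * t * t * t * Z k $ 1 $ 1) (t * Z k $ 1 $ 2) (t * Z k $ 1 $ 3)
            (t * Z k $ 2 $ 1) 0 0 (t * Z k $ 3 $ 1) 0 0" if "t \<noteq> 0" "k < m" for t k
        using \<open>t \<noteq> 0\<close> by (intro mat3_eqI) (simp_all add: mult3_nth z[OF \<open>k < m\<close>])
      show "isCont (\<lambda>t. mat3 (t * t * t * t * Z k $ 1 $ 1) (t * Z k $ 1 $ 2) (t * Z k $ 1 $ 3)
            (t * Z k $ 2 $ 1) 0 0 (t * Z k $ 3 $ 1) 0 0 $ i $ j) 0" for k i j
        using exhaust_3[of i] exhaust_3[of j] by auto
      show "mat3 (0 * 0 * 0 * 0 * Z k $ 1 $ 1) (0 * Z k $ 1 $ 2) (0 * Z k $ 1 $ 3)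
            (0 * Z k $ 2 $ 1) 0 0 (0 * Z k $ 3 $ 1) 0 0 = 0" for k
        by (rule mat3_eqI) simp_all
    qed (simp_all add: det_3)
  qed
  then have "eval (pt (\<lambda>k. P ** X k ** Q)) p = 0" unfolding Z_def .
  then show ?thesis by (rule semi_invariant_gl[OF p(1,2) PQ(1,2)])
qed

section \<open>Generic matrices and the invariants of degree six\<close>

definition gmat :: "nat \<Rightarrow> entry cpoly^3^3" where
  "gmat k = (\<chi> i j. var (k, i, j))"

text \<open>A general element of the span, as a polynomial in the entries. The coefficients
  \<open>x\<close> remain parameters, so that the vanishing of the invariants becomes a condition on
  the whole span and not only on the single matrices.\<close>

definition gcomb :: "nat \<Rightarrow> (nat \<Rightarrow> complex) \<Rightarrow> entry cpoly^3^3" where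
  "gcomb m x = (\<chi> i j. \<Sum>k<m. const_poly (x k) * var (k, i, j))"

definition evm :: "(entry \<Rightarrow> complex) \<Rightarrow> entry cpoly^3^3 \<Rightarrow> complex^3^3" where
  "evm \<sigma> M = (\<chi> i j. eval \<sigma> (M$i$j))"

lemma evm_nth: "evm \<sigma> M $ i $ j = eval \<sigma> (M$i$j)"
  by (simp add: evm_def)

lemma evm_mult: "evm \<sigma> (A ** B) = evm \<sigma> A ** evm \<sigma> B"
  by (simp add: vec_eq_iff evm_nth mult3_nth eval_simps)
lemma evm_adj3: "evm \<sigma> (adj3 A) = adj3 (evm \<sigma> A)"
  by (rule mat3_eqI) (simp_all add: evm_nth adj3_nth eval_simps)
lemma eval_trace: "eval \<sigma> (trace A) = trace (evm \<sigma> A)"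
  by (simp add: trace3 evm_nth eval_simps)
lemma eval_det3: "eval \<sigma> (det A) = det (evm \<sigma> A)"
  by (simp add: det_3 evm_nth eval_simps)
lemma evm_gmat: "evm (pt X) (gmat k) = X k"
  by (simp add: vec_eq_iff evm_nth gmat_def eval_simps pt_def)
lemma evm_mat: "evm \<sigma> (mat 1) = mat 1"
  by (simp add: vec_eq_iff evm_nth mat_nth3 eval_simps)

definition lcomb :: "nat \<Rightarrow> (nat \<Rightarrow> complex) \<Rightarrow> (nat \<Rightarrow> complex^3^3) \<Rightarrow> complex^3^3" where
  "lcomb m x X = (\<Sum>k<m. cscale (x k) (X k))"

lemma lcomb_nth: "lcomb m x X $ i $ j = (\<Sum>k<m. x k * X k $ i $ j)"
  by (simp add: lcomb_def cscale_def sum_component)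

lemma evm_gcomb: "evm (pt X) (gcomb m x) = lcomb m x X"
  by (simp add: vec_eq_iff evm_nth gcomb_def eval_simps lcomb_nth pt_def)

lemma lcomb_transform: "lcomb m x (\<lambda>k. P ** X k ** Q) = P ** lcomb m x X ** Q"
  by (rule mat3_eqI)
    (simp_all add: lcomb_nth mult3_nth sum_distrib_left sum_distrib_right sum.distrib[symmetric] algebra_simps)

definition hom_mat :: "nat \<Rightarrow> entry cpoly^3^3 \<Rightarrow> bool" where
  "hom_mat d M \<longleftrightarrow> (\<forall>i j. homogeneous d (M$i$j))"

definition mat_in :: "entry set \<Rightarrow> entry cpoly^3^3 \<Rightarrow> bool" where
  "mat_in V M \<longleftrightarrow> (\<forall>i j. M$i$j \<in> cpolys_in V)"

lemma hom_mat_mult: "hom_mat d A \<Longrightarrow> hom_mat e B \<Longrightarrow> hom_mat (d + e) (A ** B)"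
  unfolding hom_mat_def mult3_nth by (intro allI homogeneous_add homogeneous_mult) auto
lemma hom_mat_adj3: "hom_mat d A \<Longrightarrow> hom_mat (d + d) (adj3 A)"
  unfolding hom_mat_def forall_3 adj3_nth by (intro conjI homogeneous_diff homogeneous_mult) auto
lemma homogeneous_trace: "hom_mat d A \<Longrightarrow> homogeneous d (trace A)"
  unfolding hom_mat_def trace3 by (intro homogeneous_add) auto
lemma homogeneous_det: "hom_mat d A \<Longrightarrow> homogeneous (d + d + d) (det A)"
  unfolding hom_mat_def det_3 by (intro homogeneous_add homogeneous_diff homogeneous_mult) auto
lemma hom_mat_gcomb: "hom_mat 1 (gcomb m x)"
  unfolding hom_mat_def gcomb_def by (auto intro!: homogeneous_sum homogeneous_const_mult homogeneous_var[simplified])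
lemma mat_in_mult: "mat_in V A \<Longrightarrow> mat_in V B \<Longrightarrow> mat_in V (A ** B)"
  unfolding mat_in_def mult3_nth by (intro allI cpolys_in_add cpolys_in_mult) auto
lemma mat_in_adj3: "mat_in V A \<Longrightarrow> mat_in V (adj3 A)"
  unfolding mat_in_def forall_3 adj3_nth by (intro conjI cpolys_in_diff cpolys_in_mult) auto
lemma mat_in_trace: "mat_in V A \<Longrightarrow> trace A \<in> cpolys_in V"
  unfolding mat_in_def trace3 by (intro cpolys_in_add) auto
lemma mat_in_det: "mat_in V A \<Longrightarrow> det A \<in> cpolys_in V"
  unfolding mat_in_def det_3 by (intro cpolys_in_add cpolys_in_diff cpolys_in_mult) auto
lemma mat_in_gcomb: "mat_in (entries m) (gcomb m x)"
  unfolding mat_in_def gcomb_def by (auto intro!: cpolys_in_sum cpolys_in_mult cpolys_in_var simp: entries_def)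
lemma mat_in_gmat: "k < m \<Longrightarrow> mat_in (entries m) (gmat k)"
  unfolding mat_in_def gmat_def by (auto intro!: cpolys_in_var simp: entries_def)
lemma mat_in_1: "mat_in V (mat 1)"
  unfolding mat_in_def mat_nth3 by auto

definition inv6 :: "nat \<Rightarrow> (nat \<Rightarrow> complex) \<Rightarrow> (nat \<Rightarrow> complex) \<Rightarrow> (nat \<Rightarrow> complex) \<Rightarrow> (nat \<Rightarrow> complex) \<Rightarrow> entry cpoly" where
  "inv6 m x y z w = trace (adj3 (gcomb m x) ** gcomb m y ** adj3 (gcomb m z) ** gcomb m w)"

definition semi6 :: "nat \<Rightarrow> entry cpoly set" where
  "semi6 m = {p \<in> matrix_semi_invariants m. homogeneous 6 p}"

lemma inv6_in: "inv6 m x y z w \<in> semi6 m"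
proof -
  have "homogeneous (((1 + 1) + 1 + (1 + 1)) + 1) (inv6 m x y z w)"
    unfolding inv6_def by (intro homogeneous_trace hom_mat_mult hom_mat_adj3 hom_mat_gcomb)
  then have "homogeneous 6 (inv6 m x y z w)" by (simp add: numeral_eq_Suc)
  moreover have "inv6 m x y z w \<in> cpolys_in (entries m)"
    unfolding inv6_def by (intro mat_in_trace mat_in_mult mat_in_adj3 mat_in_gcomb)
  ultimately show ?thesis
    by (simp add: semi6_def semi_invariant_iff inv6_def eval_trace evm_mult evm_adj3 evm_gcomb lcomb_transform
        trace_adj_product)
qed

lemma det_square_in: "(det (gcomb m x)) ^ 2 \<in> semi6 m"
proof -
  have "homogeneous ((1 + 1 + 1) * 2) ((det (gcomb m x)) ^ 2)"
    by (intro homogeneous_power homogeneous_det hom_mat_gcomb)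
  then have "homogeneous 6 ((det (gcomb m x)) ^ 2)" by (simp add: numeral_eq_Suc)
  moreover have "(det (gcomb m x)) ^ 2 \<in> cpolys_in (entries m)"
    by (intro cpolys_in_power mat_in_det mat_in_gcomb)
  ultimately show ?thesis
    by (simp add: semi6_def semi_invariant_iff eval_simps eval_det3 evm_gcomb lcomb_transform det_mul)
qed

theorem nullcone_degree6:
  assumes z: "\<And>f. f \<in> semi6 m \<Longrightarrow> eval \<sigma> f = 0"
    and g: "g \<in> matrix_semi_invariants m" "homogeneous d g" "d > 0"
  shows "eval \<sigma> g = 0"
proof -
  define X where "X = unpt \<sigma>"
  have \<sigma>: "\<sigma> = pt X" by (simp add: X_def)
  define L where "L = range (\<lambda>x. lcomb m x X)"
  have "null_space3 L" unfolding null_space3_def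
  proof (intro conjI ballI allI)
    fix A B C D assume "A \<in> L"
    then obtain x where A: "A = lcomb m x X" by (auto simp: L_def)
    have "cscale c A = lcomb m (\<lambda>k. c * x k) X" for c
      by (simp add: A vec_eq_iff lcomb_nth cscale_def sum_distrib_left mult.assoc)
    then show "cscale c A \<in> L" for c by (auto simp: L_def)
    have "eval \<sigma> ((det (gcomb m x)) ^ 2) = 0" by (rule z[OF det_square_in])
    then show "det A = 0" by (simp add: \<sigma> eval_simps eval_det3 evm_gcomb A)
    assume "B \<in> L"
    then obtain y where B: "B = lcomb m y X" by (auto simp: L_def)
    have "A + B = lcomb m (\<lambda>k. x k + y k) X"
      by (simp add: A B vec_eq_iff lcomb_nth distrib_right sum.distrib)
    then show "A + B \<in> L" by (auto simp: L_def)
    assume "C \<in> L"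
    then obtain v where C: "C = lcomb m v X" by (auto simp: L_def)
    assume "D \<in> L"
    then obtain w where D: "D = lcomb m w X" by (auto simp: L_def)
    have "eval \<sigma> (inv6 m x y v w) = 0" by (rule z[OF inv6_in])
    then show "trace (adj3 A ** B ** adj3 C ** D) = 0"
      by (simp add: \<sigma> inv6_def eval_trace evm_mult evm_adj3 evm_gcomb A B C D)
  qed
  then have "compressible L" by (rule null_space3_compressible)
  moreover have "X k \<in> L" if "k < m" for k
  proof -
    have "X k = lcomb m (\<lambda>l. if l = k then 1 else 0) X"
      using that by (simp add: vec_eq_iff lcomb_nth if_distrib[of "\<lambda>x. x * _"] cong: if_cong)
    then show ?thesis by (auto simp: L_def)
  qed
  ultimately show ?thesis unfolding \<sigma> using compressible_null[OF g] by blast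
qed

section \<open>Minimal systems with the same zeros\<close>

lemma semi_hcomp:
  fixes p :: "entry cpoly"
  shows "p \<in> matrix_semi_invariants m \<Longrightarrow> hcomp d p \<in> matrix_semi_invariants m"
  by (rule selfadjoint_family.invs_hcomp[OF selfadjoint, unfolded invs_eq])

lemma semi6_lin:
  "f \<in> semi6 m \<Longrightarrow> g \<in> semi6 m \<Longrightarrow> f + g \<in> semi6 m" "f \<in> semi6 m \<Longrightarrow> const_poly c * f \<in> semi6 m"
  "f \<in> semi6 m \<Longrightarrow> g \<in> semi6 m \<Longrightarrow> f - g \<in> semi6 m"
  unfolding semi6_def by (auto simp: semi_invariant_iff eval_simps intro!: cpolys_in_mult)

text \<open>The space \<open>semi6 m\<close> is finite-dimensional, and a finite spanning set has
  the same zeros as the whole space.\<close>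

lemma finite_null_system:
  "\<exists>F. finite F \<and> F \<subseteq> semi6 m \<and> (\<forall>\<sigma>. (\<forall>f\<in>F. eval \<sigma> f = 0) \<longrightarrow> (\<forall>f\<in>semi6 m. eval \<sigma> f = 0))"
proof -
  interpret selfadjoint_family same_matrix "entries m" sl_family by (rule selfadjoint)
  have "\<exists>B. finite B \<and> B \<subseteq> semi6 m \<and> semi6 m \<subseteq> cspan B \<and> 0 \<notin> B \<and> (\<forall>a\<in>B. \<forall>b\<in>B. a \<noteq> b \<longrightarrow> fischer a b = 0)"
  proof (rule finite_orthogonal_basis[OF finite_monoms[of 6]])
    show "keys w \<subseteq> monoms 6" if "w \<in> semi6 m" for w
      using that by (intro keys_monoms) (auto simp: semi6_def semi_invariant_iff)
  qed (rule semi6_lin; assumption)+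
  then obtain B where B: "finite B" "B \<subseteq> semi6 m" "semi6 m \<subseteq> cspan B" by (elim exE conjE)
  have "eval \<sigma> f = 0" if "\<forall>b\<in>B. eval \<sigma> b = 0" "f \<in> cspan B" for \<sigma> f
    using that(2) by induction (auto simp: eval_simps that(1))
  then show ?thesis using B by (intro exI[of _ B]) blast
qed

text \<open>Noether normalization by minimality. For a nonzero homogeneous relation
  \<open>Q\<close>, choose a point \<open>c\<close> where \<open>Q\<close> does not vanish, scaled
  to have coordinate 1 at some \<open>f0\<close>. Subtract from every other \<open>f\<close> the
  multiple of \<open>f0\<close> by its coordinate, and drop \<open>f0\<close>. At a common zero of
  the new system the values of \<open>F\<close> are the value of \<open>f0\<close> times
  \<open>c\<close>, and homogeneity of \<open>Q\<close> forces \<open>f0\<close> to vanish, so no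
  zeros are added.\<close>

theorem independent_null_system:
  "\<exists>F. finite F \<and> F \<subseteq> semi6 m \<and> alg_independent F \<and>
    (\<forall>\<sigma>. (\<forall>f\<in>F. eval \<sigma> f = 0) \<longrightarrow> (\<forall>f\<in>semi6 m. eval \<sigma> f = 0))"
proof -
  define good where "good F \<longleftrightarrow> finite F \<and> F \<subseteq> semi6 m \<and>
    (\<forall>\<sigma>. (\<forall>f\<in>F. eval \<sigma> f = 0) \<longrightarrow> (\<forall>f\<in>semi6 m. eval \<sigma> f = 0))" for F
  obtain F0 where "good F0" using finite_null_system[of m] unfolding good_def by (elim exE)
  from ex_has_least_nat[of good F0 card, OF this] obtain F where F: "good F" "\<And>F'. good F' \<Longrightarrow> card F \<le> card F'" by blast
  have finF: "finite F" "F \<subseteq> semi6 m" and ZF: "\<And>\<sigma> f. (\<forall>f\<in>F. eval \<sigma> f = 0) \<Longrightarrow> f \<in> semi6 m \<Longrightarrow> eval \<sigma> f = 0"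
    using F(1) unfolding good_def by blast+
  have homF: "homogeneous 6 f" if "f \<in> F" for f using finF(2) that by (auto simp: semi6_def)
  have "alg_independent F" unfolding alg_independent_def
  proof (intro allI impI, rule ccontr)
    fix P :: "entry cpoly cpoly"
    assume P: "poly_vars P \<subseteq> F" "poly_subst const_poly (\<lambda>f. f) P = 0" "P \<noteq> 0"
    have PF: "hcomp e P \<in> cpolys_in F" for e using P(1) by (intro cpolys_in_hcomp) (simp add: cpolys_in_def)
    obtain D where D: "P = (\<Sum>d\<le>D. hcomp d P)" using ex_hcomp_decomp by blast
    have hom: "homogeneous (6 * d) (sbst (\<lambda>f. f) (hcomp d P))" for d
      by (rule homogeneous_sbst[OF homogeneous_hcomp]) (use PF homF in \<open>auto simp: cpolys_in_def\<close>)
    have "\<exists>e\<le>D. hcomp e P \<noteq> 0"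
    proof (rule ccontr)
      assume "\<not> ?thesis"
      then have "(\<Sum>d\<le>D. hcomp d P) = 0" by (intro sum.neutral) auto
      then show False using D P(3) by simp
    qed
    then obtain e where e: "e \<le> D" "hcomp e P \<noteq> 0" by blast
    define Q where "Q = hcomp e P"
    have QF: "poly_vars Q \<subseteq> F" using PF by (simp add: Q_def cpolys_in_def)
    \<comment> \<open>All members of \<open>F\<close> have degree 6, so the component of degree
      \<open>e\<close> of the relation becomes the component of degree \<open>6 * e\<close> after
      substitution and vanishes by itself.\<close>
    have "0 = hcomp (6 * e) (sbst (\<lambda>f. f) (\<Sum>d\<le>D. hcomp d P))" using P(2) D by simp
    also have "\<dots> = (\<Sum>d\<le>D. if d = e then sbst (\<lambda>f. f) (hcomp e P) else 0)"
      unfolding sb.subst_sum hcomp_sum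
      by (intro sum.cong refl) (simp add: hcomp_homogeneous[OF hom])
    also have "\<dots> = sbst (\<lambda>f. f) Q" using e(1) by (simp add: Q_def)
    finally have Q0: "sbst (\<lambda>f. f) Q = 0" by simp
    obtain c where c: "eval c Q \<noteq> 0" using cpoly_eqI_eval_0[of Q] e(2) by (auto simp: Q_def)
    \<comment> \<open>Otherwise \<open>c\<close> would agree on \<open>F\<close> with the values of
      \<open>F\<close> at the origin, where \<open>Q\<close> vanishes because it is a
      relation.\<close>
    have "\<exists>f0\<in>F. c f0 \<noteq> 0"
    proof (rule ccontr)
      assume "\<not> ?thesis"
      then have c0: "c x = eval (\<lambda>_. 0) x" if "x \<in> poly_vars Q" for x
        using that QF homF[THEN eval_homogeneous, of x 0 "\<lambda>_. 0"] by auto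
      have "eval c Q = eval (\<lambda>x. eval (\<lambda>_. 0) x) Q" by (rule eval_cong) (rule c0)
      also have "\<dots> = eval (\<lambda>_. 0) (sbst (\<lambda>f. f) Q)" by (simp add: eval_sbst)
      finally show False using c Q0 by (simp add: eval_simps)
    qed
    then obtain f0 where f0: "f0 \<in> F" "c f0 \<noteq> 0" by blast
    define c' where "c' f = 1 / c f0 * c f" for f
    have "eval c' Q = (1 / c f0) ^ e * eval c Q"
      unfolding c'_def by (rule eval_homogeneous) (simp add: Q_def)
    then have c': "eval c' Q \<noteq> 0" "c' f0 = 1" using c f0 by (simp_all add: c'_def)
    define F' where "F' = (\<lambda>f. f - const_poly (c' f) * f0) ` (F - {f0})"
    have "good F'" unfolding good_def
    proof (intro conjI allI impI ballI)
      show "finite F'" using finF by (simp add: F'_def)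
      show "F' \<subseteq> semi6 m" using finF(2) f0(1) by (auto simp: F'_def intro!: semi6_lin)
      fix \<sigma> f assume z: "\<forall>f\<in>F'. eval \<sigma> f = 0" and f: "f \<in> semi6 m"
      have v: "eval \<sigma> f = eval \<sigma> f0 * c' f" if "f \<in> F" for f
      proof (cases "f = f0")
        case False
        then have "f - const_poly (c' f) * f0 \<in> F'" using that by (auto simp: F'_def)
        then have "eval \<sigma> (f - const_poly (c' f) * f0) = 0" using z by blast
        then show ?thesis by (simp add: eval_simps)
      qed (simp add: c')
      have "0 = eval \<sigma> (sbst (\<lambda>f. f) Q)" by (simp add: Q0 eval_simps)
      also have "\<dots> = eval (\<lambda>f. eval \<sigma> f0 * c' f) Q"
        unfolding eval_sbst by (rule eval_cong) (use QF v in blast)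
      also have "\<dots> = eval \<sigma> f0 ^ e * eval c' Q" by (rule eval_homogeneous) (simp add: Q_def)
      finally have "eval \<sigma> f0 = 0" using c'(1) by simp
      then have "\<forall>f\<in>F. eval \<sigma> f = 0" using v by simp
      then show "eval \<sigma> f = 0" using ZF f by blast
    qed
    moreover have "card F' < card F"
    proof -
      have "card F' \<le> card (F - {f0})" unfolding F'_def using finF by (intro card_image_le) auto
      also have "\<dots> < card F" using finF f0 by (intro psubset_card_mono) auto
      finally show ?thesis .
    qed
    ultimately show False using F(2) by (meson leD)
  qed
  then show ?thesis using F(1) unfolding good_def by blast
qed

section \<open>A linear slice\<close>

text \<open>Restriction to tuples with \<open>X 0\<close> scalar, the first two columns of
  \<open>X 1\<close> equal to the same scalar times the second and third unit vectors, and the first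
  column of \<open>X 2\<close> a multiple of the first unit vector. Sharing one variable between
  \<open>X 0\<close> and \<open>X 1\<close> keeps the slice linear. For \<open>m \<ge> 3\<close> it
  has \<open>1 + 3 + 7 + 9 * (m - 3)\<close> parameters.\<close>

definition slice_sub :: "entry \<Rightarrow> entry cpoly" where
  "slice_sub = (\<lambda>(k, i, j).
     if k = 0 then (if i = j then var (0, 1, 1) else 0)
     else if k = 1 then (if j = 3 then var (1, i, 3)
       else if i = 2 \<and> j = 1 \<or> i = 3 \<and> j = 2 then var (0, 1, 1) else 0)
     else if k = 2 \<and> j = 1 \<and> i \<noteq> 1 then 0 else var (k, i, j))"

definition slice_vars :: "nat \<Rightarrow> entry set" where
  "slice_vars m = {(0, 1, 1)} \<union> {1} \<times> UNIV \<times> {3} \<union> {2} \<times> ({(1, 1)} \<union> UNIV \<times> {2, 3}) \<union> {3..<m} \<times> UNIV"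

lemma slice_vars_card:
  assumes "m \<ge> 3"
  shows "finite (slice_vars m)" "card (slice_vars m) \<le> 9 * m - 16"
proof -
  show "finite (slice_vars m)" by (simp add: slice_vars_def)
  have c1: "card ({1} \<times> (UNIV :: 3 set) \<times> {3 :: 3} :: entry set) = 3" by (simp add: card_cartesian_product)
  have "card ({(1, 1)} \<union> (UNIV :: 3 set) \<times> {2, 3 :: 3}) \<le> card {(1 :: 3, 1 :: 3)} + card ((UNIV :: 3 set) \<times> {2, 3 :: 3})"
    by (rule card_Un_le)
  also have "\<dots> = 7" by (simp add: card_cartesian_product)
  finally have c2: "card ({2} \<times> ({(1, 1)} \<union> (UNIV :: 3 set) \<times> {2, 3}) :: entry set) \<le> 7"
    by (simp only: card_cartesian_product) simp
  have c3: "card ({3..<m} \<times> UNIV :: entry set) = (m - 3) * 9"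
    by (simp only: card_cartesian_product UNIV_Times_UNIV[symmetric]) simp
  have "card (slice_vars m) \<le> card ({(0, 1, 1)} \<union> {1} \<times> UNIV \<times> {3} \<union> {2} \<times> ({(1, 1)} \<union> UNIV \<times> {2, 3}) :: entry set) +
      card ({3..<m} \<times> UNIV :: entry set)"
    unfolding slice_vars_def by (rule card_Un_le)
  also have "\<dots> \<le> (card ({(0, 1, 1)} \<union> {1} \<times> UNIV \<times> {3} :: entry set) +
      card ({2} \<times> ({(1, 1)} \<union> UNIV \<times> {2, 3}) :: entry set)) + card ({3..<m} \<times> UNIV :: entry set)"
    by (intro add_right_mono card_Un_le)
  also have "\<dots> \<le> ((card {(0, 1, 1) :: entry} + card ({1} \<times> UNIV \<times> {3} :: entry set)) +
      card ({2} \<times> ({(1, 1)} \<union> UNIV \<times> {2, 3}) :: entry set)) + card ({3..<m} \<times> UNIV :: entry set)"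
    by (intro add_right_mono card_Un_le)
  also have "\<dots> \<le> ((1 + 3) + 7) + (m - 3) * 9"
    using c1 c2 c3 by simp
  also have "\<dots> = 9 * m - 16" using assms by simp
  finally show "card (slice_vars m) \<le> 9 * m - 16" .
qed

lemma slice_sub_in:
  assumes "x \<in> entries m" shows "slice_sub x \<in> cpolys_in (slice_vars m)"
proof -
  obtain k i j where x: "x = (k, i, j)" by (cases x)
  have m0: "var (0, 1, 1) \<in> cpolys_in (slice_vars m)"
    by (rule cpolys_in_var) (simp add: slice_vars_def)
  have m1: "var (1, i, 3) \<in> cpolys_in (slice_vars m)"
    by (rule cpolys_in_var) (simp add: slice_vars_def)
  have m2: "var (2, i, j) \<in> cpolys_in (slice_vars m)" if ij: "j \<noteq> 1 \<or> i = 1"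
  proof (rule cpolys_in_var)
    consider "j = 1" "i = 1" | "j = 2" | "j = 3" using ij exhaust_3[of j] by blast
    then show "(2, i, j) \<in> slice_vars m" by cases (simp_all add: slice_vars_def)
  qed
  consider "k = 0" | "k = 1" | "k = 2" | "k \<ge> 3" by linarith
  then show ?thesis
  proof cases
    case 4
    then have "var (k, i, j) \<in> cpolys_in (slice_vars m)"
      using assms by (intro cpolys_in_var) (simp add: slice_vars_def x entries_def)
    then show ?thesis using 4 by (simp add: x slice_sub_def)
  qed (use m0 m1 m2 in \<open>simp_all add: x slice_sub_def\<close>)
qed

lemma homogeneous_slice_sub: "homogeneous 1 (slice_sub x)"
proof -
  have v: "homogeneous 1 (var y)" for y :: entry by (rule homogeneous_var)
  obtain k i j where x: "x = (k, i, j)" by (cases x)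
  show ?thesis using v by (auto simp: x slice_sub_def)
qed

definition in_slice :: "(nat \<Rightarrow> complex^3^3) \<Rightarrow> bool" where
  "in_slice X \<longleftrightarrow> (\<exists>l a b c. X 0 = mat l \<and> X 1 = mat3 0 0 a l 0 b 0 l c) \<and> X 2 $ 2 $ 1 = 0 \<and> X 2 $ 3 $ 1 = 0"

lemma eval_slice_sub:
  assumes "in_slice X"
  shows "eval (pt X) (sbst slice_sub p) = eval (pt X) p"
proof -
  obtain l a b c where X: "X 0 = mat l" "X 1 = mat3 0 0 a l 0 b 0 l c" "X 2 $ 2 $ 1 = 0" "X 2 $ 3 $ 1 = 0"
    using assms unfolding in_slice_def by (elim exE conjE)
  have *: "\<forall>i j. eval (pt X) (slice_sub (k, i, j)) = X k $ i $ j" for k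
  proof -
    consider "k = 0" | "k = 1" | "k = 2" | "k \<ge> 3" by linarith
    then show ?thesis
    proof cases
      case 1
      show ?thesis unfolding 1 by (simp add: forall_3 slice_sub_def eval_simps pt_def X(1) mat_nth3)
    next
      case 2
      show ?thesis unfolding 2 forall_3 using X(1,2)
        by (simp add: slice_sub_def eval_simps pt_def mat_nth3 del: One_nat_def)
    next
      case 3
      show ?thesis unfolding 3 by (simp add: forall_3 slice_sub_def eval_simps pt_def X(3,4))
    next
      case 4
      then show ?thesis by (simp add: slice_sub_def eval_simps pt_def)
    qed
  qed
  then have "eval (pt X) (slice_sub x) = pt X x" for x
    by (cases x) (simp add: pt_def)
  then show ?thesis by (simp add: eval_sbst)
qed

section \<open>Moving generic tuples into the slice\<close>

definition colm :: "complex^3 \<Rightarrow> complex^3 \<Rightarrow> complex^3 \<Rightarrow> complex^3^3" where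
  "colm u v w = mat3 (u$1) (v$1) (w$1) (u$2) (v$2) (w$2) (u$3) (v$3) (w$3)"

lemma mv_nth: "((M :: complex^3^3) *v u) $ i = M$i$1 * u$1 + M$i$2 * u$2 + M$i$3 * u$3"
  by (simp add: matrix_vector_mult_def sum_3)

lemma mult_colm: "M ** colm u v w = colm (M *v u) (M *v v) (M *v w)"
  by (rule mat3_eqI) (simp_all add: mult3_nth colm_def mv_nth)

lemma adj3_colm_nth:
  assumes "det (colm u v w) = 1"
  shows "adj3 (colm u v w) ** colm x y z =
    colm (adj3 (colm u v w) *v x) (adj3 (colm u v w) *v y) (adj3 (colm u v w) *v z)"
    "adj3 (colm u v w) *v u = axis 1 1" "adj3 (colm u v w) *v v = axis 2 1" "adj3 (colm u v w) *v w = axis 3 1"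
proof -
  show "adj3 (colm u v w) ** colm x y z =
    colm (adj3 (colm u v w) *v x) (adj3 (colm u v w) *v y) (adj3 (colm u v w) *v z)" by (rule mult_colm)
  have "colm (adj3 (colm u v w) *v u) (adj3 (colm u v w) *v v) (adj3 (colm u v w) *v w) = mat 1"
    using adj3_left[of "colm u v w"] assms by (simp add: mult_colm)
  then have "colm (adj3 (colm u v w) *v u) (adj3 (colm u v w) *v v) (adj3 (colm u v w) *v w) $ i $ j = mat 1 $ i $ j" for i j
    by simp
  from this[of 1 1] this[of 1 2] this[of 1 3] this[of 2 1] this[of 2 2] this[of 2 3] this[of 3 1] this[of 3 2] this[of 3 3]
  show "adj3 (colm u v w) *v u = axis 1 1" "adj3 (colm u v w) *v v = axis 2 1" "adj3 (colm u v w) *v w = axis 3 1"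
    by (simp_all add: colm_def mat_nth3 vec_eq_iff forall_3 axis_def)
qed

text \<open>With \<open>U = X 0\<^sup>-\<^sup>1\<close>, the basis change to \<open>v, Y v, Y (Y v)\<close> for \<open>Y = U ** X 1\<close> and an eigenvector \<open>v\<close> of
  \<open>U ** X 2\<close> moves \<open>X\<close> into the slice.\<close>

lemma slice_reach:
  assumes p: "p \<in> matrix_semi_invariants m" "sbst slice_sub p = 0"
    and X: "U ** X 0 = mat 1" and v: "(U ** X 2) *v v = \<mu> *s v"
    and d: "det (colm v ((U ** X 1) *v v) ((U ** X 1) *v ((U ** X 1) *v v))) = 1"
  shows "eval (pt X) p = 0"
proof -
  define Y where "Y = U ** X 1"
  define w where "w = Y *v (Y *v v)"
  define M where "M = colm v (Y *v v) w"
  have dM: "det M = 1" using d by (simp add: M_def Y_def w_def)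
  have dU: "det U * det (X 0) = 1" using X by (metis det_I det_mul)
  \<comment> \<open>This factor gives \<open>A\<close> determinant one, as the action requires; it
    is why the slice has a free scalar in \<open>X 0\<close> instead of the identity.\<close>
  obtain c where c: "c ^ 3 = det (X 0)" using cube_root_exists by blast
  define A where "A = cscale c (adj3 M ** U)"
  have "det (adj3 M) = 1" using adj3_left[of M] dM by (metis det_I det_mul mult.right_neutral)
  then have dA: "det A = 1" using c dU by (simp add: A_def det_cscale det_mul power3_eq_cube mult.commute)
  have AX: "A ** X k ** M = cscale c (adj3 M ** ((U ** X k) ** M))" for k
    by (simp add: A_def cscale_mult matrix_mul_assoc)
  note adj = adj3_colm_nth[OF dM[unfolded M_def], folded M_def]
  have "in_slice (\<lambda>k. A ** X k ** M)"
    unfolding in_slice_def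
  proof (intro conjI)
    have "A ** X 0 ** M = mat c"
      unfolding AX X by (rule mat3_eqI) (simp_all add: adj3_left dM cscale_def mat_nth3)
    moreover have "\<exists>a b e. A ** X 1 ** M = mat3 0 0 a c 0 b 0 c e"
    proof -
      have "(U ** X 1) ** M = colm (Y *v v) w (Y *v w)"
        by (simp only: Y_def[symmetric] M_def mult_colm w_def)
      then have "A ** X 1 ** M = cscale c (colm (axis 2 1) (axis 3 1) (adj3 M *v (Y *v w)))"
        unfolding AX by (simp add: mult_colm adj(3,4))
      then show ?thesis
        by (intro exI[of _ "c * (adj3 M *v (Y *v w))$1"] exI[of _ "c * (adj3 M *v (Y *v w))$2"] exI[of _ "c * (adj3 M *v (Y *v w))$3"])
          (simp add: mat3_eqI cscale_def colm_def axis_def)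
    qed
    ultimately show "\<exists>l a b ca. A ** X 0 ** M = mat l \<and> A ** X 1 ** M = mat3 0 0 a l 0 b 0 l ca" by blast
    have "(U ** X 2) ** M = colm (\<mu> *s v) ((U ** X 2) *v (Y *v v)) ((U ** X 2) *v w)"
      unfolding M_def mult_colm v ..
    then have e: "A ** X 2 ** M = cscale c (colm (adj3 M *v (\<mu> *s v)) (adj3 M *v ((U ** X 2) *v (Y *v v))) (adj3 M *v ((U ** X 2) *v w)))"
      unfolding AX by (simp add: mult_colm)
    have "adj3 M *v (\<mu> *s v) = \<mu> *s axis 1 1"
      unfolding adj(2)[symmetric] by (simp add: vec_eq_iff mv_nth algebra_simps)
    then show "(A ** X 2 ** M) $ 2 $ 1 = 0" "(A ** X 2 ** M) $ 3 $ 1 = 0"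
      unfolding e by (simp_all add: cscale_def colm_def axis_def)
  qed
  from eval_slice_sub[OF this, of p] have "eval (pt (\<lambda>k. A ** X k ** M)) p = 0" by (simp add: p(2) eval_simps)
  then show ?thesis using p(1) dA dM by (simp add: semi_invariant_iff)
qed

lemma eigenvector_exists: "\<exists>\<mu> v. v \<noteq> 0 \<and> (Z :: complex^3^3) *v v = \<mu> *s v"
proof -
  define q where "q = [:det Z, - trace (adj3 Z), trace Z, -1:]"
  have "\<not> constant (poly q)" by (simp add: constant_degree q_def)
  then obtain \<mu> where "poly q \<mu> = 0" using fundamental_theorem_of_algebra by blast
  moreover have "det (Z - mat \<mu>) = poly q \<mu>"
    by (simp add: q_def det_3 trace3 adj3_nth mat_nth3 algebra_simps)
  ultimately have "det (Z - mat \<mu>) = 0" by simp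
  then have "\<not> invertible (Z - mat \<mu>)" by (simp add: invertible_det_nz)
  then have "\<not> (\<exists>B. B ** (Z - mat \<mu>) = mat 1)" by (simp add: invertible_left_inverse)
  then obtain v where v: "(Z - mat \<mu>) *v v = 0" "v \<noteq> 0" by (auto simp: matrix_left_invertible_ker)
  have "Z *v v = \<mu> *s v"
    using v(1) by (simp add: vec_eq_iff forall_3 mv_nth mat_nth3 algebra_simps)
  then show ?thesis using v(2) by blast
qed

lemma complete_basis: "v \<noteq> 0 \<Longrightarrow> \<exists>u w. det (colm v u w) \<noteq> 0"
proof -
  assume "v \<noteq> 0"
  then consider "v$1 \<noteq> 0" | "v$2 \<noteq> 0" | "v$3 \<noteq> 0" by (auto simp: vec_eq_iff forall_3)
  then show ?thesis
  proof cases
    case 1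
    then show ?thesis by (intro exI[of _ "axis 2 1"] exI[of _ "axis 3 1"]) (simp add: det_3 colm_def axis_def)
  next
    case 2
    then show ?thesis by (intro exI[of _ "axis 1 1"] exI[of _ "axis 3 1"]) (simp add: det_3 colm_def axis_def)
  next
    case 3
    then show ?thesis by (intro exI[of _ "axis 1 1"] exI[of _ "axis 2 1"]) (simp add: det_3 colm_def axis_def)
  qed
qed

lemma mv_add_scale: "((A :: complex^3^3) + cscale t B) *v u = A *v u + t *s (B *v u)"
  by (simp add: vec_eq_iff mv_nth cscale_def algebra_simps)

text \<open>An eigenvector \<open>v\<close> of \<open>U ** X 2\<close> always exists but need not be
  cyclic for \<open>U ** X 1\<close>. For a basis \<open>v, u, w\<close>, perturbing
  \<open>U ** X 1\<close> by a map that takes \<open>v\<close> to \<open>u\<close> and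
  \<open>u\<close> to \<open>w\<close> makes \<open>v\<close> cyclic for almost all
  parameters.\<close>

lemma slice_invertible:
  assumes p: "p \<in> matrix_semi_invariants m" "sbst slice_sub p = 0" and X0: "det (X 0) \<noteq> 0"
  shows "eval (pt X) p = 0"
proof -
  define U where "U = cscale (1 / det (X 0)) (adj3 (X 0))"
  have UX: "U ** X 0 = mat 1" "X 0 ** U = mat 1"
    using X0 by (simp_all add: U_def cscale_mult adj3_left adj3_right) (simp_all add: cscale_def mat_def vec_eq_iff)
  obtain \<mu> v where v: "v \<noteq> 0" "(U ** X 2) *v v = \<mu> *s v" using eigenvector_exists by blast
  obtain u w where T: "det (colm v u w) \<noteq> 0" using complete_basis[OF v(1)] by blast
  define T where "T = colm v u w"
  \<comment> \<open>In the basis \<open>v, u, w\<close> this is a nilpotent shift: \<open>v\<close>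
    goes to \<open>u\<close>, \<open>u\<close> to \<open>w\<close>, and \<open>w\<close> to
    0.\<close>
  define W where "W = cscale (1 / det T) (colm u w 0 ** adj3 T)"
  have WT: "W ** T = colm u w 0"
  proof -
    have "W ** T = cscale (1 / det T) (colm u w 0 ** (adj3 T ** T))"
      by (simp add: W_def cscale_mult matrix_mul_assoc)
    also have "\<dots> = colm u w 0" using T by (simp add: adj3_left T_def[symmetric] mat_mult_right cscale_cscale)
    finally show ?thesis .
  qed
  then have "colm (W *v v) (W *v u) (W *v w) = colm u w 0" by (simp add: T_def mult_colm)
  then have Wv: "W *v v = u" "W *v u = w"
    by (simp_all add: colm_def mat3_def vec_eq_iff forall_3)
  define Y where "Y = U ** X 1"
  define Xt where "Xt t = X(1 := X 1 + cscale t (X 0 ** W))" for t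
  have UXt: "U ** Xt t 1 = Y + cscale t W" for t
  proof -
    have "U ** Xt t 1 = U ** X 1 + cscale t ((U ** X 0) ** W)"
      unfolding Xt_def by (rule mat3_eqI) (simp_all add: mult3_nth cscale_def algebra_simps)
    then show ?thesis by (simp add: Y_def UX)
  qed
  define D where "D t = det (colm v ((U ** Xt t 1) *v v) ((U ** Xt t 1) *v ((U ** Xt t 1) *v v)))" for t
  define y where "y = Y *v v"
  define b0 b1 where "b0 = Y *v y" and "b1 = Y *v u + W *v y"
  \<comment> \<open>The expansion of the determinant in powers of \<open>t\<close>; its leading
    coefficient is nonzero because \<open>v, u, w\<close> is a basis.\<close>
  define q where "q = [:det (colm v y b0), det (colm v u b0) + det (colm v y b1), det (colm v y w) + det (colm v u b1), det (colm v u w):]"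
  have D: "D t = poly q t" for t
  proof -
    have 1: "(Y + cscale t W) *v v = y + t *s u" by (simp add: mv_add_scale y_def Wv)
    have 2: "(Y + cscale t W) *v (y + t *s u) = b0 + t *s b1 + (t * t) *s w"
      by (simp add: mv_add_scale b0_def b1_def Wv(2)[symmetric]) (simp add: vec_eq_iff mv_nth algebra_simps)
    show ?thesis unfolding D_def UXt 1 2 q_def
      by (simp add: det_3 colm_def algebra_simps)
  qed
  have "q \<noteq> 0" using T by (simp add: q_def)
  then have "\<forall>\<^sub>F t in at 0. D t \<noteq> 0" unfolding D by (rule poly_eventually_nonzero)
  moreover have "eval (pt (Xt t)) p = 0" if Dt: "D t \<noteq> 0" for t
  proof -
    \<comment> \<open>Rescaling \<open>v\<close> by \<open>s\<close> multiplies the determinant by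
      \<open>s ^ 3\<close>, so a cube root normalizes it to 1.\<close>
    obtain s where s: "s ^ 3 = 1 / D t" using cube_root_exists by blast
    have "(U ** Xt t 2) *v (s *s v) = \<mu> *s (s *s v)"
    proof -
      have "(U ** X 2) *v (s *s v) = s *s ((U ** X 2) *v v)" by (simp add: vec_eq_iff mv_nth algebra_simps)
      then show ?thesis by (simp add: Xt_def v(2) mult.commute)
    qed
    moreover have "det (colm (s *s v) ((U ** Xt t 1) *v (s *s v)) ((U ** Xt t 1) *v ((U ** Xt t 1) *v (s *s v)))) = 1"
    proof -
      have sc: "M *v (s *s x) = s *s (M *v x)" for M :: "complex^3^3" and x by (simp add: vec_eq_iff mv_nth algebra_simps)
      have "det (colm (s *s x) (s *s y) (s *s z)) = s ^ 3 * det (colm x y z)" for x y z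
        by (simp add: det_3 colm_def power3_eq_cube algebra_simps)
      then show ?thesis unfolding sc using s Dt by (simp add: D_def)
    qed
    moreover have "U ** Xt t 0 = mat 1" by (simp add: Xt_def UX)
    ultimately show ?thesis by (intro slice_reach[OF p])
  qed
  ultimately have "\<forall>\<^sub>F t in at 0. eval (pt (Xt t)) p = 0" by (simp add: eventually_mono)
  then have "eval (pt (Xt 0)) p = 0"
  proof (rule eval_perturb[rotated])
    fix x :: entry
    obtain k i j where "x = (k, i, j)" by (cases x)
    then show "isCont (\<lambda>t. pt (Xt t) x) 0"
      by (cases "k = 1") (simp_all add: pt_def Xt_def cscale_def)
  qed
  moreover have "Xt 0 = X" by (auto simp: Xt_def fun_eq_iff cscale_def vec_eq_iff)
  ultimately show ?thesis by simp
qed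

text \<open>Tuples with \<open>X 0\<close> invertible are settled; adding a small nonzero multiple
  of the identity to \<open>X 0\<close> makes it invertible, and continuity does the rest.\<close>

theorem slice_faithful:
  assumes p: "p \<in> matrix_semi_invariants m" "sbst slice_sub p = 0"
  shows "p = 0"
proof (rule cpoly_eqI_eval_0)
  fix \<sigma> :: "entry \<Rightarrow> complex"
  define X where "X = unpt \<sigma>"
  define Xt where "Xt t = X(0 := X 0 + mat t)" for t
  define q where "q = [:det (X 0), trace (adj3 (X 0)), trace (X 0), 1:]"
  have "det (Xt t 0) = poly q t" for t
    by (simp add: Xt_def q_def det_3 trace3 adj3_nth mat_nth3 algebra_simps)
  moreover have "\<forall>\<^sub>F t in at 0. poly q t \<noteq> 0" by (rule poly_eventually_nonzero) (simp add: q_def)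
  ultimately have "\<forall>\<^sub>F t in at 0. eval (pt (Xt t)) p = 0"
    by (auto elim!: eventually_mono intro!: slice_invertible[OF p])
  then have "eval (pt (Xt 0)) p = 0"
  proof (rule eval_perturb[rotated])
    fix x :: entry
    obtain k i j where "x = (k, i, j)" by (cases x)
    then show "isCont (\<lambda>t. pt (Xt t) x) 0"
      by (cases "k = 0"; cases "i = j") (simp_all add: pt_def Xt_def mat_nth3)
  qed
  moreover have "Xt 0 = X" by (auto simp: Xt_def fun_eq_iff vec_eq_iff mat_nth3)
  ultimately show "eval \<sigma> p = 0" by (simp add: X_def)
qed

section \<open>Comparison of growth rates: the upper bound\<close>

lemma growth_exponent_le:
  fixes a b B C :: nat
  assumes "\<And>N. N \<ge> 1 \<Longrightarrow> N ^ a \<le> C * (B * N) ^ b"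
  shows "a \<le> b"
proof (rule ccontr)
  assume "\<not> a \<le> b"
  then have "Suc b \<le> a" by simp
  define N where "N = Suc (C * B ^ b)"
  have "N ^ Suc b \<le> N ^ a" using \<open>Suc b \<le> a\<close> by (intro power_increasing) (simp_all add: N_def)
  also have "\<dots> \<le> C * (B * N) ^ b" by (rule assms) (simp add: N_def)
  also have "\<dots> = (C * B ^ b) * N ^ b" by (simp add: power_mult_distrib)
  finally have "N * N ^ b \<le> (C * B ^ b) * N ^ b" by simp
  then have "N \<le> C * B ^ b" by (simp add: N_def)
  then show False by (simp add: N_def)
qed

lemma lookup_sum_single:
  assumes "finite I"
  shows "lookup (\<Sum>u\<in>I. single u (c u)) v = (if v \<in> I then c v else 0)"
  using assms by (simp add: lookup_sum lookup_single when_def)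

lemma monom_degree_box:
  assumes "finite A" "u \<in> monom_box A N"
  shows "monom_degree u \<le> card A * N"
proof -
  have "monom_degree u = (\<Sum>x\<in>A. lookup u x)"
    using assms by (intro monom_degree_superset) (auto simp: monom_box_def)
  also have "\<dots> \<le> (\<Sum>x\<in>A. N)" using assms by (intro sum_mono) (auto simp: monom_box_def less_imp_le)
  finally show ?thesis by simp
qed

text \<open>The \<open>N ^ card F\<close> products of elements of \<open>F\<close> with exponents
  below \<open>N\<close>, restricted to the slice, use at most a constant multiple of
  \<open>N ^ card (slice_vars m)\<close> monomials. More products than monomials would give a linear
  relation on the slice, which \<open>slice_faithful\<close> lifts to a relation among the elements
  of \<open>F\<close>.\<close>

theorem independent_card_upper:
  assumes m: "m \<ge> 3" and F: "finite F" "F \<subseteq> semi6 m" "alg_independent F"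
  shows "card F \<le> 9 * m - 16"
proof -
  let ?d = "card F"
  have "N ^ ?d \<le> 1 * ((6 * ?d + 1) * N) ^ card (slice_vars m)" if N: "N \<ge> 1" for N
  proof (rule ccontr)
    assume no: "\<not> ?thesis"
    define I where "I = monom_box F N"
    \<comment> \<open>A product has degree at most \<open>6 * card F * N\<close>, and substituting
      linear forms preserves it; the bound of the box is strict, whence the added 1.\<close>
    define B where "B = monom_box (slice_vars m) (6 * ?d * N + 1)"
    define f where "f u = sbst slice_sub (mpow (\<lambda>g. g) u)" for u :: "entry cpoly \<Rightarrow>\<^sub>0 nat"
    have fin: "finite I" "finite B" using F(1) slice_vars_card(1)[OF m] by (simp_all add: I_def B_def finite_monom_box)
    have inv: "mpow (\<lambda>g. g) u \<in> matrix_semi_invariants m" if "u \<in> I" for u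
    proof -
      interpret selfadjoint_family same_matrix "entries m" sl_family by (rule selfadjoint)
      have "mpow (\<lambda>g. g) u \<in> invs"
        using that F(2) by (intro invs_mpow) (auto simp: invs_eq I_def monom_box_def semi6_def)
      then show ?thesis by (simp add: invs_eq)
    qed
    have "card B \<le> ((6 * ?d + 1) * N) ^ card (slice_vars m)"
      using N by (auto simp: B_def card_monom_box slice_vars_card(1)[OF m] algebra_simps intro!: power_mono)
    then have "card B < card I" using no F(1) by (simp add: I_def card_monom_box)
    moreover have "keys (f u) \<subseteq> B" if u: "u \<in> I" for u
    proof -
      have "homogeneous (6 * monom_degree u) (mpow (\<lambda>g. g) u)"
        using u F(2) by (intro homogeneous_mpow) (auto simp: I_def monom_box_def semi6_def)
      then have "homogeneous (1 * (6 * monom_degree u)) (f u)"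
        unfolding f_def by (rule homogeneous_sbst) (rule homogeneous_slice_sub)
      then have h: "homogeneous (6 * monom_degree u) (f u)" by simp
      have "f u \<in> cpolys_in (slice_vars m)"
        unfolding f_def using inv[OF u] slice_sub_in[of _ m]
        by (intro cpolys_in_sbst) (auto simp: semi_invariant_iff cpolys_in_def)
      moreover have "lookup v x < 6 * ?d * N + 1" if v: "v \<in> keys (f u)" for v x
      proof -
        have "lookup v x \<le> monom_degree v" by (rule lookup_le_monom_degree)
        also have "\<dots> = 6 * monom_degree u" using h v by (simp add: homogeneous_def)
        also have "\<dots> \<le> 6 * (?d * N)" using monom_degree_box[OF F(1), of u N] u by (simp add: I_def)
        finally show ?thesis by simp
      qed
      ultimately show ?thesis by (auto simp: B_def monom_box_def cpolys_in_iff)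
    qed
    ultimately have "\<exists>c. (\<exists>u\<in>I. c u \<noteq> 0) \<and> (\<Sum>u\<in>I. const_poly (c u) * f u) = 0"
      by (intro lin_dep_cpoly[OF fin(2,1)])
    then obtain c where c: "\<exists>u\<in>I. c u \<noteq> 0" "(\<Sum>u\<in>I. const_poly (c u) * f u) = 0" by (elim exE conjE)
    define P where "P = (\<Sum>u\<in>I. single u (c u))"
    obtain u where "u \<in> I" "c u \<noteq> 0" using c(1) by blast
    then have "lookup P u \<noteq> 0" by (simp add: P_def lookup_sum_single[OF fin(1)])
    then have "P \<noteq> 0" by auto
    have PF: "poly_vars P \<subseteq> F"
    proof -
      have "P \<in> cpolys_in F" unfolding P_def
        by (intro cpolys_in_sum) (auto simp: cpolys_in_iff I_def monom_box_def split: if_splits)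
      then show ?thesis by (simp add: cpolys_in_def)
    qed
    have sP: "sbst (\<lambda>g. g) P = (\<Sum>u\<in>I. const_poly (c u) * mpow (\<lambda>g. g) u)"
      by (simp add: P_def sb.subst_sum sb.subst_single)
    have "sbst (\<lambda>g. g) P = 0"
    proof (rule slice_faithful)
      show "sbst slice_sub (sbst (\<lambda>g. g) P) = 0"
        unfolding sP sb.subst_sum sb.subst_mult sb.subst_const using c(2) by (simp add: f_def)
      interpret selfadjoint_family same_matrix "entries m" sl_family by (rule selfadjoint)
      have "sbst (\<lambda>g. g) P \<in> invs"
        unfolding sP by (intro invs_sum invs_mult invs_const) (simp add: invs_eq inv)
      then show "sbst (\<lambda>g. g) P \<in> matrix_semi_invariants m" by (simp add: invs_eq)
    qed
    with F(3)[unfolded alg_independent_def, rule_format, OF PF] have "P = 0" .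
    then show False using \<open>P \<noteq> 0\<close> by simp
  qed
  then have "?d \<le> card (slice_vars m)" by (rule growth_exponent_le)
  then show ?thesis using slice_vars_card(2)[OF m] by simp
qed

section \<open>Algebraically independent invariants\<close>

primrec mpw :: "'a::comm_ring_1^3^3 \<Rightarrow> nat \<Rightarrow> 'a^3^3" where
  "mpw A 0 = mat 1"
| "mpw A (Suc n) = A ** mpw A n"

text \<open>For \<open>P\<close> and \<open>Q\<close> of determinant one, all matrices
  \<open>adj3 (X 0) ** X k\<close> are conjugated by \<open>Q\<close>. The list consists of the
  determinant of \<open>X 0\<close>, the coefficients of the characteristic polynomial of
  \<open>Y\<close> up to sign, seven functions of \<open>Y\<close> and \<open>Z\<close>, and nine
  traces for each further matrix. The adjugate of \<open>X 0\<close> stands for its inverse and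
  keeps everything polynomial.\<close>

definition sinv :: "(nat \<Rightarrow> 'a::comm_ring_1^3^3) \<Rightarrow> nat \<times> nat \<times> nat \<Rightarrow> 'a" where
  "sinv X = (\<lambda>(j, p, q).
     let Y = adj3 (X 0) ** X 1; Z = adj3 (X 0) ** X 2 in
     if j = 0 then det (X 0)
     else if j = 1 then (if p = 0 then trace Y else if p = 1 then trace (adj3 Y) else det Y)
     else if j = 2 then (if p = 0 then trace (mpw Y q ** Z) else if p = 1 then trace (mpw Y q ** adj3 Z) else det Z)
     else trace (mpw Y p ** Z ** mpw Y q ** (adj3 (X 0) ** X j)))"

definition sidx :: "nat \<Rightarrow> (nat \<times> nat \<times> nat) set" where
  "sidx m = {(0, 0, 0)} \<union> {1} \<times> {..<3} \<times> {0} \<union> {2} \<times> {0, 1} \<times> {..<3} \<union> {(2, 2, 0)} \<union> {3..<m} \<times> {..<3} \<times> {..<3}"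

lemma sidx_card:
  assumes "m \<ge> 3"
  shows "finite (sidx m)" "card (sidx m) = 9 * m - 16"
proof -
  show "finite (sidx m)" by (simp add: sidx_def)
  have "card (sidx m) = card ({(0, 0, 0)} \<union> {1} \<times> {..<3} \<times> {0} \<union> {2} \<times> {0, 1} \<times> {..<3} \<union> {(2, 2, 0)} :: (nat \<times> nat \<times> nat) set)
      + card ({3..<m} \<times> {..<3} \<times> {..<3} :: (nat \<times> nat \<times> nat) set)"
    unfolding sidx_def by (rule card_Un_disjoint) auto
  also have "card ({(0, 0, 0)} \<union> {1} \<times> {..<3} \<times> {0} \<union> {2} \<times> {0, 1} \<times> {..<3} \<union> {(2, 2, 0)} :: (nat \<times> nat \<times> nat) set)
      = card ({(0, 0, 0)} \<union> {1} \<times> {..<3} \<times> {0} \<union> {2} \<times> {0, 1} \<times> {..<3} :: (nat \<times> nat \<times> nat) set) + card {(2 :: nat, 2 :: nat, 0 :: nat)}"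
    by (rule card_Un_disjoint) auto
  also have "card ({(0, 0, 0)} \<union> {1} \<times> {..<3} \<times> {0} \<union> {2} \<times> {0, 1} \<times> {..<3} :: (nat \<times> nat \<times> nat) set)
      = card ({(0, 0, 0)} \<union> {1} \<times> {..<3} \<times> {0} :: (nat \<times> nat \<times> nat) set) + card ({2} \<times> {0, 1} \<times> {..<3} :: (nat \<times> nat \<times> nat) set)"
    by (rule card_Un_disjoint) auto
  also have "card ({(0, 0, 0)} \<union> {1} \<times> {..<3} \<times> {0} :: (nat \<times> nat \<times> nat) set)
      = card {(0 :: nat, 0 :: nat, 0 :: nat)} + card ({1} \<times> {..<3} \<times> {0} :: (nat \<times> nat \<times> nat) set)"
    by (rule card_Un_disjoint) auto
  finally show "card (sidx m) = 9 * m - 16" using assms by (simp add: card_cartesian_product)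
qed

lemma adj3_adj3: "adj3 (adj3 A) = cscale (det A) A"
  by (rule mat3_eqI) (simp_all add: adj3_nth cscale_def det_3 algebra_simps)

lemma det_adj3_1: "det A = 1 \<Longrightarrow> det (adj3 A) = 1"
  using adj3_left[of A] by (metis det_I det_mul mult.right_neutral)

lemma mpw_conj: "det Q = 1 \<Longrightarrow> mpw (adj3 Q ** A ** Q) n = adj3 Q ** mpw A n ** Q"
  by (induction n) (simp_all add: adj3_left conj_mult)

lemma sinv_invariant:
  assumes PQ: "det P = 1" "det Q = 1"
  shows "sinv (\<lambda>k. P ** X k ** Q) i = sinv X i"
proof -
  obtain j p q where i: "i = (j, p, q)" by (cases i)
  have step: "adj3 (P ** X 0 ** Q) ** (P ** X k ** Q) = adj3 Q ** (adj3 (X 0) ** X k) ** Q" for k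
    by (simp only: adj_conj_step PQ(1) cscale_1)
  have adj: "adj3 (adj3 Q ** A ** Q) = adj3 Q ** adj3 A ** Q" for A
    by (simp add: adj3_mult adj3_adj3 PQ matrix_mul_assoc)
  have tr: "trace (adj3 Q ** A ** Q) = trace A" for A by (simp add: trace_conj PQ)
  have dt: "det (adj3 Q ** A ** Q) = det A" for A by (simp add: det_mul det_adj3_1 PQ)
  have mu: "(adj3 Q ** A ** Q) ** (adj3 Q ** B ** Q) = adj3 Q ** (A ** B) ** Q" for A B
    by (simp only: conj_mult PQ(2) cscale_1)
  show ?thesis
    unfolding i sinv_def prod.case Let_def step mpw_conj[OF PQ(2)] adj mu tr dt
    by (simp only: det_mul PQ mult_1_left mult_1_right)
qed

lemma evm_mpw: "evm \<sigma> (mpw A n) = mpw (evm \<sigma> A) n"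
  by (induction n) (simp_all add: evm_mat evm_mult)

lemma eval_sinv: "eval (pt X) (sinv gmat i) = sinv X i"
proof -
  obtain j p q where i: "i = (j, p, q)" by (cases i)
  show ?thesis
    by (simp add: i sinv_def Let_def eval_trace eval_det3 evm_mult evm_adj3 evm_mpw evm_gmat)
qed

lemma mat_in_mpw: "mat_in V A \<Longrightarrow> mat_in V (mpw A n)"
  by (induction n) (simp_all add: mat_in_1 mat_in_mult)

lemma sinv_in:
  assumes "m \<ge> 3" "i \<in> sidx m"
  shows "sinv gmat i \<in> matrix_semi_invariants m"
proof -
  obtain j p q where i: "i = (j, p, q)" by (cases i)
  have j: "j < m" using assms by (auto simp: i sidx_def)
  have "sinv gmat i \<in> cpolys_in (entries m)"
    unfolding i sinv_def prod.case Let_def using assms(1) j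
    by (auto intro!: mat_in_det mat_in_trace mat_in_mult mat_in_mpw mat_in_adj3 mat_in_gmat)
  then show ?thesis by (simp add: semi_invariant_iff eval_sinv sinv_invariant)
qed

section \<open>Prescribing the values of the invariants\<close>

lemma vandermonde3:
  fixes d1 d2 d3 :: complex
  assumes "d1 \<noteq> d2" "d1 \<noteq> d3" "d2 \<noteq> d3"
  shows "\<exists>x :: complex^3. \<forall>q<3. d1 ^ q * x$1 + d2 ^ q * x$2 + d3 ^ q * x$3 = y q"
proof -
  define M where "M = mat3 1 1 1 d1 d2 d3 (d1\<^sup>2) (d2\<^sup>2) (d3\<^sup>2)"
  have "det M = (d2 - d1) * (d3 - d1) * (d3 - d2)"
    by (simp add: M_def det_3 power2_eq_square algebra_simps)
  then have dM: "det M \<noteq> 0" using assms by simp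
  define v :: "complex^3" where "v = vector [y 0, y 1, y 2]"
  define x where "x = (1 / det M) *s (adj3 M *v v)"
  have "M *v (adj3 M *v v) = det M *s v"
    unfolding matrix_vector_mul_assoc adj3_right by (simp add: vec_eq_iff forall_3 mv_nth mat_nth3)
  moreover have "M *v x = (1 / det M) *s (M *v (adj3 M *v v))"
    by (simp add: x_def vec_eq_iff mv_nth algebra_simps)
  ultimately have "M *v x = v" using dM by (simp add: vec_eq_iff)
  then have "(M *v x) $ i = v $ i" for i by simp
  from this[of 1] this[of 2] this[of 3]
  have "x$1 + x$2 + x$3 = y 0" "d1 * x$1 + d2 * x$2 + d3 * x$3 = y 1" "d1\<^sup>2 * x$1 + d2\<^sup>2 * x$2 + d3\<^sup>2 * x$3 = y 2"
    by (simp_all add: mv_nth M_def v_def)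
  then have "\<forall>q<3. d1 ^ q * x$1 + d2 ^ q * x$2 + d3 ^ q * x$3 = y q"
    by (auto simp: numeral_3_eq_3 numeral_2_eq_2 less_Suc_eq power2_eq_square)
  then show ?thesis by blast
qed

lemma quadratic_root: "\<exists>u :: complex. u * u - k * u + a = 0"
proof -
  have "\<not> constant (poly [:a, - k, 1:])" by (simp add: constant_degree)
  then obtain u where "poly [:a, - k, 1:] u = 0" using fundamental_theorem_of_algebra by blast
  then show ?thesis by (intro exI[of _ u]) (simp add: algebra_simps)
qed

lemma cubic_roots: "\<exists>d1 d2 d3 :: complex. d1 + d2 + d3 = a \<and> d1 * d2 + d1 * d3 + d2 * d3 = b \<and> d1 * d2 * d3 = c"
proof -
  have "\<not> constant (poly [:- c, b, - a, 1:])" by (simp add: constant_degree)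
  then obtain d1 where "poly [:- c, b, - a, 1:] d1 = 0" using fundamental_theorem_of_algebra by blast
  then have d1: "d1 * (b - d1 * (a - d1)) = c" by (simp add: algebra_simps)
  obtain d2 where d2: "d2 * d2 - (a - d1) * d2 + (b - d1 * (a - d1)) = 0" using quadratic_root by blast
  define d3 where "d3 = a - d1 - d2"
  have p: "d2 * d3 = b - d1 * (a - d1)" using d2 by (simp add: d3_def algebra_simps)
  have "d1 * d2 + d1 * d3 + d2 * d3 = b" unfolding p by (simp add: d3_def algebra_simps)
  moreover have "d1 * d2 * d3 = c" using d1 p by (simp add: mult.assoc)
  ultimately show ?thesis by (intro exI[of _ d1] exI[of _ d2] exI[of _ d3]) (simp add: d3_def)
qed

text \<open>The values of \<open>sinv\<close> in coordinates: \<open>l ^ 3\<close> is the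
  determinant of \<open>X 0\<close>, \<open>d1\<close>, \<open>d2\<close>, \<open>d3\<close> are the
  eigenvalues of \<open>Y\<close>, \<open>z\<close> and \<open>w\<close> are the diagonals of
  \<open>Z\<close> and \<open>adj3 Z\<close> in an eigenbasis, \<open>k\<close> is
  \<open>det Z\<close>, and \<open>h\<close> prescribes the traces that involve further
  matrices.\<close>

definition Phi :: "complex \<Rightarrow> complex \<Rightarrow> complex \<Rightarrow> complex \<Rightarrow> complex^3 \<Rightarrow> complex^3 \<Rightarrow> complex \<Rightarrow>
    (nat \<times> nat \<times> nat \<Rightarrow> complex) \<Rightarrow> nat \<times> nat \<times> nat \<Rightarrow> complex" where
  "Phi l d1 d2 d3 z w k h = (\<lambda>(j, p, q).
     if j = 0 then l ^ 3
     else if j = 1 then (if p = 0 then d1 + d2 + d3 else if p = 1 then d1 * d2 + d1 * d3 + d2 * d3 else d1 * d2 * d3)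
     else if j = 2 then (if p = 0 then d1 ^ q * z$1 + d2 ^ q * z$2 + d3 ^ q * z$3
       else if p = 1 then d1 ^ q * w$1 + d2 ^ q * w$2 + d3 ^ q * w$3 else k)
     else h (j, p, q))"

lemma mpw_diag: "mpw (mat3 d1 0 0 0 d2 0 0 0 d3) n = mat3 (d1 ^ n) 0 0 0 (d2 ^ n) 0 0 0 (d3 ^ n)"
  by (induction n) (rule mat3_eqI; simp add: mat_nth3 mult3_nth)+

text \<open>Prescribed values are attained with \<open>X 0\<close> scalar and \<open>X 1\<close> diagonal: the diagonal and the products
  \<open>Z$i$j * Z$j$i\<close> of \<open>Z\<close> are then found by solving Vandermonde systems, and \<open>det Z\<close> is adjusted through the
  two remaining cyclic products, whose product is already fixed.\<close>

lemma Phi_attained: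
  assumes l: "l \<noteq> 0" and d: "d1 \<noteq> d2" "d1 \<noteq> d3" "d2 \<noteq> d3"
    and z: "z$1 \<noteq> 0" "z$2 \<noteq> 0" "z$3 \<noteq> 0"
    and a: "z$2 * z$3 - w$1 \<noteq> 0" "z$1 * z$3 - w$2 \<noteq> 0" "z$1 * z$2 - w$3 \<noteq> 0"
  shows "\<exists>X. \<forall>i\<in>sidx m. sinv X i = Phi l d1 d2 d3 z w k h i"
proof -
  \<comment> \<open>The products of opposite entries of \<open>Z\<close> that the diagonal
    \<open>w\<close> of its adjugate forces.\<close>
  define a1 a2 a3 where a_def: "a1 = z$2 * z$3 - w$1" "a2 = z$1 * z$3 - w$2" "a3 = z$1 * z$2 - w$3"
  define k' where "k' = k - (z$1 * z$2 * z$3 - z$1 * a1 - z$2 * a2 - z$3 * a3)"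
  obtain u where u: "u * u - k' * u + a1 * a2 * a3 = 0" using quadratic_root by blast
  have an: "a1 \<noteq> 0" "a2 \<noteq> 0" "a3 \<noteq> 0" using a by (simp_all add: a_def)
  then have u0: "u \<noteq> 0" using u by auto
  have uk: "u + a1 * a2 * a3 / u = k'" using u u0 by (simp add: field_simps)
  define Z where "Z = mat3 (z$1) 1 (a2 / u) a3 (z$2) 1 u a1 (z$3)"
  define D where "D = mat3 d1 0 0 0 d2 0 0 0 d3"
  have Znz: "Z$i$j \<noteq> 0" for i j
    using exhaust_3[of i] exhaust_3[of j] z an u0 by (auto simp: Z_def)
  \<comment> \<open>The trace for \<open>H j\<close> is a sum over \<open>r\<close> and
    \<open>i\<close> of terms \<open>Z$i$r * H j $r$i\<close> weighted by the \<open>q\<close>-th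
    power of the \<open>r\<close>-th and the \<open>p\<close>-th power of the \<open>i\<close>-th
    eigenvalue. It is solved in two stages, in \<open>q\<close> for the vectors \<open>e\<close>,
    then in \<open>p\<close> for the products \<open>c\<close>; dividing by the nonzero entries of
    \<open>Z\<close> gives \<open>H j\<close>.\<close>
  define e :: "nat \<Rightarrow> nat \<Rightarrow> complex^3" where
    "e j p = (SOME e. \<forall>q<3. d1 ^ q * e$1 + d2 ^ q * e$2 + d3 ^ q * e$3 = h (j, p, q))" for j p
  have "\<forall>q<3. d1 ^ q * e j p $1 + d2 ^ q * e j p $2 + d3 ^ q * e j p $3 = h (j, p, q)" for j p
    unfolding e_def by (rule someI_ex) (rule vandermonde3[OF d])
  then have e: "d1 ^ q * e j p $1 + d2 ^ q * e j p $2 + d3 ^ q * e j p $3 = h (j, p, q)" if "q < 3" for j p q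
    using that by blast
  define c :: "nat \<Rightarrow> 3 \<Rightarrow> complex^3" where
    "c j r = (SOME c. \<forall>p<3. d1 ^ p * c$1 + d2 ^ p * c$2 + d3 ^ p * c$3 = e j p $ r)" for j r
  have "\<forall>p<3. d1 ^ p * c j r $1 + d2 ^ p * c j r $2 + d3 ^ p * c j r $3 = e j p $ r" for j r
    unfolding c_def by (rule someI_ex) (rule vandermonde3[OF d])
  then have c: "d1 ^ p * c j r $1 + d2 ^ p * c j r $2 + d3 ^ p * c j r $3 = e j p $ r" if "p < 3" for j r p
    using that by blast
  define H where "H j = (\<chi> r i. c j r $ i / Z $ i $ r)" for j
  define X where "X n = (if n = 0 then mat l else cscale (1 / (l * l)) (if n = 1 then D else if n = 2 then Z else H n))" for n
  have adjX0: "adj3 (X 0) = mat (l * l)"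
    by (rule mat3_eqI) (simp_all add: X_def adj3_nth mat_nth3)
  have X: "adj3 (X 0) ** X n = (if n = 1 then D else if n = 2 then Z else H n)" if "n \<noteq> 0" for n
    using that l by (simp add: adjX0 mat_mult_left) (simp add: X_def cscale_cscale)
  have detZ: "det Z = k"
  proof -
    have "det Z = z$1 * z$2 * z$3 - z$1 * a1 - z$2 * a2 - z$3 * a3 + (u + a1 * a2 * a3 / u)"
      using u0 by (simp add: Z_def det_3 field_simps)
    then show ?thesis by (simp add: uk k'_def)
  qed
  have adjZ: "adj3 Z $1$1 = w$1" "adj3 Z $2$2 = w$2" "adj3 Z $3$3 = w$3"
    using u0 by (simp_all add: adj3_nth Z_def a_def)
  have word: "trace (mpw D p ** Z ** mpw D q ** H j) = h (j, p, q)" if "p < 3" "q < 3" for j p q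
  proof -
    have HZ: "Z $ i $ r * H j $ r $ i = c j r $ i" for i r using Znz by (simp add: H_def)
    have "trace (mpw D p ** Z ** mpw D q ** H j) =
      d1 ^ q * (d1 ^ p * (Z$1$1 * H j $1$1) + d2 ^ p * (Z$2$1 * H j $1$2) + d3 ^ p * (Z$3$1 * H j $1$3)) +
      d2 ^ q * (d1 ^ p * (Z$1$2 * H j $2$1) + d2 ^ p * (Z$2$2 * H j $2$2) + d3 ^ p * (Z$3$2 * H j $2$3)) +
      d3 ^ q * (d1 ^ p * (Z$1$3 * H j $3$1) + d2 ^ p * (Z$2$3 * H j $3$2) + d3 ^ p * (Z$3$3 * H j $3$3))"
      by (simp add: trace3 mult3_nth D_def mpw_diag algebra_simps)
    also have "\<dots> = h (j, p, q)" unfolding HZ c[OF that(1)] e[OF that(2)] ..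
    finally show ?thesis .
  qed
  have "sinv X i = Phi l d1 d2 d3 z w k h i" if i: "i \<in> sidx m" for i
  proof -
    obtain j p q where ijk: "i = (j, p, q)" by (cases i)
    consider "j = 0" | "j = 1" | "j = 2" | "j \<ge> 3" "p < 3" "q < 3"
      using i by (auto simp: ijk sidx_def)
    then show ?thesis
    proof cases
      case 1
      then show ?thesis by (simp add: ijk sinv_def Phi_def X_def det_3 mat_nth3 power3_eq_cube)
    next
      case 2
      then show ?thesis unfolding ijk sinv_def Phi_def prod.case Let_def using X[of 1]
        by (simp add: D_def trace3 adj3_nth det_3)
    next
      case 3
      then show ?thesis unfolding ijk sinv_def Phi_def prod.case Let_def using X[of 1] X[of 2]
        by (simp add: D_def mpw_diag trace3 mult3_nth adjZ detZ) (simp add: Z_def)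
    next
      case 4
      then have "sinv X i = trace (mpw D p ** Z ** mpw D q ** H j)"
        unfolding ijk sinv_def prod.case Let_def using X[of 1] X[of 2] X[of j] by simp
      then show ?thesis using word 4 by (simp add: ijk Phi_def)
    qed
  qed
  then show ?thesis by blast
qed

text \<open>Generic values are attained by tuples, so \<open>Q\<close> vanishes there, and
  continuity extends this to every point \<open>y\<close>. There are two perturbations because
  \<open>z\<close> and \<open>w\<close> can be solved for only once the eigenvalues are
  distinct.\<close>

theorem sinv_independent:
  assumes Q: "poly_vars Q \<subseteq> sidx m" "\<And>X. eval (sinv X) Q = 0"
  shows "Q = 0"
proof (rule cpoly_eqI_eval_0)
  fix y :: "nat \<times> nat \<times> nat \<Rightarrow> complex"
  have stage1: "eval (Phi l d1 d2 d3 z w k h) Q = 0"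
    if l: "l \<noteq> 0" and d: "d1 \<noteq> d2" "d1 \<noteq> d3" "d2 \<noteq> d3" for l d1 d2 d3 z w k h
  proof -
    \<comment> \<open>Moving all coordinates of \<open>z\<close> by the same \<open>t\<close> turns
      each condition of \<open>Phi_attained\<close> on \<open>z\<close> and \<open>w\<close> into
      the nonvanishing of a monic polynomial in \<open>t\<close>.\<close>
    define zt where "zt t = (\<chi> i. z $ i + t)" for t
    define q where "q = [:z$1, 1:] * [:z$2, 1:] * [:z$3, 1:] * [:z$2 * z$3 - w$1, z$2 + z$3, 1:] *
      [:z$1 * z$3 - w$2, z$1 + z$3, 1:] * [:z$1 * z$2 - w$3, z$1 + z$2, 1:]"
    have "q \<noteq> 0" by (simp add: q_def del: mult_pCons_left mult_pCons_right)
    then have ev: "\<forall>\<^sub>F t in at 0. poly q t \<noteq> 0" by (rule poly_eventually_nonzero)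
    have "eval (Phi l d1 d2 d3 (zt t) w k h) Q = 0" if t: "poly q t \<noteq> 0" for t
    proof -
      have nz: "z$1 + t \<noteq> 0" "z$2 + t \<noteq> 0" "z$3 + t \<noteq> 0" "(z$2 + t) * (z$3 + t) - w$1 \<noteq> 0"
        "(z$1 + t) * (z$3 + t) - w$2 \<noteq> 0" "(z$1 + t) * (z$2 + t) - w$3 \<noteq> 0"
      proof -
        have p1: "poly [:a, 1:] t = a + t" for a by simp
        have p2: "poly [:a * b - c, a + b, 1:] t = (a + t) * (b + t) - c" for a b c
          by (simp add: algebra_simps)
        show "z$1 + t \<noteq> 0" "z$2 + t \<noteq> 0" "z$3 + t \<noteq> 0" "(z$2 + t) * (z$3 + t) - w$1 \<noteq> 0"
          "(z$1 + t) * (z$3 + t) - w$2 \<noteq> 0" "(z$1 + t) * (z$2 + t) - w$3 \<noteq> 0"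
          using t unfolding q_def poly_mult p1 p2 by simp_all
      qed
      have "\<exists>X. \<forall>i\<in>sidx m. sinv X i = Phi l d1 d2 d3 (zt t) w k h i"
        by (rule Phi_attained[OF l d]) (use nz in \<open>simp_all add: zt_def\<close>)
      then obtain X where X: "\<forall>i\<in>sidx m. sinv X i = Phi l d1 d2 d3 (zt t) w k h i" by (elim exE)
      have "eval (Phi l d1 d2 d3 (zt t) w k h) Q = eval (sinv X) Q"
        by (rule eval_cong) (use Q(1) X in auto)
      then show ?thesis by (simp add: Q(2))
    qed
    then have "\<forall>\<^sub>F t in at 0. eval (Phi l d1 d2 d3 (zt t) w k h) Q = 0"
      by (rule eventually_mono[OF ev])
    then have "eval (Phi l d1 d2 d3 (zt 0) w k h) Q = 0"
    proof (rule eval_perturb[rotated])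
      fix x :: "nat \<times> nat \<times> nat"
      obtain j p q where "x = (j, p, q)" by (cases x)
      then show "isCont (\<lambda>t. Phi l d1 d2 d3 (zt t) w k h x) 0"
        by (cases "j = 0"; cases "j = 1"; cases "j = 2"; cases "p = 0"; cases "p = 1") (simp_all add: Phi_def zt_def)
    qed
    moreover have "zt 0 = z" by (simp add: zt_def vec_eq_iff)
    ultimately show ?thesis by simp
  qed
  obtain l where l: "l ^ 3 = y (0, 0, 0)" using cube_root_exists by blast
  obtain d1 d2 d3 where d: "d1 + d2 + d3 = y (1, 0, 0)" "d1 * d2 + d1 * d3 + d2 * d3 = y (1, 1, 0)"
    "d1 * d2 * d3 = y (1, 2, 0)" using cubic_roots by blast
  \<comment> \<open>The shifts 0, \<open>t\<close> and \<open>2 * t\<close> separate the three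
    eigenvalues whatever they are. Only coordinates with \<open>j \<le> 1\<close> move: the rest of
    \<open>y\<close> is met exactly, by solving for \<open>z\<close> and \<open>w\<close> anew for
    each \<open>t\<close>.\<close>
  define \<sigma> where "\<sigma> t = (\<lambda>(j, p, q).
     if j = 0 then (l + t) ^ 3
     else if j = 1 then (if p = 0 then d1 + (d2 + t) + (d3 + 2 * t)
       else if p = 1 then d1 * (d2 + t) + d1 * (d3 + 2 * t) + (d2 + t) * (d3 + 2 * t) else d1 * (d2 + t) * (d3 + 2 * t))
     else y (j, p, q))" for t
  define q where "q = [:l, 1:] * [:d2 - d1, 1:] * [:d3 - d1, 2:] * [:d3 - d2, 1:]"
  have "q \<noteq> 0" by (simp add: q_def del: mult_pCons_left mult_pCons_right)
  then have ev: "\<forall>\<^sub>F t in at 0. poly q t \<noteq> 0" by (rule poly_eventually_nonzero)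
  have "eval (\<sigma> t) Q = 0" if t: "poly q t \<noteq> 0" for t
  proof -
    have nz: "l + t \<noteq> 0" "d1 \<noteq> d2 + t" "d1 \<noteq> d3 + 2 * t" "d2 + t \<noteq> d3 + 2 * t"
    proof -
      have p: "poly [:a, b:] t = a + b * t" for a b by (simp add: mult.commute)
      have "l + t \<noteq> 0" "d2 - d1 + t \<noteq> 0" "d3 - d1 + 2 * t \<noteq> 0" "d3 - d2 + t \<noteq> 0"
        using t unfolding q_def poly_mult p by simp_all
      then show "l + t \<noteq> 0" "d1 \<noteq> d2 + t" "d1 \<noteq> d3 + 2 * t" "d2 + t \<noteq> d3 + 2 * t"
        by (auto simp: algebra_simps)
    qed
    obtain z :: "complex^3" where z: "\<forall>q<3. d1 ^ q * z$1 + (d2 + t) ^ q * z$2 + (d3 + 2 * t) ^ q * z$3 = y (2, 0, q)"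
      using vandermonde3[OF nz(2-4), of "\<lambda>q. y (2, 0, q)"] by (elim exE)
    obtain w :: "complex^3" where w: "\<forall>q<3. d1 ^ q * w$1 + (d2 + t) ^ q * w$2 + (d3 + 2 * t) ^ q * w$3 = y (2, 1, q)"
      using vandermonde3[OF nz(2-4), of "\<lambda>q. y (2, 1, q)"] by (elim exE)
    have "eval (\<sigma> t) Q = eval (Phi (l + t) d1 (d2 + t) (d3 + 2 * t) z w (y (2, 2, 0)) y) Q"
    proof (rule eval_cong)
      fix x assume "x \<in> poly_vars Q"
      then have "x \<in> sidx m" using Q(1) by blast
      then show "\<sigma> t x = Phi (l + t) d1 (d2 + t) (d3 + 2 * t) z w (y (2, 2, 0)) y x"
        using z w by (auto simp: sidx_def \<sigma>_def Phi_def)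
    qed
    then show ?thesis using stage1[OF nz] by simp
  qed
  then have "\<forall>\<^sub>F t in at 0. eval (\<sigma> t) Q = 0" by (rule eventually_mono[OF ev])
  then have "eval (\<sigma> 0) Q = 0"
  proof (rule eval_perturb[rotated])
    fix x :: "nat \<times> nat \<times> nat"
    obtain j p q where "x = (j, p, q)" by (cases x)
    then show "isCont (\<lambda>t. \<sigma> t x) 0"
      by (cases "j = 0"; cases "j = 1"; cases "p = 0"; cases "p = 1") (simp_all add: \<sigma>_def)
  qed
  moreover have "eval (\<sigma> 0) Q = eval y Q"
  proof (rule eval_cong)
    fix x assume "x \<in> poly_vars Q"
    then have "x \<in> sidx m" using Q(1) by blast
    then show "\<sigma> 0 x = y x"
      using l d by (auto simp: sidx_def \<sigma>_def numeral_3_eq_3 numeral_2_eq_2 less_Suc_eq)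
  qed
  ultimately show "eval y Q = 0" by simp
qed

section \<open>The lower bound\<close>

lemma degree_mpow:
  assumes "\<And>x v. x \<in> keys u \<Longrightarrow> v \<in> keys (f x) \<Longrightarrow> monom_degree v \<le> D"
    and "v \<in> keys (mpow f u :: 'x cpoly)"
  shows "monom_degree v \<le> D * monom_degree u"
  using assms
proof (induction u arbitrary: v rule: monom_induct)
  case zero
  then show ?case by simp
next
  case (step x u)
  have "v \<in> keys (f x * mpow f u)" using step.prems(2) by (simp add: mpow_add)
  then obtain a b where ab: "v = a + b" "a \<in> keys (f x)" "b \<in> keys (mpow f u)"
    using Poly_Mapping.keys_mult[of "f x" "mpow f u"] by blast
  have "monom_degree a \<le> D" using step.prems(1)[of x a] ab(2) by (simp add: keys_plus_nat)
  moreover have "monom_degree b \<le> D * monom_degree u"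
    using step.prems(1) ab(3) by (intro step.IH) (auto simp: keys_plus_nat)
  ultimately show ?case by (simp add: ab(1) monom_degree_add)
qed

definition module_gens :: "entry cpoly set \<Rightarrow> entry cpoly set \<Rightarrow> nat \<Rightarrow> entry cpoly set" where
  "module_gens F G d = (\<lambda>(h, u). mpow (\<lambda>f. f) u * h) ` (G \<times> monom_box F (Suc d))"

lemma null_system_module:
  assumes F: "finite F" "F \<subseteq> semi6 m"
    and Z: "\<And>\<sigma> f. (\<forall>f\<in>F. eval \<sigma> f = 0) \<Longrightarrow> f \<in> semi6 m \<Longrightarrow> eval \<sigma> f = 0"
  shows "\<exists>G. finite G \<and> G \<subseteq> matrix_semi_invariants m \<and>
    (\<forall>d. \<forall>f\<in>matrix_semi_invariants m. homogeneous d f \<longrightarrow> f \<in> cspan (module_gens F G d))"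
proof -
  interpret selfadjoint_family same_matrix "entries m" sl_family by (rule selfadjoint)
  have "\<exists>G. finite G \<and> G \<subseteq> invs \<and> (\<forall>d. \<forall>f\<in>invs. homogeneous d f \<longrightarrow>
    f \<in> cspan ((\<lambda>(h, u). mpow (\<lambda>f. f) u * h) ` (G \<times> monom_box F (Suc d))))"
  proof (rule invs_finite_module[OF F(1), of 6])
    show "F \<subseteq> invs" "\<And>f. f \<in> F \<Longrightarrow> homogeneous 6 f" using F(2) by (auto simp: invs_eq semi6_def)
    fix \<sigma> g d assume "\<And>f. f \<in> F \<Longrightarrow> eval \<sigma> f = 0" and g: "g \<in> invs" "homogeneous d g" "d > 0"
    then have "\<forall>f\<in>F. eval \<sigma> f = 0" by blast
    from Z[OF this] show "eval \<sigma> g = 0" using g by (intro nullcone_degree6[of m \<sigma> g d]) (auto simp: invs_eq)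
  qed simp
  then show ?thesis by (simp add: invs_eq module_gens_def)
qed

lemma card_module_gens:
  assumes "finite F" "finite G"
  shows "finite (module_gens F G d)" "card (module_gens F G d) \<le> card G * Suc d ^ card F"
proof -
  have fin: "finite (G \<times> monom_box F (Suc d))" using assms by (simp add: finite_monom_box)
  then show "finite (module_gens F G d)" by (simp add: module_gens_def)
  have "card (module_gens F G d) \<le> card (G \<times> monom_box F (Suc d))"
    unfolding module_gens_def by (rule card_image_le[OF fin])
  then show "card (module_gens F G d) \<le> card G * Suc d ^ card F"
    using assms by (simp add: card_cartesian_product card_monom_box)
qed

text \<open>The products of the independent invariants \<open>sinv\<close> with exponents below
  \<open>N\<close> have degree at most a constant times \<open>N\<close>. They lie in a space
  spanned by at most a constant multiple of \<open>N ^ card F\<close> elements, while their number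
  is \<open>N ^ card (sidx m)\<close>, so the exponents compare.\<close>

theorem module_card_lower:
  assumes m: "m \<ge> 3" and F: "finite F" and G: "finite G"
    and gen: "\<forall>d. \<forall>f\<in>matrix_semi_invariants m. homogeneous d f \<longrightarrow> f \<in> cspan (module_gens F G d)"
  shows "9 * m - 16 \<le> card F"
proof -
  let ?s = "card (sidx m)"
  have fs: "finite (sidx m)" by (rule sidx_card(1)[OF m])
  have "\<forall>i. \<exists>D. \<forall>v\<in>keys (sinv gmat i). monom_degree v \<le> D"
    using ex_degree_bound by blast
  then obtain Di where Di: "\<And>i v. v \<in> keys (sinv gmat i) \<Longrightarrow> monom_degree v \<le> Di i" by metis
  define D where "D = (\<Sum>i\<in>sidx m. Di i)"
  have D: "monom_degree v \<le> D" if "i \<in> sidx m" "v \<in> keys (sinv gmat i)" for i v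
    using Di[OF that(2)] member_le_sum[OF that(1), of Di] fs by (simp add: D_def)
  have "N ^ ?s \<le> card G * ((D * ?s + 1) * N) ^ card F" if N: "N \<ge> 1" for N
  proof (rule ccontr)
    assume no: "\<not> ?thesis"
    define I where "I = monom_box (sidx m) N"
    define M where "M = D * (?s * N)"
    define f where "f u = mpow (sinv gmat) u" for u :: "nat \<times> nat \<times> nat \<Rightarrow>\<^sub>0 nat"
    have finI: "finite I" using fs by (simp add: I_def finite_monom_box)
    have mono: "module_gens F G e \<subseteq> module_gens F G M" if "e \<le> M" for e
      using that by (fastforce simp: module_gens_def monom_box_def)
    have fu: "f u \<in> cspan (module_gens F G M)" if u: "u \<in> I" for u
    proof -
      have inv: "f u \<in> matrix_semi_invariants m"
      proof -
        interpret selfadjoint_family same_matrix "entries m" sl_family by (rule selfadjoint)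
        have "f u \<in> invs" unfolding f_def
          using u sinv_in[OF m] by (intro invs_mpow) (auto simp: invs_eq I_def monom_box_def)
        then show ?thesis by (simp add: invs_eq)
      qed
      have "monom_degree v \<le> M" if v: "v \<in> keys (f u)" for v
      proof -
        have "monom_degree v \<le> D * monom_degree u"
          using u v D by (intro degree_mpow[of u "sinv gmat"]) (auto simp: f_def I_def monom_box_def)
        also have "\<dots> \<le> M" unfolding M_def
          using monom_degree_box[OF fs, of u N] u by (intro mult_le_mono2) (simp add: I_def)
        finally show ?thesis .
      qed
      \<comment> \<open>The spanning sets are given degree by degree; they increase with the degree,
        so that of \<open>M\<close> serves for all components.\<close>
      then have "f u = (\<Sum>e\<le>M. hcomp e (f u))" by (rule hcomp_decomp)
      moreover have "hcomp e (f u) \<in> cspan (module_gens F G M)" if "e \<le> M" for e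
        using gen semi_hcomp[OF inv] cspan_mono[OF mono[OF that]] by blast
      then have "(\<Sum>e\<le>M. hcomp e (f u)) \<in> cspan (module_gens F G M)" by (intro cspan_sum) simp
      ultimately show ?thesis by simp
    qed
    have "Suc M \<le> (D * ?s + 1) * N" using N by (simp add: M_def algebra_simps)
    then have "card G * Suc M ^ card F \<le> card G * ((D * ?s + 1) * N) ^ card F"
      by (intro mult_le_mono2 power_mono) simp_all
    with card_module_gens(2)[OF F G, of M] have "card (module_gens F G M) \<le> card G * ((D * ?s + 1) * N) ^ card F"
      by (rule order_trans)
    also have "\<dots> < N ^ ?s" using no by (simp only: not_le)
    finally have "card (module_gens F G M) < card I" by (simp add: I_def card_monom_box[OF fs])
    then have "\<exists>c. (\<exists>u\<in>I. c u \<noteq> 0) \<and> (\<Sum>u\<in>I. const_poly (c u) * f u) = 0"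
      by (rule cspan_dependent[OF card_module_gens(1)[OF F G] finI]) (rule fu)
    then obtain c where c: "\<exists>u\<in>I. c u \<noteq> 0" "(\<Sum>u\<in>I. const_poly (c u) * f u) = 0" by (elim exE conjE)
    define Q where "Q = (\<Sum>u\<in>I. single u (c u))"
    have "Q = 0"
    proof (rule sinv_independent)
      have "Q \<in> cpolys_in (sidx m)" unfolding Q_def
        by (intro cpolys_in_sum) (auto simp: cpolys_in_iff I_def monom_box_def split: if_splits)
      then show "poly_vars Q \<subseteq> sidx m" by (simp add: cpolys_in_def)
      have "sbst (sinv gmat) Q = 0"
        using c(2) by (simp add: Q_def sb.subst_sum sb.subst_single f_def)
      moreover have "eval (sinv X) Q = eval (pt X) (sbst (sinv gmat) Q)" for X
        unfolding eval_sbst eval_sinv ..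
      ultimately show "eval (sinv X) Q = 0" for X by (simp add: eval_simps)
    qed
    obtain u where "u \<in> I" "c u \<noteq> 0" using c(1) by blast
    then have "lookup Q u \<noteq> 0" by (simp add: Q_def lookup_sum_single[OF finI])
    then show False using \<open>Q = 0\<close> by simp
  qed
  then have "?s \<le> card F" by (rule growth_exponent_le)
  then show ?thesis by (simp add: sidx_card(2)[OF m])
qed

section \<open>From spanning in each degree to a finitely generated module\<close>

lemma generated_subalgebra_closed:
  "p \<in> generated_subalgebra F \<Longrightarrow> q \<in> generated_subalgebra F \<Longrightarrow> p + q \<in> generated_subalgebra F"
  "keys u \<subseteq> F \<Longrightarrow> const_poly c * mpow (\<lambda>f. f) u \<in> generated_subalgebra F"
  "0 \<in> generated_subalgebra F"
proof -
  have iff: "p \<in> generated_subalgebra F \<longleftrightarrow> (\<exists>P\<in>cpolys_in F. p = sbst (\<lambda>f. f) P)" for p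
    by (auto simp: generated_subalgebra_def cpolys_in_def)
  show "p \<in> generated_subalgebra F \<Longrightarrow> q \<in> generated_subalgebra F \<Longrightarrow> p + q \<in> generated_subalgebra F"
    unfolding iff by (metis cpolys_in_add sb.subst_add)
  show "0 \<in> generated_subalgebra F"
    unfolding iff by (intro bexI[of _ 0]) (simp_all add: sb.subst_0)
  assume "keys u \<subseteq> F"
  then show "const_poly c * mpow (\<lambda>f. f) u \<in> generated_subalgebra F"
    unfolding iff by (intro bexI[of _ "single u c"])
      (auto simp: sb.subst_single cpolys_in_iff split: if_splits)
qed

text \<open>Each spanning element is a monomial in \<open>F\<close> times some
  \<open>h \<in> G\<close>; collecting the monomials that belong to the same \<open>h\<close> gives
  coefficients in the subalgebra.\<close>

lemma null_system_finitely_generated: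
  assumes F: "F \<subseteq> matrix_semi_invariants m" and G: "finite G" "G \<subseteq> matrix_semi_invariants m"
    and gen: "\<forall>d. \<forall>f\<in>matrix_semi_invariants m. homogeneous d f \<longrightarrow> f \<in> cspan (module_gens F G d)"
  shows "finitely_generated_module (generated_subalgebra F) (matrix_semi_invariants m)"
proof -
  interpret selfadjoint_family same_matrix "entries m" sl_family by (rule selfadjoint)
  define S where "S = {\<Sum>g\<in>G. c g * g | c. \<forall>g\<in>G. c g \<in> generated_subalgebra F}"
  have SI: "(\<Sum>g\<in>G. c g * g) \<in> S" if "\<And>g. g \<in> G \<Longrightarrow> c g \<in> generated_subalgebra F" for c
    unfolding S_def using that by (intro CollectI exI[of _ c] conjI ballI refl)
  have SE: "\<exists>c. (\<forall>g\<in>G. c g \<in> generated_subalgebra F) \<and> p = (\<Sum>g\<in>G. c g * g)" if "p \<in> S" for p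
    using that unfolding S_def by (elim CollectE exE conjE) (intro exI conjI)
  have sub: "generated_subalgebra F \<subseteq> invs"
  proof
    fix p assume "p \<in> generated_subalgebra F"
    then obtain P where P: "p = sbst (\<lambda>f. f) P" "poly_vars P \<subseteq> F" by (auto simp: generated_subalgebra_def)
    show "p \<in> invs" unfolding P(1) poly_subst_def
      using P(2) F by (intro invs_sum invs_mult invs_const invs_prod invs_power) (auto simp: poly_vars_def invs_eq)
  qed
  have add: "p + q \<in> S" if p: "p \<in> S" and q: "q \<in> S" for p q
  proof -
    obtain a where a: "\<forall>g\<in>G. a g \<in> generated_subalgebra F" "p = (\<Sum>g\<in>G. a g * g)"
      using SE[OF p] by (elim exE conjE)
    obtain b where b: "\<forall>g\<in>G. b g \<in> generated_subalgebra F" "q = (\<Sum>g\<in>G. b g * g)"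
      using SE[OF q] by (elim exE conjE)
    have "(\<Sum>g\<in>G. (a g + b g) * g) \<in> S"
      using a(1) b(1) by (intro SI generated_subalgebra_closed(1)) auto
    then show ?thesis by (simp add: a(2) b(2) distrib_right sum.distrib)
  qed
  have zero: "0 \<in> S"
    using SI[of "\<lambda>_. 0"] by (simp add: generated_subalgebra_closed(3))
  have span: "p \<in> S" if "p \<in> cspan (module_gens F G d)" for p d
    using that
  proof induction
    case cspan_0
    show ?case by (rule zero)
  next
    case (cspan_step a p c)
    obtain h u where hu: "h \<in> G" "keys u \<subseteq> F" "a = mpow (\<lambda>f. f) u * h"
    proof -
      obtain x where "x \<in> G \<times> monom_box F (Suc d)" "a = (\<lambda>(h, u). mpow (\<lambda>f. f) u * h) x"
        using cspan_step(1) unfolding module_gens_def by (elim imageE)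
      then show thesis by (intro that[of "fst x" "snd x"]) (auto simp: monom_box_def)
    qed
    have "(\<Sum>g\<in>G. (if g = h then const_poly c * mpow (\<lambda>f. f) u else 0) * g) =
        (\<Sum>g\<in>G. if g = h then const_poly c * mpow (\<lambda>f. f) u * g else 0)"
      by (intro sum.cong) auto
    also have "\<dots> = const_poly c * a" using hu(1) G(1) by (simp add: hu(3) mult.assoc)
    finally have e: "(\<Sum>g\<in>G. (if g = h then const_poly c * mpow (\<lambda>f. f) u else 0) * g) = const_poly c * a" .
    have "(\<Sum>g\<in>G. (if g = h then const_poly c * mpow (\<lambda>f. f) u else 0) * g) \<in> S"
      by (rule SI) (simp add: generated_subalgebra_closed(2)[OF hu(2)] generated_subalgebra_closed(3))
    then show ?case unfolding e by (rule add[OF _ cspan_step(3)])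
  qed
  have "matrix_semi_invariants m \<subseteq> S"
  proof
    fix p :: "entry cpoly" assume p: "p \<in> matrix_semi_invariants m"
    obtain D where D: "p = (\<Sum>d\<le>D. hcomp d p)" using ex_hcomp_decomp by blast
    have c: "hcomp d p \<in> S" for d
      by (rule span[of _ d]) (use gen semi_hcomp[OF p] in blast)
    have "(\<Sum>d\<in>A. hcomp d p) \<in> S" for A
      by (induction A rule: infinite_finite_induct) (simp_all add: zero add c)
    from this[of "{..D}"] show "p \<in> S" using D by simp
  qed
  moreover have "S \<subseteq> matrix_semi_invariants m"
  proof
    fix p assume "p \<in> S"
    from SE[OF this] obtain c where c: "\<forall>g\<in>G. c g \<in> generated_subalgebra F" "p = (\<Sum>g\<in>G. c g * g)"
      by (elim exE conjE)
    then show "p \<in> matrix_semi_invariants m"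
      using sub G(2) unfolding invs_eq[symmetric] c(2) by (intro invs_sum invs_mult) auto
  qed
  ultimately have "matrix_semi_invariants m = S" by (rule antisym)
  then show ?thesis unfolding finitely_generated_module_def S_def using G
    by (intro exI[of _ G] conjI)
qed

theorem proposition1p12:
  fixes m :: nat
  assumes "m \<ge> 3"
  shows "\<exists>F :: (nat \<times> 3 \<times> 3) cpoly set.
           card F = 9 * m - 16 \<and> (\<forall>f\<in>F. homogeneous 6 f) \<and>
           hsop (matrix_semi_invariants m) F"
proof -
  obtain F where F: "finite F" "F \<subseteq> semi6 m" "alg_independent F"
    and Z: "\<forall>\<sigma>. (\<forall>f\<in>F. eval \<sigma> f = 0) \<longrightarrow> (\<forall>f\<in>semi6 m. eval \<sigma> f = 0)"
    using independent_null_system[of m] by (elim exE conjE)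
  obtain G where G: "finite G" "G \<subseteq> matrix_semi_invariants m"
    and gen: "\<forall>d. \<forall>f\<in>matrix_semi_invariants m. homogeneous d f \<longrightarrow> f \<in> cspan (module_gens F G d)"
    using null_system_module[OF F(1,2)] Z by (metis (no_types, lifting))
  have FR: "F \<subseteq> matrix_semi_invariants m" and hom: "\<forall>f\<in>F. homogeneous 6 f"
    using F(2) by (auto simp: semi6_def)
  \<comment> \<open>Algebraic independence bounds the size from above, finite generation of the
    module from below.\<close>
  have "card F = 9 * m - 16"
    using independent_card_upper[OF assms F] module_card_lower[OF assms F(1) G(1) gen] by (rule antisym)
  moreover have "hsop (matrix_semi_invariants m) F"
    unfolding hsop_def using F(1,3) FR hom null_system_finitely_generated[OF FR G gen] by blast
  ultimately show ?thesis using hom by blast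
qed

end
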